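(* Let $(\mathcal C,\mathcal D)$ be a regular MASA inclusion, let $r:\operatorname{Mod}(\mathcal C,\mathcal D)\to\hat{\mathcal D}$ be the restriction map $r(\rho)=\rho|_{\mathcal D}$, and suppose $F\subseteq\operatorname{Mod}(\mathcal C,\mathcal D)$ is closed and $r(F)=\hat{\mathcal D}$. Then $\mathfrak S_s(\mathcal C,\mathcal D)\subseteq F$. Suppose further that there exists a countable subset $N\subseteq\mathcal N(\mathcal C,\mathcal D)$ such that the norm-closed $\mathcal D$-bimodule generated by $N$ is $\mathcal C$, and set $$\mathfrak U(\mathcal C,\mathcal D):=\{\rho\in\operatorname{Mod}(\mathcal C,\mathcal D):\rho|_{\mathcal D}\text{ has a unique state extension to }\mathcal C\}.$$ Then $\mathfrak S_s(\mathcal C,\mathcal D)=\overline{\mathfrak U(\mathcal C,\mathcal D)}^{\text{w-}*}$.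
   Context: All $C^*$-algebras are unital. An inclusion is a pair $(\mathcal C,\mathcal D)$ where $\mathcal C$ is a unital $C^*$-algebra and $\mathcal D\subseteq\mathcal C$ is an abelian $C^*$-subalgebra containing the unit of $\mathcal C$. Its normalizers are $\mathcal N(\mathcal C,\mathcal D)=\{v\in\mathcal C: v^*\mathcal Dv\cup v\mathcal Dv^*\subseteq\mathcal D\}$. The inclusion is regular if $\operatorname{span}\mathcal N(\mathcal C,\mathcal D)$ is norm dense in $\mathcal C$, and a MASA inclusion if $\mathcal D$ is a maximal abelian $C^*$-subalgebra of $\mathcal C$; a regular MASA inclusion is both. For an abelian $C^*$-algebra $\mathcal B$, $\hat{\mathcal B}$ is its character space. $\operatorname{Mod}(\mathcal C,\mathcal D)=\{\rho\text{ a state on }\mathcal C:\rho|_{\mathcal D}\in\hat{\mathcal D}\}$ with the relative weak-$*$ topology. An injective envelope of $\mathcal D$ is a pair $(I(\mathcal D),\iota)$ with $I(\mathcal D)$ an injective unital abelian $C^*$-algebra and $\iota:\mathcal D\to I(\mathcal D)$ a unital injective $*$-homomorphism which is a rigid and essential extension. For a regular MASA inclusion there is a unique unital completely positive map $E:\mathcal C\to I(\mathcal D)$ with $E|_{\mathcal D}=\iota$ (the pseudo-expectation). The set of strongly compatible states is $\mathfrak S_s(\mathcal C,\mathcal D)=\{\rho\circ E:\rho\in\widehat{I(\mathcal D)}\}\subseteq\operatorname{Mod}(\mathcal C,\mathcal D)$. *)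

theory Defs
  imports "HOL-Analysis.Analysis" "HOL-Algebra.Module"
begin

section \<open>Unital C*-algebras as types\<close>

text \<open>
  The axiom \<open>norm 1 = 1\<close> inherited from \<^class>\<open>real_normed_algebra_1\<close> excludes exactly the
  zero algebra, which has no states and no characters.
\<close>

class cstar_algebra = real_normed_algebra_1 + banach +
  fixes scaleC :: "complex \<Rightarrow> 'a \<Rightarrow> 'a"
    and star :: "'a \<Rightarrow> 'a"
  assumes scaleC_add_right: "scaleC c (x + y) = scaleC c x + scaleC c y"
    and scaleC_add_left: "scaleC (c + d) x = scaleC c x + scaleC d x"
    and scaleC_scaleC: "scaleC c (scaleC d x) = scaleC (c * d) x"
    and scaleC_of_real: "scaleC (of_real r) x = scaleR r x"
    and mult_scaleC_left: "scaleC c x * y = scaleC c (x * y)"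
    and mult_scaleC_right: "x * scaleC c y = scaleC c (x * y)"
    and norm_scaleC: "norm (scaleC c x) = cmod c * norm x"
    and star_star: "star (star x) = x"
    and star_add: "star (x + y) = star x + star y"
    and star_scaleC: "star (scaleC c x) = scaleC (cnj c) (star x)"
    and star_mult: "star (x * y) = star y * star x"
    and cstar_identity: "norm (star x * x) = (norm x)\<^sup>2"

lemma scaleC_one: "scaleC 1 (x :: 'a::cstar_algebra) = x"
  using scaleC_of_real[of 1 x] by simp

global_interpretation complex_vector:
  vector_space "scaleC :: complex \<Rightarrow> 'a \<Rightarrow> 'a::cstar_algebra"
  by unfold_locales (simp_all add: scaleC_add_right scaleC_add_left scaleC_scaleC scaleC_one)


section \<open>Inclusions\<close>

definition commuting :: "'a::times set \<Rightarrow> bool" where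
  "commuting B \<longleftrightarrow> (\<forall>x\<in>B. \<forall>y\<in>B. x * y = y * x)"

definition unital_cstar_subalgebra :: "'a::cstar_algebra set \<Rightarrow> bool" where
  "unital_cstar_subalgebra B \<longleftrightarrow>
     complex_vector.subspace B \<and> 1 \<in> B \<and> (\<forall>x\<in>B. \<forall>y\<in>B. x * y \<in> B) \<and> (\<forall>x\<in>B. star x \<in> B) \<and>
     closed B"

text \<open>The ambient algebra of an inclusion is the whole type \<open>'a\<close>.\<close>

definition inclusion :: "'a::cstar_algebra set \<Rightarrow> bool" where
  "inclusion D \<longleftrightarrow> unital_cstar_subalgebra D \<and> commuting D"

definition normalizers :: "'a::cstar_algebra set \<Rightarrow> 'a set" where
  "normalizers D = {v. \<forall>d\<in>D. star v * d * v \<in> D \<and> v * d * star v \<in> D}"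

definition regular_inclusion :: "'a::cstar_algebra set \<Rightarrow> bool" where
  "regular_inclusion D \<longleftrightarrow> inclusion D \<and> closure (complex_vector.span (normalizers D)) = UNIV"

definition masa_inclusion :: "'a::cstar_algebra set \<Rightarrow> bool" where
  "masa_inclusion D \<longleftrightarrow> inclusion D \<and> (\<forall>B. inclusion B \<and> D \<subseteq> B \<longrightarrow> B = D)"

definition regular_masa_inclusion :: "'a::cstar_algebra set \<Rightarrow> bool" where
  "regular_masa_inclusion D \<longleftrightarrow> regular_inclusion D \<and> masa_inclusion D"

definition closed_bimodule :: "'a::cstar_algebra set \<Rightarrow> 'a set \<Rightarrow> bool" where
  "closed_bimodule D M \<longleftrightarrow>
     closed M \<and> complex_vector.subspace M \<and> (\<forall>d\<in>D. \<forall>x\<in>M. d * x \<in> M \<and> x * d \<in> M)"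


section \<open>Characters and states\<close>

text \<open>
  A functional on a subset \<open>B\<close> is represented by a function that is \<^const>\<open>undefined\<close> outside
  \<open>B\<close>, so that equality of functionals on \<open>B\<close> is equality of functions.
\<close>

definition characters :: "'a::cstar_algebra set \<Rightarrow> ('a \<Rightarrow> complex) set" where
  "characters B = {\<omega> \<in> extensional B.
     (\<forall>x\<in>B. \<forall>y\<in>B. \<omega> (x + y) = \<omega> x + \<omega> y) \<and>
     (\<forall>c. \<forall>x\<in>B. \<omega> (scaleC c x) = c * \<omega> x) \<and>
     (\<forall>x\<in>B. \<forall>y\<in>B. \<omega> (x * y) = \<omega> x * \<omega> y) \<and>
     \<omega> 1 = 1}"

definition state :: "('a::cstar_algebra \<Rightarrow> complex) \<Rightarrow> bool" where
  "state \<rho> \<longleftrightarrow>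
     Vector_Spaces.linear scaleC (*) \<rho> \<and> (\<forall>x. \<rho> (star x * x) \<in> \<real>\<^sub>\<ge>\<^sub>0) \<and> \<rho> 1 = 1"

definition Mod :: "'a::cstar_algebra set \<Rightarrow> ('a \<Rightarrow> complex) set" where
  "Mod D = {\<rho>. state \<rho> \<and> restrict \<rho> D \<in> characters D}"

text \<open>The relative weak-* topology is that of pointwise convergence.\<close>

definition Mod_topology :: "'a::cstar_algebra set \<Rightarrow> ('a \<Rightarrow> complex) topology" where
  "Mod_topology D = subtopology (product_topology (\<lambda>_. euclidean) UNIV) (Mod D)"

definition unique_extension_states :: "'a::cstar_algebra set \<Rightarrow> ('a \<Rightarrow> complex) set" where
  "unique_extension_states D =
     {\<rho> \<in> Mod D. \<exists>!\<sigma>. state \<sigma> \<and> restrict \<sigma> D = restrict \<rho> D}"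


section \<open>C*-algebras on carrier sets, operator systems, completely positive maps\<close>

text \<open>
  Injectivity and essentiality quantify over C*-algebras, which cannot be done over types inside
  a formula.  Hence the carrier-based notion below; \<open>cstar_of\<close> views a type of class
  \<^class>\<open>cstar_algebra\<close> as such an algebra.
\<close>

definition complex_ring :: "complex ring" where
  "complex_ring = \<lparr>carrier = UNIV, mult = (*), one = 1, zero = 0, add = (+)\<rparr>"

record 'a cstar_struct = "(complex, 'a) module" +
  adjoint_op :: "'a \<Rightarrow> 'a"
  norm_op :: "'a \<Rightarrow> real"

locale cstar = Ring.ring A + Module.module complex_ring A for A :: "'a cstar_struct" (structure) +
  assumes smult_mult_left: "\<lbrakk>x \<in> carrier A; y \<in> carrier A\<rbrakk> \<Longrightarrow> (c \<odot> x) \<otimes> y = c \<odot> (x \<otimes> y)"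
    and smult_mult_right: "\<lbrakk>x \<in> carrier A; y \<in> carrier A\<rbrakk> \<Longrightarrow> x \<otimes> (c \<odot> y) = c \<odot> (x \<otimes> y)"
    and adjoint_closed: "x \<in> carrier A \<Longrightarrow> adjoint_op A x \<in> carrier A"
    and adjoint_adjoint: "x \<in> carrier A \<Longrightarrow> adjoint_op A (adjoint_op A x) = x"
    and adjoint_add: "\<lbrakk>x \<in> carrier A; y \<in> carrier A\<rbrakk> \<Longrightarrow>
          adjoint_op A (x \<oplus> y) = adjoint_op A x \<oplus> adjoint_op A y"
    and adjoint_smult: "x \<in> carrier A \<Longrightarrow> adjoint_op A (c \<odot> x) = cnj c \<odot> adjoint_op A x"
    and adjoint_mult: "\<lbrakk>x \<in> carrier A; y \<in> carrier A\<rbrakk> \<Longrightarrow>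
          adjoint_op A (x \<otimes> y) = adjoint_op A y \<otimes> adjoint_op A x"
    and norm_nonneg: "x \<in> carrier A \<Longrightarrow> 0 \<le> norm_op A x"
    and norm_eq_zero: "x \<in> carrier A \<Longrightarrow> norm_op A x = 0 \<longleftrightarrow> x = \<zero>"
    and norm_triangle: "\<lbrakk>x \<in> carrier A; y \<in> carrier A\<rbrakk> \<Longrightarrow>
          norm_op A (x \<oplus> y) \<le> norm_op A x + norm_op A y"
    and norm_smult: "x \<in> carrier A \<Longrightarrow> norm_op A (c \<odot> x) = cmod c * norm_op A x"
    and norm_mult_le: "\<lbrakk>x \<in> carrier A; y \<in> carrier A\<rbrakk> \<Longrightarrow>
          norm_op A (x \<otimes> y) \<le> norm_op A x * norm_op A y"
    and norm_adjoint_mult: "x \<in> carrier A \<Longrightarrow> norm_op A (adjoint_op A x \<otimes> x) = (norm_op A x)\<^sup>2"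
    and complete: "Metric_space.mcomplete (carrier A) (\<lambda>x y. norm_op A (x \<ominus> y))"

definition cstar_of :: "'a::cstar_algebra cstar_struct" where
  "cstar_of = \<lparr>carrier = UNIV, mult = (*), one = 1, zero = 0, add = (+), smult = scaleC,
     adjoint_op = star, norm_op = norm\<rparr>"

lemma ring_cstar_of: "Ring.ring (cstar_of :: 'a::cstar_algebra cstar_struct)"
proof (rule ringI)
  show "abelian_group (cstar_of :: 'a cstar_struct)"
  proof (rule abelian_groupI)
    fix x :: 'a assume "x \<in> carrier cstar_of"
    show "\<exists>y\<in>carrier cstar_of. y \<oplus>\<^bsub>cstar_of\<^esub> x = \<zero>\<^bsub>cstar_of\<^esub>"
      by (rule bexI[of _ "- x"]) (simp_all add: cstar_of_def)
  qed (simp_all add: cstar_of_def algebra_simps)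
  show "monoid (cstar_of :: 'a cstar_struct)"
    by (rule monoidI) (simp_all add: cstar_of_def algebra_simps)
qed (simp_all add: cstar_of_def algebra_simps)

lemma cring_complex_ring: "cring complex_ring"
proof (rule cringI)
  show "abelian_group complex_ring"
  proof (rule abelian_groupI)
    fix x assume "x \<in> carrier complex_ring"
    show "\<exists>y\<in>carrier complex_ring. y \<oplus>\<^bsub>complex_ring\<^esub> x = \<zero>\<^bsub>complex_ring\<^esub>"
      by (rule bexI[of _ "- x"]) (simp_all add: complex_ring_def)
  qed (simp_all add: complex_ring_def algebra_simps)
  show "Group.comm_monoid complex_ring"
    by (rule comm_monoidI) (simp_all add: complex_ring_def algebra_simps)
qed (simp_all add: complex_ring_def algebra_simps)

lemma a_minus_cstar_of: "x \<ominus>\<^bsub>cstar_of\<^esub> y = x - (y :: 'a::cstar_algebra)"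
proof -
  interpret Ring.ring "cstar_of :: 'a cstar_struct" by (rule ring_cstar_of)
  have "\<ominus>\<^bsub>cstar_of\<^esub> y = - y"
    by (rule minus_equality) (simp_all add: cstar_of_def)
  then show ?thesis
    by (simp add: a_minus_def) (simp add: cstar_of_def)
qed

lemma cstar_cstar_of: "cstar (cstar_of :: 'a::cstar_algebra cstar_struct)"
proof (intro cstar.intro ring_cstar_of cstar_axioms.intro)
  interpret Ring.ring "cstar_of :: 'a cstar_struct" by (rule ring_cstar_of)
  show "Module.module complex_ring (cstar_of :: 'a cstar_struct)"
    by (intro moduleI cring_complex_ring abelian_group_axioms)
      (simp_all add: cstar_of_def complex_ring_def scaleC_add_left scaleC_add_right
        scaleC_scaleC scaleC_one)
  have "complete (UNIV :: 'a set)"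
    by (rule complete_UNIV)
  then have "Met_TC.mcomplete (TYPE('a))"
    by simp
  then show "Metric_space.mcomplete (carrier cstar_of)
      (\<lambda>x y :: 'a. norm_op cstar_of (x \<ominus>\<^bsub>cstar_of\<^esub> y))"
    unfolding a_minus_cstar_of by (simp add: cstar_of_def dist_norm[abs_def])
qed (simp_all add: cstar_of_def mult_scaleC_left mult_scaleC_right star_star star_add star_scaleC
    star_mult norm_triangle_ineq norm_scaleC norm_mult_ineq cstar_identity)

text \<open>
  Only the entries with indices below \<open>n\<close> matter, and positivity means being of the form
  \<open>B* B\<close> with \<open>B\<close> an \<open>n \<times> n\<close> matrix over \<open>A\<close>.
\<close>

definition positive_matrix :: "'a cstar_struct \<Rightarrow> nat \<Rightarrow> (nat \<Rightarrow> nat \<Rightarrow> 'a) \<Rightarrow> bool" where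
  "positive_matrix A n M \<longleftrightarrow>
     (\<exists>B. (\<forall>i<n. \<forall>j<n. B i j \<in> carrier A) \<and>
          (\<forall>i<n. \<forall>j<n. M i j =
             finsum A (\<lambda>k. adjoint_op A (B k i) \<otimes>\<^bsub>A\<^esub> B k j) {..<n}))"

definition operator_system :: "'a cstar_struct \<Rightarrow> 'a set \<Rightarrow> bool" where
  "operator_system A S \<longleftrightarrow>
     S \<subseteq> carrier A \<and> \<one>\<^bsub>A\<^esub> \<in> S \<and> (\<forall>x\<in>S. \<forall>y\<in>S. x \<oplus>\<^bsub>A\<^esub> y \<in> S) \<and>
     (\<forall>c. \<forall>x\<in>S. c \<odot>\<^bsub>A\<^esub> x \<in> S) \<and> (\<forall>x\<in>S. adjoint_op A x \<in> S)"

text \<open>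
  \<open>ucp A S B \<phi>\<close>: on the operator system \<open>S\<close> of \<open>A\<close>, \<open>\<phi>\<close> is a unital completely positive map
  into \<open>B\<close>; positivity of matrices over \<open>S\<close> is that of matrices over \<open>A\<close>.
\<close>

definition ucp :: "'a cstar_struct \<Rightarrow> 'a set \<Rightarrow> 'b cstar_struct \<Rightarrow> ('a \<Rightarrow> 'b) \<Rightarrow> bool" where
  "ucp A S B \<phi> \<longleftrightarrow>
     \<phi> ` S \<subseteq> carrier B \<and> \<phi> \<one>\<^bsub>A\<^esub> = \<one>\<^bsub>B\<^esub> \<and>
     (\<forall>x\<in>S. \<forall>y\<in>S. \<phi> (x \<oplus>\<^bsub>A\<^esub> y) = \<phi> x \<oplus>\<^bsub>B\<^esub> \<phi> y) \<and>
     (\<forall>c. \<forall>x\<in>S. \<phi> (c \<odot>\<^bsub>A\<^esub> x) = c \<odot>\<^bsub>B\<^esub> \<phi> x) \<and>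
     (\<forall>n M. (\<forall>i<n. \<forall>j<n. M i j \<in> S) \<longrightarrow> positive_matrix A n M \<longrightarrow>
        positive_matrix B n (\<lambda>i j. \<phi> (M i j)))"

definition complete_order_embedding ::
    "'a cstar_struct \<Rightarrow> 'a set \<Rightarrow> 'b cstar_struct \<Rightarrow> ('a \<Rightarrow> 'b) \<Rightarrow> bool" where
  "complete_order_embedding A S B \<phi> \<longleftrightarrow> ucp A S B \<phi> \<and>
     (\<forall>n M. (\<forall>i<n. \<forall>j<n. M i j \<in> S) \<longrightarrow> positive_matrix B n (\<lambda>i j. \<phi> (M i j)) \<longrightarrow>
        positive_matrix A n M)"


section \<open>Injective envelopes and pseudo-expectations\<close>

text \<open>
  The test algebras below have carriers in \<open>'i universe\<close>; for an abelian \<open>'i\<close> this is no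
  restriction.  Injectivity: \<open>'i\<close> embeds by the Gelfand transform into the algebra of bounded
  functions on its character space, whose elements live in \<open>'i universe\<close>.  Extending the
  inverse of this embedding makes \<open>'i\<close> a retract, by a ucp map, of an algebra of all bounded
  functions on a set, which is injective with respect to operator systems of every size.
  Essentiality: a test map \<open>\<phi>\<close> may be restricted in its codomain to the C*-algebra generated by
  its range, whose cardinality is at most that of \<open>'i \<Rightarrow> complex\<close>; as the operations of a
  \<^typ>\<open>'u cstar_struct\<close> are arbitrary, an isomorphic copy lives in \<open>'i universe\<close>.
\<close>

type_synonym 'i universe = "('i \<Rightarrow> complex) \<Rightarrow> complex"

definition injective_cstar :: "'i::cstar_algebra itself \<Rightarrow> bool" where
  "injective_cstar _ \<longleftrightarrow>
     (\<forall>(T :: 'i universe cstar_struct) S (\<phi> :: 'i universe \<Rightarrow> 'i).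
        cstar T \<and> operator_system T S \<and> ucp T S cstar_of \<phi> \<longrightarrow>
        (\<exists>\<psi>. ucp T (carrier T) cstar_of \<psi> \<and> (\<forall>x\<in>S. \<psi> x = \<phi> x)))"

definition unital_injective_star_hom ::
    "'a::cstar_algebra set \<Rightarrow> ('a \<Rightarrow> 'i::cstar_algebra) \<Rightarrow> bool" where
  "unital_injective_star_hom D \<iota> \<longleftrightarrow>
     (\<forall>x\<in>D. \<forall>y\<in>D. \<iota> (x + y) = \<iota> x + \<iota> y) \<and> (\<forall>c. \<forall>x\<in>D. \<iota> (scaleC c x) = scaleC c (\<iota> x)) \<and>
     (\<forall>x\<in>D. \<forall>y\<in>D. \<iota> (x * y) = \<iota> x * \<iota> y) \<and> (\<forall>x\<in>D. \<iota> (star x) = star (\<iota> x)) \<and>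
     \<iota> 1 = 1 \<and> inj_on \<iota> D"

definition rigid_extension :: "'a::cstar_algebra set \<Rightarrow> ('a \<Rightarrow> 'i::cstar_algebra) \<Rightarrow> bool" where
  "rigid_extension D \<iota> \<longleftrightarrow>
     (\<forall>\<phi> :: 'i \<Rightarrow> 'i. ucp cstar_of UNIV cstar_of \<phi> \<and> (\<forall>d\<in>D. \<phi> (\<iota> d) = \<iota> d) \<longrightarrow> \<phi> = id)"

definition essential_extension :: "'a::cstar_algebra set \<Rightarrow> ('a \<Rightarrow> 'i::cstar_algebra) \<Rightarrow> bool" where
  "essential_extension D \<iota> \<longleftrightarrow>
     (\<forall>(T :: 'i universe cstar_struct) \<phi>.
        cstar T \<and> ucp cstar_of UNIV T \<phi> \<and> complete_order_embedding cstar_of D T (\<phi> \<circ> \<iota>) \<longrightarrow>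
        complete_order_embedding cstar_of UNIV T \<phi>)"

definition injective_envelope :: "'a::cstar_algebra set \<Rightarrow> ('a \<Rightarrow> 'i::cstar_algebra) \<Rightarrow> bool" where
  "injective_envelope D \<iota> \<longleftrightarrow>
     commuting (UNIV :: 'i set) \<and> injective_cstar TYPE('i) \<and>
     unital_injective_star_hom D \<iota> \<and> rigid_extension D \<iota> \<and> essential_extension D \<iota>"

definition pseudo_expectation ::
    "'a::cstar_algebra set \<Rightarrow> ('a \<Rightarrow> 'i::cstar_algebra) \<Rightarrow> ('a \<Rightarrow> 'i) \<Rightarrow> bool" where
  "pseudo_expectation D \<iota> E \<longleftrightarrow> ucp cstar_of UNIV cstar_of E \<and> (\<forall>d\<in>D. E d = \<iota> d)"

definition strongly_compatible_states ::
    "('a::cstar_algebra \<Rightarrow> 'i::cstar_algebra) \<Rightarrow> ('a \<Rightarrow> complex) set" where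
  "strongly_compatible_states E = {\<rho> \<circ> E | \<rho>. \<rho> \<in> characters UNIV}"

end

theory Submission
  imports Defs "HOL-Computational_Algebra.Formal_Power_Series"
begin

text \<open>
  Let \<open>X\<close> be the character space of the injective envelope and \<open>\<pi> : X \<rightarrow> characters D\<close> the map
  dual to \<open>\<iota>\<close>.  For a normalizer \<open>v\<close>, the value \<open>\<rho> v\<close> is the same for all \<open>\<rho> \<in> Mod D\<close> over a
  character \<open>\<tau>\<close> in two cases: if \<open>v\<close> moves \<open>\<tau>\<close>, where \<open>\<rho> v = 0\<close>, and if \<open>v d \<in> D\<close> for some \<open>d \<in> D\<close>
  with \<open>\<tau> d \<noteq> 0\<close>, where \<open>\<rho> v = \<tau> (v d) / \<tau> d\<close>.  If \<open>v\<close> moves no character in the support of \<open>d\<close>, then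
  \<open>v d\<close> commutes with \<open>D\<close>, hence lies in \<open>D\<close> by maximality.  Essentiality of the envelope says that
  every nonempty open subset of \<open>X\<close> contains the support of \<open>\<iota> d\<close> for some \<open>d \<noteq> 0\<close>; so the points of \<open>X\<close>
  over characters of one of the two kinds form a dense open set.  By Baire's theorem, for countably
  many normalizers a generic \<open>x \<in> X\<close> has the property that \<open>x \<circ> E\<close> is determined by \<open>\<pi> x\<close> on the closed
  \<open>D\<close>-bimodule they generate.  Both claims follow by approximating an arbitrary point of \<open>X\<close> by
  generic ones, since \<open>\<pi>\<close> is onto and \<open>x \<mapsto> x \<circ> E\<close> is continuous.

  Gelfand duality is obtained from the order structure: a maximal quadratic module in the
  self-adjoint part of an abelian algebra defines a character.
\<close>

text \<open>Essentiality is phrased through positive matrices of every size. Testing it requires a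
  factorization over D of every matrix that is positive at each character, which is why square roots
  are taken of matrices. The power series used has absolutely summable coefficients, so it converges
  on the boundary of the unit ball too. Its 1 x 1 case also supplies the order structure behind
  Gelfand duality: because such roots exist, sums of squares of self-adjoint elements of an abelian
  algebra are again squares. The obstacle in the first claim is that regularity may involve
  uncountably many normalizers, while Baire's theorem handles only countably many. A weak-*
  neighbourhood, however, tests only finitely many elements, and each of them is a limit of
  combinations of countably many normalizers. So the generic point is chosen anew for each
  neighbourhood and controls only the elements tested there. In the second claim one countable
  family controls the whole algebra, and generic points yield unique extensions.\<close>

section \<open>The involution, self-adjoint elements, real and imaginary parts\<close>

lemma star_0 [simp]: "star 0 = (0 :: 'a::cstar_algebra)"
  using star_add[of "0::'a" 0] by simp

lemma star_minus: "star (- x) = - star (x :: 'a::cstar_algebra)"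
  using star_add[of x "- x"] by (simp add: eq_neg_iff_add_eq_0 add.commute)

lemma star_diff: "star (x - y) = star x - star (y :: 'a::cstar_algebra)"
  using star_add[of x "- y"] by (simp add: star_minus)

lemma star_scaleR: "star (r *\<^sub>R x) = r *\<^sub>R star (x :: 'a::cstar_algebra)"
  by (simp flip: scaleC_of_real add: star_scaleC)

lemma star_1 [simp]: "star 1 = (1 :: 'a::cstar_algebra)"
  by (metis mult.left_neutral mult.right_neutral star_mult star_star)

lemma star_sum: "star (sum f I) = (\<Sum>i\<in>I. star (f i :: 'a::cstar_algebra))"
  by (induction I rule: infinite_finite_induct) (auto simp: star_add)

lemma norm_star [simp]: "norm (star x) = norm (x :: 'a::cstar_algebra)"
proof -
  have le: "norm y \<le> norm (star y)" for y :: 'a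
  proof (cases "y = 0")
    case False
    have "norm y * norm y \<le> norm (star y) * norm y"
      using norm_mult_ineq[of "star y" y] by (simp add: cstar_identity power2_eq_square)
    with False show ?thesis by simp
  qed auto
  from le[of x] le[of "star x"] show ?thesis by (simp add: star_star)
qed

lemma bounded_linear_star: "bounded_linear (star :: 'a::cstar_algebra \<Rightarrow> 'a)"
  by (intro bounded_linear_intro[of _ 1]) (auto simp: star_add star_scaleR)

definition self_adjoint :: "'a::cstar_algebra \<Rightarrow> bool" where
  "self_adjoint x \<longleftrightarrow> star x = x"

lemma self_adjoint_star_mult [simp]: "self_adjoint (star x * x)"
  by (simp add: self_adjoint_def star_mult star_star)

lemma self_adjoint_1 [simp]: "self_adjoint 1"
  by (simp add: self_adjoint_def)

lemma self_adjoint_0 [simp]: "self_adjoint 0"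
  by (simp add: self_adjoint_def)

lemma self_adjoint_add: "self_adjoint x \<Longrightarrow> self_adjoint y \<Longrightarrow> self_adjoint (x + y)"
  by (simp add: self_adjoint_def star_add)

lemma self_adjoint_diff: "self_adjoint x \<Longrightarrow> self_adjoint y \<Longrightarrow> self_adjoint (x - y)"
  by (simp add: self_adjoint_def star_diff)

lemma self_adjoint_minus: "self_adjoint x \<Longrightarrow> self_adjoint (- x)"
  by (simp add: self_adjoint_def star_minus)

lemma self_adjoint_scaleR: "self_adjoint x \<Longrightarrow> self_adjoint (r *\<^sub>R x)"
  by (simp add: self_adjoint_def star_scaleR)

lemma norm_self_adjoint_square: "self_adjoint x \<Longrightarrow> norm (x * x) = (norm x)\<^sup>2"
  using cstar_identity[of x] by (simp add: self_adjoint_def)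

definition re_part :: "'a::cstar_algebra \<Rightarrow> 'a" where
  "re_part x = (1/2) *\<^sub>R (x + star x)"

definition im_part :: "'a::cstar_algebra \<Rightarrow> 'a" where
  "im_part x = scaleC (- \<i> / 2) (x - star x)"

lemma self_adjoint_re_part: "self_adjoint (re_part x)"
  by (simp add: self_adjoint_def re_part_def star_scaleR star_add star_star add.commute)

lemma self_adjoint_im_part: "self_adjoint (im_part x)"
proof -
  have "star (im_part x) = scaleC (\<i> / 2) (star x - x)"
    by (simp add: im_part_def star_scaleC star_diff star_star del: complex_vector.scale_minus_left)
  also have "\<dots> = scaleC (- \<i> / 2) (- (star x - x))"
    by (simp del: minus_diff_eq)
  finally show ?thesis by (simp add: self_adjoint_def im_part_def)
qed

lemma re_im_decomp: "x = re_part x + scaleC \<i> (im_part x)"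
proof -
  have "re_part x = scaleC (1/2) (x + star x)"
    unfolding re_part_def by (simp flip: scaleC_of_real)
  moreover have "scaleC \<i> (im_part x) = scaleC (1/2) (x - star x)"
    by (simp add: im_part_def scaleC_scaleC)
  ultimately have "re_part x + scaleC \<i> (im_part x) = scaleC (1/2) (x + x)"
    by (simp flip: scaleC_add_right)
  also have "\<dots> = x"
  proof -
    have "x + x = scaleC 2 x"
      using scaleC_add_left[of 1 1 x] by (simp add: scaleC_one)
    then show ?thesis by (simp only: scaleC_scaleC) (simp add: scaleC_one)
  qed
  finally show ?thesis by simp
qed

section \<open>Square roots of matrices by the binomial series\<close>

text \<open>The size is an argument, as in \<open>positive_matrix\<close>, since it varies inside
  formulas; only indices below n are meaningful.\<close>

primrec mpow :: "nat \<Rightarrow> (nat \<Rightarrow> nat \<Rightarrow> 'a::semiring_1) \<Rightarrow> nat \<Rightarrow> nat \<Rightarrow> nat \<Rightarrow> 'a" where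
  "mpow n T 0 = (\<lambda>i j. if i = j then 1 else 0)"
| "mpow n T (Suc k) = (\<lambda>i j. \<Sum>l<n. T i l * mpow n T k l j)"

lemma mpow_add:
  "i < n \<Longrightarrow> mpow n T (k + m) i j = (\<Sum>l<n. mpow n T k i l * mpow n T m l j)"
proof (induction k arbitrary: i)
  case 0
  have "(\<Sum>l<n. mpow n T 0 i l * mpow n T m l j) = (\<Sum>l<n. if l = i then mpow n T m l j else 0)"
    by (intro sum.cong) auto
  with 0 show ?case by simp
next
  case (Suc k)
  have "mpow n T (Suc k + m) i j = (\<Sum>l<n. T i l * (\<Sum>h<n. mpow n T k l h * mpow n T m h j))"
    using Suc by simp
  also have "\<dots> = (\<Sum>h<n. \<Sum>l<n. T i l * mpow n T k l h * mpow n T m h j)"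
    by (simp add: sum_distrib_left mult.assoc) (rule sum.swap)
  finally show ?case by (simp add: sum_distrib_right)
qed

lemma mpow_one: "i < n \<Longrightarrow> j < n \<Longrightarrow> mpow n T 1 i j = T i j"
proof -
  assume "i < n" "j < n"
  have "(\<Sum>l<n. T i l * (if l = j then 1 else 0)) = (\<Sum>l<n. if l = j then T i l else 0)"
    by (intro sum.cong) auto
  with \<open>j < n\<close> show ?thesis by simp
qed

lemma mpow_star:
  fixes T :: "nat \<Rightarrow> nat \<Rightarrow> 'a::cstar_algebra"
  assumes T: "\<And>i j. i < n \<Longrightarrow> j < n \<Longrightarrow> star (T i j) = T j i" and "i < n" "j < n"
  shows "star (mpow n T k i j) = mpow n T k j i"
  using assms(2,3)
proof (induction k arbitrary: i j)
  case (Suc k)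
  have "star (mpow n T (Suc k) i j) = (\<Sum>l<n. mpow n T k j l * T l i)"
    using Suc T by (simp add: star_sum star_mult)
  \<comment> \<open>The adjoint puts T to the right of the power, whereas \<open>mpow\<close>
    unfolds on the left; \<open>mpow_add\<close> with exponents k and 1 connects the two
    forms.\<close>
  also have "\<dots> = (\<Sum>l<n. mpow n T k j l * mpow n T 1 l i)"
    using Suc.prems by (intro sum.cong refl) (simp add: mpow_one del: One_nat_def)
  also have "\<dots> = mpow n T (k + 1) j i"
    using mpow_add[OF Suc.prems(2)] by metis
  finally show ?case by simp
qed auto

text \<open>The Taylor coefficients of \<open>sqrt (1 - t)\<close>.\<close>

definition sqrt_coeff :: "nat \<Rightarrow> real" where
  "sqrt_coeff k = ((1/2) gchoose k) * (-1) ^ k"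

lemma sqrt_coeff_0 [simp]: "sqrt_coeff 0 = 1"
  by (simp add: sqrt_coeff_def)

text \<open>Alternating partial sums of binomial coefficients with upper entry a collapse to one
  coefficient with upper entry a - 1, here 1/2 - 1.\<close>

lemma sqrt_coeff_partial: "(\<Sum>k\<le>m. sqrt_coeff k) = (-1) ^ m * ((-1/2) gchoose m)"
  unfolding sqrt_coeff_def using gbinomial_sum_lower_neg[of "1/2 :: real" m] by simp

text \<open>Each of the m factors -1/2 - i of the falling factorial is negative.\<close>

lemma sign_gbinomial_neg_half: "(-1) ^ m * ((-1/2 :: real) gchoose m) \<ge> 0"
proof -
  have "(-1) ^ m * ((-1/2 :: real) gchoose m) = (\<Prod>i = 0..<m. (1/2 + real i)) / fact m"
  proof -
    have "(\<Prod>i = 0..<m. (-1/2 - real i)) = (\<Prod>i = 0..<m. (-1) * (1/2 + real i))"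
      by (intro prod.cong) auto
    also have "\<dots> = (-1) ^ m * (\<Prod>i = 0..<m. (1/2 + real i))"
      by (subst prod.distrib) simp
    finally show ?thesis by (simp add: gbinomial_prod_rev)
  qed
  also have "\<dots> \<ge> 0" by (intro divide_nonneg_nonneg prod_nonneg) auto
  finally show ?thesis .
qed

text \<open>The absorption identity lowers the upper entry from 1/2 to -1/2, where the sign is
  known.\<close>

lemma sqrt_coeff_Suc_nonpos: "sqrt_coeff (Suc k) \<le> 0"
proof -
  have "sqrt_coeff (Suc k) = - ((1/2) / real (Suc k)) * ((-1) ^ k * ((-1/2) gchoose k))"
    using gbinomial_absorption[of k "1/2::real"] 
    by (simp add: sqrt_coeff_def field_simps)
  with sign_gbinomial_neg_half[of k] show ?thesis
    by (metis (no_types, lifting) mult_nonpos_nonneg neg_le_0_iff_le divide_nonneg_nonneg of_nat_0_le_iff zero_le_divide_1_iff zero_le_numeral)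
qed

text \<open>All coefficients after the zeroth are nonpositive, so their absolute values add up to 1
  minus a partial sum, and partial sums are nonnegative. Summability at t = 1 is what admits
  elements of norm exactly 1.\<close>

lemma sqrt_coeff_bound: "(\<Sum>k<m. \<bar>sqrt_coeff (Suc k)\<bar>) \<le> 1"
proof -
  have "(\<Sum>k<m. \<bar>sqrt_coeff (Suc k)\<bar>) = - (\<Sum>k<m. sqrt_coeff (Suc k))"
    unfolding sum_negf[symmetric] by (intro sum.cong refl abs_of_nonpos sqrt_coeff_Suc_nonpos)
  also have "\<dots> = 1 - (\<Sum>k\<le>m. sqrt_coeff k)"
    by (simp add: sum.atMost_shift)
  also have "\<dots> \<le> 1"
    unfolding sqrt_coeff_partial using sign_gbinomial_neg_half[of m] by simp
  finally show ?thesis .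
qed

lemma summable_sqrt_coeff_Suc: "summable (\<lambda>k. \<bar>sqrt_coeff (Suc k)\<bar>)"
  by (intro summableI_nonneg_bounded[where x = 1] sqrt_coeff_bound) auto

lemma summable_sqrt_coeff: "summable (\<lambda>k. \<bar>sqrt_coeff k\<bar>)"
  using summable_sqrt_coeff_Suc by (subst summable_Suc_iff[symmetric])

text \<open>The square of the series is 1 - t: Vandermonde's identity gives the binomial
  coefficients with upper entry 1/2 + 1/2 = 1.\<close>

lemma sqrt_coeff_convolution:
  "(\<Sum>i\<le>k. sqrt_coeff i * sqrt_coeff (k - i)) = (if k = 0 then 1 else if k = 1 then -1 else 0)"
proof -
  have "(\<Sum>i\<le>k. sqrt_coeff i * sqrt_coeff (k - i))
      = (\<Sum>i = 0..k. ((1/2) gchoose i) * ((1/2) gchoose (k - i))) * (-1) ^ k"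
    unfolding sqrt_coeff_def atLeast0AtMost sum_distrib_right
    by (intro sum.cong refl) (auto simp: mult_ac simp flip: power_add)
  also have "\<dots> = (1 gchoose k) * (-1) ^ k"
    using gbinomial_Vandermonde[of "1/2::real" "1/2" k] by simp
  also have "\<dots> = (if k = 0 then 1 else if k = 1 then -1 else 0)"
    using binomial_gbinomial[of 1 k, where 'a = real] 
    by (auto simp: binomial_eq_0 not_le)
  finally show ?thesis .
qed

definition msqrt :: "nat \<Rightarrow> (nat \<Rightarrow> nat \<Rightarrow> 'a::{real_normed_algebra_1,banach}) \<Rightarrow> nat \<Rightarrow> nat \<Rightarrow> 'a" where
  "msqrt n T i j = (\<Sum>k. sqrt_coeff k *\<^sub>R mpow n T k i j)"

text \<open>A bound on the entries of all powers stands in for an operator norm on matrices; over an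
  abelian algebra it can be checked one character at a time.\<close>

locale power_bounded_matrix =
  fixes n :: nat and T :: "nat \<Rightarrow> nat \<Rightarrow> 'a::{real_normed_algebra_1,banach}"
  assumes bound: "\<And>k i j. i < n \<Longrightarrow> j < n \<Longrightarrow> norm (mpow n T k i j) \<le> 1"
begin

lemma summable_norm_msqrt:
  assumes "i < n" "j < n"
  shows "summable (\<lambda>k. norm (sqrt_coeff k *\<^sub>R mpow n T k i j))"
  by (rule summable_comparison_test'[OF summable_sqrt_coeff, where N = 0])
    (simp add: mult_left_le bound[OF assms])

lemma msqrt_sums:
  assumes "i < n" "j < n"
  shows "(\<lambda>k. sqrt_coeff k *\<^sub>R mpow n T k i j) sums msqrt n T i j"
  unfolding msqrt_def by (rule summable_sums[OF summable_norm_cancel[OF summable_norm_msqrt[OF assms]]])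

text \<open>Cauchy products entry by entry; the convolution identity leaves only the terms of degree
  0 and 1.\<close>

lemma msqrt_square:
  assumes "i < n" "j < n"
  shows "(\<Sum>l<n. msqrt n T i l * msqrt n T l j) = (if i = j then 1 else 0) - T i j"
proof -
  let ?f = "\<lambda>i j k. sqrt_coeff k *\<^sub>R mpow n T k i j"
  have "(\<lambda>k. \<Sum>l<n. \<Sum>m\<le>k. ?f i l m * ?f l j (k - m)) sums (\<Sum>l<n. msqrt n T i l * msqrt n T l j)"
    unfolding msqrt_def using assms
    by (intro sums_sum Cauchy_product_sums summable_norm_msqrt) auto
  also have "(\<lambda>k. \<Sum>l<n. \<Sum>m\<le>k. ?f i l m * ?f l j (k - m))
      = (\<lambda>k. (\<Sum>m\<le>k. sqrt_coeff m * sqrt_coeff (k - m)) *\<^sub>R mpow n T k i j)"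
  proof
    fix k
    have "(\<Sum>l<n. \<Sum>m\<le>k. ?f i l m * ?f l j (k - m))
        = (\<Sum>m\<le>k. (sqrt_coeff m * sqrt_coeff (k - m)) *\<^sub>R (\<Sum>l<n. mpow n T m i l * mpow n T (k - m) l j))"
      unfolding scaleR_sum_right by (subst sum.swap) (intro sum.cong refl, simp)
    also have "\<dots> = (\<Sum>m\<le>k. (sqrt_coeff m * sqrt_coeff (k - m)) *\<^sub>R mpow n T (m + (k - m)) i j)"
      using assms by (simp only: mpow_add)
    finally show "(\<Sum>l<n. \<Sum>m\<le>k. ?f i l m * ?f l j (k - m))
        = (\<Sum>m\<le>k. sqrt_coeff m * sqrt_coeff (k - m)) *\<^sub>R mpow n T k i j"
      by (simp add: scaleR_sum_left del: mpow.simps)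
  qed
  finally have "(\<lambda>k. (if k = 0 then 1 else if k = 1 then -1 else (0::real)) *\<^sub>R mpow n T k i j) sums
      (\<Sum>l<n. msqrt n T i l * msqrt n T l j)"
    unfolding sqrt_coeff_convolution .
  moreover have "(\<lambda>k. (if k = 0 then 1 else if k = 1 then -1 else (0::real)) *\<^sub>R mpow n T k i j) sums
      (\<Sum>k\<in>{0,1}. (if k = 0 then 1 else if k = 1 then -1 else (0::real)) *\<^sub>R mpow n T k i j)"
    by (rule sums_finite) (auto simp del: mpow.simps)
  ultimately have "(\<Sum>l<n. msqrt n T i l * msqrt n T l j)
      = (\<Sum>k\<in>{0,1}. (if k = 0 then 1 else if k = 1 then -1 else (0::real)) *\<^sub>R mpow n T k i j)"
    by (rule sums_unique2)
  also have "\<dots> = mpow n T 0 i j - mpow n T 1 i j"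
    by (simp del: mpow.simps)
  finally have "(\<Sum>l<n. msqrt n T i l * msqrt n T l j) = mpow n T 0 i j - mpow n T 1 i j" .
  then show ?thesis using mpow_one[OF assms] by simp
qed

text \<open>The coefficients after the zeroth have total mass at most 1. The bound singles out the
  nonnegative root: a real \<sigma> at distance at most 1 from 1 is nonnegative, which
  \<open>positive_part\<close> exploits.\<close>

lemma msqrt_near_one:
  assumes "i < n"
  shows "norm (1 - msqrt n T i i) \<le> 1"
proof -
  let ?f = "\<lambda>k. sqrt_coeff k *\<^sub>R mpow n T k i i"
  have s: "summable (\<lambda>k. norm (?f k))" by (rule summable_norm_msqrt[OF assms assms])
  have s': "summable (\<lambda>k. norm (?f (Suc k)))" using summable_ignore_initial_segment[OF s, of 1] by simp
  have "msqrt n T i i = ?f 0 + (\<Sum>k. ?f (Suc k))"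
    unfolding msqrt_def using suminf_split_head[OF summable_norm_cancel[OF s]] by simp
  then have "norm (1 - msqrt n T i i) = norm (\<Sum>k. ?f (Suc k))" by simp
  also have "\<dots> \<le> (\<Sum>k. norm (?f (Suc k)))"
    by (rule summable_norm[OF s'])
  also have "\<dots> \<le> (\<Sum>k. \<bar>sqrt_coeff (Suc k)\<bar>)"
    using bound[OF assms assms]
    by (intro suminf_le summable_sqrt_coeff_Suc s') (auto intro: mult_left_le simp del: mpow.simps)
  also have "\<dots> \<le> 1"
    by (intro suminf_le_const summable_sqrt_coeff_Suc sqrt_coeff_bound)
  finally show ?thesis .
qed

end

section \<open>Square roots inside closed subalgebras\<close>

lemma unital_cstar_subalgebraD:
  assumes "unital_cstar_subalgebra B"
  shows "x \<in> B \<Longrightarrow> y \<in> B \<Longrightarrow> x + y \<in> B" "x \<in> B \<Longrightarrow> y \<in> B \<Longrightarrow> x - y \<in> B" "x \<in> B \<Longrightarrow> y \<in> B \<Longrightarrow> x * y \<in> B"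
    "x \<in> B \<Longrightarrow> - x \<in> B" "x \<in> B \<Longrightarrow> scaleC c x \<in> B" "x \<in> B \<Longrightarrow> r *\<^sub>R x \<in> B" "x \<in> B \<Longrightarrow> star x \<in> B"
    "1 \<in> B" "0 \<in> B" "closed B" "(\<And>i. i \<in> I \<Longrightarrow> f i \<in> B) \<Longrightarrow> sum f I \<in> B"
proof -
  have S: "complex_vector.subspace B" and B: "1 \<in> B" "closed B" "\<And>x y. x \<in> B \<Longrightarrow> y \<in> B \<Longrightarrow> x * y \<in> B"
    "\<And>x. x \<in> B \<Longrightarrow> star x \<in> B"
    using assms by (simp_all add: unital_cstar_subalgebra_def)
  show "x \<in> B \<Longrightarrow> r *\<^sub>R x \<in> B"
    unfolding scaleC_of_real[symmetric] by (rule complex_vector.subspace_scale[OF S])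
  show "(\<And>i. i \<in> I \<Longrightarrow> f i \<in> B) \<Longrightarrow> sum f I \<in> B"
    by (rule complex_vector.subspace_sum[OF S])
qed (use assms in \<open>simp_all add: unital_cstar_subalgebra_def complex_vector.subspace_add
    complex_vector.subspace_diff complex_vector.subspace_neg complex_vector.subspace_scale
    complex_vector.subspace_0\<close>)

lemma mpow_mem:
  assumes "unital_cstar_subalgebra B" and T: "\<And>i j. i < n \<Longrightarrow> j < n \<Longrightarrow> T i j \<in> B" and "i < n" "j < n"
  shows "mpow n T k i j \<in> B"
  using assms(3,4)
proof (induction k arbitrary: i j)
  note B' = unital_cstar_subalgebraD[OF assms(1)]
  case (Suc k)
  then show ?case unfolding mpow.simps by (intro B'(11) B'(3) T) auto
qed (simp add: unital_cstar_subalgebraD[OF assms(1)])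

lemma msqrt_mem:
  fixes T :: "nat \<Rightarrow> nat \<Rightarrow> 'a::cstar_algebra"
  assumes B: "unital_cstar_subalgebra B" and "power_bounded_matrix n T"
    and T: "\<And>i j. i < n \<Longrightarrow> j < n \<Longrightarrow> T i j \<in> B" and ij: "i < n" "j < n"
  shows "msqrt n T i j \<in> B"
proof -
  note B' = unital_cstar_subalgebraD[OF B]
  interpret power_bounded_matrix n T by (rule assms(2))
  have lim: "(\<lambda>m. \<Sum>k<m. sqrt_coeff k *\<^sub>R mpow n T k i j) \<longlonglongrightarrow> msqrt n T i j"
    using msqrt_sums[OF ij] by (simp add: sums_def)
  have "(\<Sum>k<m. sqrt_coeff k *\<^sub>R mpow n T k i j) \<in> B" for m
    by (intro B'(11) B'(6) mpow_mem[OF B _ ij] T)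
  then show ?thesis
    by (rule closed_sequentially[OF B'(10) _ lim])
qed

lemma msqrt_star:
  fixes T :: "nat \<Rightarrow> nat \<Rightarrow> 'a::cstar_algebra"
  assumes "power_bounded_matrix n T"
    and T: "\<And>i j. i < n \<Longrightarrow> j < n \<Longrightarrow> star (T i j) = T j i" and ij: "i < n" "j < n"
  shows "star (msqrt n T i j) = msqrt n T j i"
proof -
  interpret power_bounded_matrix n T by (rule assms(1))
  have mp: "star (mpow n T k i j) = mpow n T k j i" for k
    by (rule mpow_star) (simp_all add: T ij)
  have "(\<lambda>k. star (sqrt_coeff k *\<^sub>R mpow n T k i j)) sums star (msqrt n T i j)"
    by (rule bounded_linear.sums[OF bounded_linear_star msqrt_sums[OF ij]])
  also have "(\<lambda>k. star (sqrt_coeff k *\<^sub>R mpow n T k i j)) = (\<lambda>k. sqrt_coeff k *\<^sub>R mpow n T k j i)"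
    by (simp only: star_scaleR mp)
  finally show ?thesis using msqrt_sums[OF ij(2,1)] by (rule sums_unique2)
qed

lemma sqrt_one_minus:
  fixes t :: "'a::cstar_algebra"
  assumes B: "unital_cstar_subalgebra B" and t: "t \<in> B" "self_adjoint t" "norm t \<le> 1"
  obtains s where "s \<in> B" "self_adjoint s" "s * s = 1 - t" "norm (1 - s) \<le> 1"
proof -
  let ?T = "\<lambda>i j :: nat. t"
  have mp: "mpow 1 ?T k i j = t ^ k" if "i < 1" "j < 1" for k i j
    using that by (induction k arbitrary: i) auto
  interpret power_bounded_matrix 1 ?T
  proof
    fix k i j :: nat assume "i < 1" "j < 1"
    moreover have "norm (t ^ k) \<le> 1"
      using norm_power_ineq[of t k] t(3) by (meson norm_ge_zero order_trans power_le_one)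
    ultimately show "norm (mpow 1 ?T k i j) \<le> 1" by (simp only: mp)
  qed
  show ?thesis
  proof (rule that[of "msqrt 1 ?T 0 0"])
    show "msqrt 1 ?T 0 0 \<in> B"
      using t by (intro msqrt_mem[OF B] power_bounded_matrix_axioms) auto
    show "self_adjoint (msqrt 1 ?T 0 0)"
      using t unfolding self_adjoint_def by (intro msqrt_star power_bounded_matrix_axioms) auto
    show "msqrt 1 ?T 0 0 * msqrt 1 ?T 0 0 = 1 - t"
      using msqrt_square[of 0 0] by simp
    show "norm (1 - msqrt 1 ?T 0 0) \<le> 1"
      by (rule msqrt_near_one) simp
  qed
qed

section \<open>Characters of abelian C*-algebras\<close>

lemma re_im_unique:
  assumes "self_adjoint a" "self_adjoint b"
  shows "re_part (a + scaleC \<i> b) = a" "im_part (a + scaleC \<i> b) = b"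
proof -
  have s: "star (a + scaleC \<i> b) = a - scaleC \<i> b"
    using assms by (simp add: self_adjoint_def star_add star_scaleC)
  have dbl: "x + x = scaleC 2 x" for x :: 'a
    using scaleC_add_left[of 1 1 x] by (simp add: scaleC_one)
  have "re_part (a + scaleC \<i> b) = (1/2) *\<^sub>R (a + a)"
    unfolding re_part_def s by simp
  then show "re_part (a + scaleC \<i> b) = a"
    by (simp add: scaleR_half_double)
  have "im_part (a + scaleC \<i> b) = scaleC (- \<i> / 2) (scaleC \<i> b + scaleC \<i> b)"
    unfolding im_part_def s by simp
  also have "\<dots> = scaleC (- \<i> / 2 * (2 * \<i>)) b"
    by (simp only: dbl scaleC_scaleC)
  finally show "im_part (a + scaleC \<i> b) = b"
    by (simp add: scaleC_one)
qed

locale abelian =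
  fixes B :: "'a::cstar_algebra set"
  assumes inclusion: "inclusion B"
begin

lemma sub: "unital_cstar_subalgebra B"
  using inclusion by (simp add: inclusion_def)

lemma comm: "x \<in> B \<Longrightarrow> y \<in> B \<Longrightarrow> x * y = y * x"
  using inclusion by (simp add: inclusion_def commuting_def)

lemmas mem = unital_cstar_subalgebraD[OF sub]

definition sa :: "'a set" where
  "sa = {x \<in> B. self_adjoint x}"

lemma saD: "x \<in> sa \<Longrightarrow> x \<in> B" "x \<in> sa \<Longrightarrow> star x = x" "x \<in> sa \<Longrightarrow> self_adjoint x"
  by (auto simp: sa_def self_adjoint_def)

lemma sa_mult: "x \<in> sa \<Longrightarrow> y \<in> sa \<Longrightarrow> x * y \<in> sa"
  by (auto simp: sa_def self_adjoint_def star_mult mem comm)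

lemma sa_add: "x \<in> sa \<Longrightarrow> y \<in> sa \<Longrightarrow> x + y \<in> sa"
  and sa_diff: "x \<in> sa \<Longrightarrow> y \<in> sa \<Longrightarrow> x - y \<in> sa"
  and sa_minus: "x \<in> sa \<Longrightarrow> - x \<in> sa"
  and sa_scaleR: "x \<in> sa \<Longrightarrow> r *\<^sub>R x \<in> sa"
  and sa_1: "1 \<in> sa" and sa_0: "0 \<in> sa"
  by (auto simp: sa_def mem self_adjoint_add self_adjoint_diff self_adjoint_minus self_adjoint_scaleR)

lemmas sa_intros = sa_add sa_diff sa_minus sa_scaleR sa_1 sa_0 sa_mult

lemma sa_re_part: "x \<in> B \<Longrightarrow> re_part x \<in> sa"
  and sa_im_part: "x \<in> B \<Longrightarrow> im_part x \<in> sa"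
  by (auto simp: sa_def self_adjoint_re_part self_adjoint_im_part)
    (auto simp: re_part_def im_part_def mem simp del: complex_vector.scale_minus_left)

section \<open>The cone of squares and its quadratic modules\<close>

definition sq :: "'a set" where
  "sq = {a * a |a. a \<in> sa}"

lemma sqI: "a \<in> sa \<Longrightarrow> a * a \<in> sq"
  by (auto simp: sq_def)

lemma sq_sa: "x \<in> sq \<Longrightarrow> x \<in> sa"
  by (auto simp: sq_def sa_mult)

lemma sq_0: "0 \<in> sq" and sq_1: "1 \<in> sq"
  using sqI[OF sa_0] sqI[OF sa_1] by auto

lemma sq_scaleR: "x \<in> sq \<Longrightarrow> 0 \<le> r \<Longrightarrow> r *\<^sub>R x \<in> sq"
proof -
  assume "x \<in> sq" "0 \<le> r"
  then obtain a where a: "a \<in> sa" "x = a * a" by (auto simp: sq_def)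
  have "r *\<^sub>R x = (sqrt r *\<^sub>R a) * (sqrt r *\<^sub>R a)"
    using \<open>0 \<le> r\<close> by (simp add: a)
  then show ?thesis using sqI[OF sa_scaleR[OF a(1), of "sqrt r"]] by simp
qed

lemma sq_mult: "x \<in> sq \<Longrightarrow> y \<in> sq \<Longrightarrow> x * y \<in> sq"
proof -
  assume "x \<in> sq" "y \<in> sq"
  then obtain a b where ab: "a \<in> sa" "x = a * a" "b \<in> sa" "y = b * b" by (auto simp: sq_def)
  have "a * a * (b * b) = a * (a * b) * b" by (simp add: mult.assoc)
  also have "\<dots> = a * (b * a) * b"
    using comm[of a b] ab by (simp add: saD)
  also have "\<dots> = (a * b) * (a * b)"
    by (simp only: mult.assoc)
  finally show ?thesis using ab sqI[OF sa_mult[of a b]] by simp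
qed

text \<open>For z = a + i b with commuting self-adjoint a and b, \<open>star z * z\<close> is the
  sum of the two squares, and a is the real part of z, whose norm is at most that of z.\<close>

lemma norm_sq_le:
  assumes "x \<in> sq" "y \<in> sq"
  shows "norm x \<le> norm (x + y)"
proof -
  from assms obtain a b where ab: "a \<in> sa" "x = a * a" "b \<in> sa" "y = b * b" by (auto simp: sq_def)
  define z where "z = a + scaleC \<i> b"
  have sz: "star z = a - scaleC \<i> b"
    using ab by (simp add: z_def star_add star_scaleC saD)
  have "star z * z = (a - scaleC \<i> b) * (a + scaleC \<i> b)"
    by (simp only: sz) (simp only: z_def)
  also have "\<dots> = a * a + b * b"
    using comm[of a b] ab(1,3)
    by (simp add: algebra_simps mult_scaleC_left mult_scaleC_right scaleC_scaleC scaleC_one saD)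
  finally have "star z * z = a * a + b * b" .
  then have z: "(norm z)\<^sup>2 = norm (x + y)"
    using cstar_identity[of z] ab by simp
  have "a = (1/2) *\<^sub>R (z + star z)"
    unfolding sz by (simp add: z_def scaleR_half_double)
  then have "norm a = 1/2 * norm (z + star z)" by (metis norm_scaleR abs_of_nonneg zero_le_divide_1_iff zero_le_numeral)
  also have "\<dots> \<le> norm z" using norm_triangle_ineq[of z "star z"] by simp
  finally have "(norm a)\<^sup>2 \<le> (norm z)\<^sup>2" by (intro power_mono) auto
  then show ?thesis
    using z ab norm_self_adjoint_square[of a] by (simp add: saD)
qed

text \<open>For r > 0, dividing by r writes x as r (1 - t) with t in the unit ball, where the root
  of 1 - t exists.\<close>

lemma sq_norm_criterion:
  assumes "x \<in> sa" "norm (r *\<^sub>R 1 - x) \<le> r"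
  shows "x \<in> sq"
proof (cases "r = 0")
  case True
  then show ?thesis using assms sq_0 by simp
next
  case False
  have "r > 0" using False assms(2) norm_ge_zero order_trans by (metis order_le_less)
  define t where "t = 1 - (1/r) *\<^sub>R x"
  have "t = (1/r) *\<^sub>R (r *\<^sub>R 1 - x)"
    using \<open>r > 0\<close> by (simp add: t_def scaleR_diff_right)
  then have "norm t \<le> 1"
    using \<open>r > 0\<close> assms(2) by simp
  moreover have "t \<in> sa" unfolding t_def by (intro sa_intros assms)
  ultimately obtain s where s: "s \<in> B" "self_adjoint s" "s * s = 1 - t"
    using sqrt_one_minus[OF sub] saD by metis
  then have "s \<in> sa" by (simp add: sa_def)
  have "x = r *\<^sub>R (s * s)"
    using \<open>r > 0\<close> by (simp add: s t_def)
  then show ?thesis using sq_scaleR[OF sqI[OF \<open>s \<in> sa\<close>], of r] \<open>r > 0\<close> by simp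
qed

lemma sq_norm_diff:
  assumes "a \<in> sa"
  shows "norm a *\<^sub>R 1 - a \<in> sq" "norm a *\<^sub>R 1 + a \<in> sq"
proof -
  show "norm a *\<^sub>R 1 - a \<in> sq" "norm a *\<^sub>R 1 + a \<in> sq"
    by (rule sq_norm_criterion[where r = "norm a"], intro sa_intros assms, simp)+
qed

lemma norm_sub_sq_le:
  assumes "x \<in> sq"
  shows "norm (norm x *\<^sub>R 1 - x) \<le> norm x"
  using norm_sq_le[OF sq_norm_diff(1)[OF sq_sa[OF assms]] assms] by simp

text \<open>Being a square is not visibly additive, but lying within distance r of r 1 is, by the
  triangle inequality; \<open>norm_sub_sq_le\<close> and \<open>sq_norm_criterion\<close> pass
  between the two.\<close>

lemma sq_add:
  assumes "x \<in> sq" "y \<in> sq"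
  shows "x + y \<in> sq"
proof (rule sq_norm_criterion)
  show "x + y \<in> sa" using assms by (simp add: sa_add sq_sa)
  have "(norm x + norm y) *\<^sub>R 1 - (x + y) = (norm x *\<^sub>R 1 - x) + (norm y *\<^sub>R 1 - y)"
    by (simp add: algebra_simps)
  then have "norm ((norm x + norm y) *\<^sub>R 1 - (x + y)) \<le> norm (norm x *\<^sub>R 1 - x) + norm (norm y *\<^sub>R 1 - y)"
    by (simp only: norm_triangle_ineq)
  then show "norm ((norm x + norm y) *\<^sub>R 1 - (x + y)) \<le> norm x + norm y"
    using norm_sub_sq_le[OF assms(1)] norm_sub_sq_le[OF assms(2)] by linarith
qed

lemma sq_const: "0 \<le> r \<Longrightarrow> r *\<^sub>R 1 \<in> sq"
  by (intro sq_scaleR sq_1)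

text \<open>Proper quadratic modules of real algebra. The intended maximal ones consist of the
  self-adjoint elements that are nonnegative at one character.\<close>

definition qmod :: "'a set \<Rightarrow> bool" where
  "qmod Q \<longleftrightarrow> Q \<subseteq> sa \<and> sq \<subseteq> Q \<and> (\<forall>p\<in>Q. \<forall>q\<in>Q. p + q \<in> Q) \<and> (\<forall>p\<in>sq. \<forall>q\<in>Q. p * q \<in> Q) \<and> - 1 \<notin> Q"

lemma qmod_extend_max:
  assumes "qmod Q0"
  obtains Q where "Q0 \<subseteq> Q" "qmod Q" "\<forall>Q'. qmod Q' \<longrightarrow> Q \<subseteq> Q' \<longrightarrow> Q' = Q"
proof -
  let ?A = "{Q. qmod Q \<and> Q0 \<subseteq> Q}"
  have "\<exists>M\<in>?A. \<forall>X\<in>?A. M \<subseteq> X \<longrightarrow> X = M"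
  proof (rule subset_Zorn_nonempty)
    show "?A \<noteq> {}" using assms by blast
    fix C assume C: "C \<noteq> {}" "subset.chain ?A C"
    then have CA: "\<And>X. X \<in> C \<Longrightarrow> qmod X \<and> Q0 \<subseteq> X" and ch: "\<And>X Y. X \<in> C \<Longrightarrow> Y \<in> C \<Longrightarrow> X \<subseteq> Y \<or> Y \<subseteq> X"
      by (auto simp: subset_chain_def)
    have "qmod (\<Union>C)"
      unfolding qmod_def
    proof (intro conjI ballI)
      show "\<Union>C \<subseteq> sa" "sq \<subseteq> \<Union>C" "- 1 \<notin> \<Union>C"
        using CA C(1) unfolding qmod_def by blast+
      show "p * q \<in> \<Union>C" if "p \<in> sq" "q \<in> \<Union>C" for p q
        using that CA unfolding qmod_def by blast
      show "p + q \<in> \<Union>C" if pq: "p \<in> \<Union>C" "q \<in> \<Union>C" for p q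
      proof -
        from pq obtain X Y where XY: "p \<in> X" "X \<in> C" "q \<in> Y" "Y \<in> C" by blast
        with ch[of X Y] have "\<exists>Z\<in>C. p \<in> Z \<and> q \<in> Z" by blast
        with CA show ?thesis unfolding qmod_def by blast
      qed
    qed
    with C(1) CA show "\<Union>C \<in> ?A" by blast
  qed
  then obtain M where M: "M \<in> ?A" "\<forall>X\<in>?A. M \<subseteq> X \<longrightarrow> X = M" by (rule bexE)
  show thesis
  proof (rule that[of M])
    show "\<forall>Q'. qmod Q' \<longrightarrow> M \<subseteq> Q' \<longrightarrow> Q' = M"
    proof (intro allI impI)
      fix Q' assume "qmod Q'" "M \<subseteq> Q'"
      with M(1) have "Q' \<in> ?A" by auto
      with M(2) \<open>M \<subseteq> Q'\<close> show "Q' = M" by blast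
    qed
  qed (use M in auto)
qed

end

section \<open>The character of a maximal quadratic module\<close>

locale maximal_qmod = abelian +
  fixes Q
  assumes Q: "qmod Q" and max: "\<And>Q'. qmod Q' \<Longrightarrow> Q \<subseteq> Q' \<Longrightarrow> Q' = Q"
begin

lemma Q_sa: "q \<in> Q \<Longrightarrow> q \<in> sa" and Q_sq: "q \<in> sq \<Longrightarrow> q \<in> Q" and Q_add: "p \<in> Q \<Longrightarrow> q \<in> Q \<Longrightarrow> p + q \<in> Q"
  and Q_mult: "p \<in> sq \<Longrightarrow> q \<in> Q \<Longrightarrow> p * q \<in> Q" and Q_minus_1: "- 1 \<notin> Q"
  using Q unfolding qmod_def by blast+

lemma Q_scaleR: "q \<in> Q \<Longrightarrow> 0 \<le> r \<Longrightarrow> r *\<^sub>R q \<in> Q"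
  using Q_mult[OF sq_const, of r q] by simp

text \<open>The set of all q + p a contains Q and a and has every closure property of a quadratic
  module, so by maximality it can fail only by being improper.\<close>

lemma not_mem_Q:
  assumes a: "a \<in> sa" "a \<notin> Q"
  obtains p q where "p \<in> sq" "q \<in> Q" "- 1 = q + p * a"
proof -
  define Q' where "Q' = {q + p * a |p q. p \<in> sq \<and> q \<in> Q}"
  have I: "q + p * a \<in> Q'" if "p \<in> sq" "q \<in> Q" for p q
    using that unfolding Q'_def by blast
  have "Q \<subseteq> Q'"
    using I[OF sq_0] by auto
  have "a \<in> Q'"
    using I[OF sq_1 Q_sq[OF sq_0]] by simp
  have "Q' \<subseteq> sa"
    unfolding Q'_def using a by (auto intro!: sa_intros simp: Q_sa sq_sa)
  moreover have "p + q \<in> Q'" if pq: "p \<in> Q'" "q \<in> Q'" for p q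
  proof -
    from pq obtain p1 q1 p2 q2 where *: "p1 \<in> sq" "q1 \<in> Q" "p = q1 + p1 * a" "p2 \<in> sq" "q2 \<in> Q" "q = q2 + p2 * a"
      unfolding Q'_def by blast
    have "p + q = (q1 + q2) + (p1 + p2) * a" unfolding *(3,6) by (simp add: algebra_simps)
    with * show ?thesis by (simp only:) (intro I sq_add Q_add)
  qed
  moreover have "p * q \<in> Q'" if pq: "p \<in> sq" "q \<in> Q'" for p q
  proof -
    from pq obtain p1 q1 where *: "p1 \<in> sq" "q1 \<in> Q" "q = q1 + p1 * a"
      unfolding Q'_def by blast
    have "p * q = p * q1 + (p * p1) * a" unfolding *(3) by (simp add: algebra_simps)
    with * pq show ?thesis by (simp only:) (intro I sq_mult Q_mult)
  qed
  moreover have "sq \<subseteq> Q'" using \<open>Q \<subseteq> Q'\<close> Q_sq by blast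
  moreover have "\<not> qmod Q'" using max[of Q'] \<open>Q \<subseteq> Q'\<close> \<open>a \<in> Q'\<close> a by blast
  ultimately have "- 1 \<in> Q'"
    unfolding qmod_def by blast
  then obtain p q where "- 1 = q + p * a" "p \<in> sq" "q \<in> Q" unfolding Q'_def by auto
  then show thesis by (intro that[of p q])
qed

lemma Q_total:
  assumes a: "a \<in> sa"
  shows "a \<in> Q \<or> - a \<in> Q"
proof (rule ccontr)
  assume "\<not> ?thesis"
  then have "a \<notin> Q" "- a \<notin> Q" by auto
  obtain p1 q1 where 1: "p1 \<in> sq" "q1 \<in> Q" "- 1 = q1 + p1 * a"
    by (rule not_mem_Q[OF a \<open>a \<notin> Q\<close>])
  obtain p2 q2 where 2: "p2 \<in> sq" "q2 \<in> Q" "- 1 = q2 + p2 * (- a)"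
    by (rule not_mem_Q[OF sa_minus[OF a] \<open>- a \<notin> Q\<close>])
  have e1: "p1 * a = - 1 - q1" using 1(3) by (simp add: algebra_simps)
  have e2: "p2 * a = 1 + q2" using 2(3) by (simp add: algebra_simps)
  have c: "p1 * p2 = p2 * p1" using 1(1) 2(1) by (intro comm) (auto simp: saD sq_sa)
  \<comment> \<open>Computing the product of p1, p2 and a in two ways eliminates a and exhibits - p1
    as an element of Q.\<close>
  have "p2 * (p1 * a) = p1 * (p2 * a)" by (simp flip: mult.assoc add: c)
  then have "p2 * (- 1 - q1) = p1 * (1 + q2)" unfolding e1 e2 .
  then have "p1 + p1 * q2 = - (p2 + p2 * q1)" by (simp add: distrib_left right_diff_distrib)
  moreover have "p1 + (p2 + p2 * q1 + p1 * q2) = (p1 + p1 * q2) + (p2 + p2 * q1)" by (simp only: ac_simps)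
  ultimately have "- p1 = p2 + p2 * q1 + p1 * q2" by (intro minus_unique) simp
  moreover have "p2 + p2 * q1 + p1 * q2 \<in> Q"
    using 1 2 by (simp add: Q_add Q_mult Q_sq)
  ultimately have mp: "- p1 \<in> Q" by simp
  \<comment> \<open>These make a = \<open>u * u - v * v\<close>. As both p1 and - p1 lie in Q, so
    does p1 a, and then q1 + p1 a = - 1 lies in Q as well.\<close>
  define u v where "u = (1/2) *\<^sub>R (a + 1)" and "v = (1/2) *\<^sub>R (a - 1)"
  have uv: "u \<in> sa" "v \<in> sa" unfolding u_def v_def by (intro sa_intros a)+
  have "u * u - v * v = (1/4) *\<^sub>R (a + a + a + a)"
    unfolding u_def v_def by (simp add: algebra_simps)
  also have "a + a + a + a = (4::real) *\<^sub>R a"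
  proof -
    have "(4::real) *\<^sub>R a = (1 + 1 + 1 + 1) *\<^sub>R a" by simp
    then show ?thesis by (simp only: scaleR_add_left scaleR_one)
  qed
  finally have auv: "a = u * u - v * v" by simp
  have "p1 * a = (u * u) * p1 + (v * v) * (- p1)"
    using comm[of "u * u" p1] comm[of "v * v" p1] uv 1(1)
    by (simp add: auv algebra_simps saD sa_mult sq_sa)
  moreover have "(u * u) * p1 + (v * v) * (- p1) \<in> Q"
    using uv 1(1) mp by (intro Q_add Q_mult sqI) (auto simp: Q_sq)
  ultimately have "q1 + p1 * a \<in> Q" using 1 Q_add by simp
  then show False using 1(3) Q_minus_1 by simp
qed

lemma Q_const: "r *\<^sub>R 1 \<in> Q \<Longrightarrow> 0 \<le> r"
proof (rule ccontr)
  assume "r *\<^sub>R 1 \<in> Q" "\<not> 0 \<le> r"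
  then have "(1 / - r) *\<^sub>R (r *\<^sub>R 1) \<in> Q" by (intro Q_scaleR[of "r *\<^sub>R 1"]) auto
  with \<open>\<not> 0 \<le> r\<close> Q_minus_1 show False by simp
qed

text \<open>\<open>val a c\<close> says that \<open>c\<close> is the value at \<open>a\<close> of the character belonging to \<open>Q\<close>.\<close>

definition val :: "'a \<Rightarrow> real \<Rightarrow> bool" where
  "val a c \<longleftrightarrow> a \<in> sa \<and> (\<forall>e>0. a + (e - c) *\<^sub>R 1 \<in> Q \<and> (e + c) *\<^sub>R 1 - a \<in> Q)"

text \<open>The value is the supremum of the r with a - r in Q. Totality of Q turns failure just
  above the supremum into the upper estimate. Q is not known to be closed, whence the margin e in
  \<open>val\<close>.\<close>

lemma val_ex:
  assumes a: "a \<in> sa"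
  obtains c where "val a c"
proof -
  define L where "L = {r. a - r *\<^sub>R 1 \<in> Q}"
  have ne: "- norm a \<in> L"
    using Q_sq[OF sq_norm_diff(2)[OF a]] by (simp add: L_def add.commute)
  have ub: "r \<le> norm a" if "r \<in> L" for r
  proof -
    have "(norm a *\<^sub>R 1 - a) + (a - r *\<^sub>R 1) \<in> Q"
      using that by (intro Q_add[OF Q_sq[OF sq_norm_diff(1)[OF a]]]) (simp add: L_def)
    then have "(norm a - r) *\<^sub>R 1 \<in> Q" by (simp add: algebra_simps)
    then show ?thesis using Q_const by fastforce
  qed
  then have bdd: "bdd_above L" by (auto simp: bdd_above_def)
  have "val a (Sup L)"
    unfolding val_def
  proof (intro conjI allI impI a)
    fix e :: real assume "e > 0"
    then obtain r where r: "r \<in> L" "Sup L - e < r"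
      using less_cSup_iff[OF _ bdd, of "Sup L - e"] ne by auto
    have "(a - r *\<^sub>R 1) + (r - (Sup L - e)) *\<^sub>R 1 \<in> Q"
      using r by (intro Q_add[OF _ Q_sq[OF sq_const]]) (auto simp: L_def)
    then show "a + (e - Sup L) *\<^sub>R 1 \<in> Q" by (simp add: algebra_simps)
    have "Sup L + e \<notin> L"
      using \<open>e > 0\<close> cSup_upper[OF _ bdd, of "Sup L + e"] by auto
    then have "- (a - (Sup L + e) *\<^sub>R 1) \<in> Q"
      using Q_total[of "a - (Sup L + e) *\<^sub>R 1"] a by (auto simp: L_def sa_intros)
    then show "(e + Sup L) *\<^sub>R 1 - a \<in> Q" by (simp add: algebra_simps)
  qed
  then show thesis by (rule that)
qed

lemma val_nonneg:
  assumes "val a c" "a \<in> Q"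
  shows "0 \<le> c"
proof (rule field_le_epsilon)
  fix e :: real assume "e > 0"
  then have "(e + c) *\<^sub>R 1 - a + a \<in> Q" using assms by (intro Q_add[OF _ assms(2)]) (auto simp: val_def)
  then have "0 \<le> e + c" by (intro Q_const) simp
  then show "0 \<le> c + e" by simp
qed

lemma val_add:
  assumes "val a c" "val b d"
  shows "val (a + b) (c + d)"
  unfolding val_def
proof (intro conjI allI impI)
  show "a + b \<in> sa" using assms by (auto simp: val_def sa_add)
  fix e :: real assume "e > 0"
  then have h: "e/2 > 0" by simp
  have "(a + (e/2 - c) *\<^sub>R 1) + (b + (e/2 - d) *\<^sub>R 1) \<in> Q"
    using assms h by (simp add: val_def Q_add)
  also have "(a + (e/2 - c) *\<^sub>R 1) + (b + (e/2 - d) *\<^sub>R 1) = (a + b) + ((e/2 - c) + (e/2 - d)) *\<^sub>R 1"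
    unfolding scaleR_add_left by (simp only: ac_simps)
  also have "(e/2 - c) + (e/2 - d) = e - (c + d)" by simp
  finally show "a + b + (e - (c + d)) *\<^sub>R 1 \<in> Q" .
  have "((e/2 + c) *\<^sub>R 1 - a) + ((e/2 + d) *\<^sub>R 1 - b) \<in> Q"
    using assms h by (simp add: val_def Q_add)
  also have "((e/2 + c) *\<^sub>R 1 - a) + ((e/2 + d) *\<^sub>R 1 - b) = ((e/2 + c) + (e/2 + d)) *\<^sub>R 1 - (a + b)"
    unfolding scaleR_add_left by (simp only: diff_conv_add_uminus minus_add_distrib ac_simps)
  also have "(e/2 + c) + (e/2 + d) = e + (c + d)" by simp
  finally show "(e + (c + d)) *\<^sub>R 1 - (a + b) \<in> Q" .
qed

lemma val_minus: "val a c \<Longrightarrow> val (- a) (- c)"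
  unfolding val_def by (auto simp: sa_minus add.commute)

lemma val_const: "val (c *\<^sub>R 1) c"
proof -
  have "c *\<^sub>R 1 + (e - c) *\<^sub>R 1 = e *\<^sub>R (1::'a)" "(e + c) *\<^sub>R 1 - c *\<^sub>R 1 = e *\<^sub>R (1::'a)" for e
    by (simp_all add: algebra_simps)
  then show ?thesis
    unfolding val_def by (auto intro!: sa_intros Q_sq sq_const)
qed

lemma val_diff: "val a c \<Longrightarrow> val b d \<Longrightarrow> val (a - b) (c - d)"
  using val_add[OF _ val_minus, of a c b d] by simp

lemma val_unique: "val a c \<Longrightarrow> val a d \<Longrightarrow> c = d"
proof -
  have le: "c \<le> d" if "val a c" "val a d" for c d
    using val_nonneg[OF val_diff[OF that(2,1)]] Q_sq[OF sq_0] by simp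
  assume "val a c" "val a d"
  then show ?thesis using le by (intro order_antisym)
qed

lemma val_scaleR:
  assumes "val a c"
  shows "val (r *\<^sub>R a) (r * c)"
proof -
  have pos: "val (r *\<^sub>R a) (r * c)" if "r > 0" for r
    unfolding val_def
  proof (intro conjI allI impI)
    show "r *\<^sub>R a \<in> sa" using assms by (simp add: val_def sa_scaleR)
    fix e :: real assume "e > 0"
    with that have "e / r > 0" by simp
    then have "r *\<^sub>R (a + (e / r - c) *\<^sub>R 1) \<in> Q" "r *\<^sub>R ((e / r + c) *\<^sub>R 1 - a) \<in> Q"
      using assms that by (auto intro!: Q_scaleR simp: val_def)
    with that show "r *\<^sub>R a + (e - r * c) *\<^sub>R 1 \<in> Q" "(e + r * c) *\<^sub>R 1 - r *\<^sub>R a \<in> Q"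
      by (simp_all add: scaleR_add_right scaleR_diff_right distrib_left right_diff_distrib)
  qed
  consider "r > 0" | "r = 0" | "- r > 0" by linarith
  then show ?thesis
  proof cases
    case 2
    then show ?thesis using val_const[of 0] by simp
  next
    case 3
    then show ?thesis using val_minus[OF pos[of "- r"]] by simp
  qed (use pos in auto)
qed

lemma val_square_0:
  assumes "val b 0"
  shows "val (b * b) 0"
  unfolding val_def
proof (intro conjI allI impI)
  have b: "b \<in> sa" using assms by (simp add: val_def)
  then show "b * b \<in> sa" by (simp add: sa_mult)
  fix e :: real assume "e > 0"
  then show "b * b + (e - 0) *\<^sub>R 1 \<in> Q"
    by (intro Q_add Q_sq sqI b sq_const) auto
  define d where "d = sqrt e"
  have d: "d > 0" "d * d = e" using \<open>e > 0\<close> by (auto simp: d_def)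
  \<comment> \<open>\<open>2 d (d\<^sup>2 - b\<^sup>2) = (d - b)\<^sup>2 (d + b) + (d + b)\<^sup>2 (d - b)\<close>, and each summand lies in \<open>Q\<close>\<close>
  define p m where "p = d *\<^sub>R 1 + b" and "m = d *\<^sub>R 1 - b"
  have "p \<in> Q" "m \<in> Q" "p \<in> sa" "m \<in> sa"
    using assms d b unfolding p_def m_def val_def by (auto simp: add.commute intro: sa_intros)
  then have "(1 / (2 * d)) *\<^sub>R (m * m * p + p * p * m) \<in> Q"
    using d by (intro Q_scaleR Q_add Q_mult sqI) auto
  also have "m * m * p + p * p * m = m * p * (p + m)"
  proof -
    have "m * p = p * m" by (simp add: p_def m_def algebra_simps)
    then show ?thesis by (simp add: algebra_simps) (metis mult.assoc)
  qed
  also have "p + m = (2 * d) *\<^sub>R 1"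
    by (simp add: p_def m_def flip: scaleR_2)
  also have "m * p * ((2 * d) *\<^sub>R 1) = (2 * d) *\<^sub>R (e *\<^sub>R 1 - b * b)"
    by (simp add: p_def m_def algebra_simps flip: d(2))
  finally show "(e + 0) *\<^sub>R 1 - b * b \<in> Q" using d by simp
qed

text \<open>Subtracting the constant c reduces to an element of value 0.\<close>

lemma val_square:
  assumes "val a c"
  shows "val (a * a) (c * c)"
proof -
  define b where "b = a - c *\<^sub>R 1"
  have b: "val b 0"
    unfolding b_def using val_diff[OF assms val_const[of c]] by simp
  have "a * a = b * b + (2 * c) *\<^sub>R b + (c * c) *\<^sub>R 1"
    unfolding b_def by (simp add: algebra_simps flip: scaleR_2)
  then show ?thesis
    using val_add[OF val_add[OF val_square_0[OF b] val_scaleR[OF b, of "2 * c"]] val_const[of "c * c"]]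
    by simp
qed

text \<open>Polarization from squares: a quadratic module is stable under multiplication by squares,
  not under arbitrary products, so squares have to come first.\<close>

lemma val_mult:
  assumes "val a c" "val b d"
  shows "val (a * b) (c * d)"
proof -
  have ab: "a * b = b * a" using assms by (intro comm) (auto simp: val_def saD)
  have "val ((a + b) * (a + b) - a * a - b * b) ((c + d) * (c + d) - c * c - d * d)"
    by (intro val_diff val_square val_add assms)
  moreover have "(a + b) * (a + b) - a * a - b * b = 2 *\<^sub>R (a * b)"
    using ab by (simp add: algebra_simps scaleR_2)
  moreover have "(c + d) * (c + d) - c * c - d * d = 2 * (c * d)" by (simp add: algebra_simps)
  ultimately have "val (2 *\<^sub>R (a * b)) (2 * (c * d))" by metis
  from val_scaleR[OF this, of "1/2"] show ?thesis by simp
qed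

definition phi :: "'a \<Rightarrow> real" where
  "phi a = (THE c. val a c)"

lemma val_phi: "a \<in> sa \<Longrightarrow> val a (phi a)"
proof -
  assume "a \<in> sa"
  then obtain c where c: "val a c" by (rule val_ex)
  then have "phi a = c" unfolding phi_def by (rule the_equality) (rule val_unique[OF _ c])
  with c show ?thesis by simp
qed

lemma phi_eqI: "val a c \<Longrightarrow> phi a = c"
  unfolding phi_def by (rule the_equality) (auto intro: val_unique)

definition qchar :: "'a \<Rightarrow> complex" where
  "qchar = restrict (\<lambda>x. of_real (phi (re_part x)) + \<i> * of_real (phi (im_part x))) B"

lemma qchar_eqI:
  assumes "val a c" "val b d" "x = a + scaleC \<i> b"
  shows "qchar x = of_real c + \<i> * of_real d"
proof -
  have ab: "a \<in> sa" "b \<in> sa" using assms by (auto simp: val_def)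
  then have "x \<in> B" using assms by (simp add: mem saD)
  then show ?thesis
    using re_im_unique[of a b] ab assms by (simp add: qchar_def saD phi_eqI)
qed

lemma val_decomp:
  assumes "x \<in> B"
  obtains a c b d where "val a c" "val b d" "x = a + scaleC \<i> b"
  by (rule that[OF val_phi[OF sa_re_part[OF assms]] val_phi[OF sa_im_part[OF assms]] re_im_decomp[of x]])

lemma qchar_character: "qchar \<in> characters B"
  unfolding characters_def
proof (intro CollectI conjI ballI allI)
  show "qchar \<in> extensional B" by (simp add: qchar_def)
  have v0: "val 0 0" using val_const[of 0] by simp
  have v1: "val 1 1" using val_const[of 1] by simp
  show "qchar 1 = 1" using qchar_eqI[OF v1 v0] by simp
  have m: "qchar (x * y) = qchar x * qchar y" if xy: "x \<in> B" "y \<in> B" for x y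
  proof -
    obtain a c b d where x: "val a c" "val b d" "x = a + scaleC \<i> b" by (rule val_decomp[OF xy(1)])
    obtain a' c' b' d' where y: "val a' c'" "val b' d'" "y = a' + scaleC \<i> b'" by (rule val_decomp[OF xy(2)])
    have "x * y = (a * a' - b * b') + scaleC \<i> (a * b' + b * a')"
      unfolding x(3) y(3) by (simp add: algebra_simps mult_scaleC_left mult_scaleC_right scaleC_scaleC scaleC_add_right scaleC_one)
    then have "qchar (x * y) = of_real (c * c' - d * d') + \<i> * of_real (c * d' + d * c')"
      by (rule qchar_eqI[OF val_diff[OF val_mult[OF x(1) y(1)] val_mult[OF x(2) y(2)]]
            val_add[OF val_mult[OF x(1) y(2)] val_mult[OF x(2) y(1)]]])
    then show ?thesis
      using qchar_eqI[OF x] qchar_eqI[OF y] by (simp add: algebra_simps)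
  qed
  then show "\<And>x y. x \<in> B \<Longrightarrow> y \<in> B \<Longrightarrow> qchar (x * y) = qchar x * qchar y" .
  show "qchar (x + y) = qchar x + qchar y" if xy: "x \<in> B" "y \<in> B" for x y
  proof -
    obtain a c b d where x: "val a c" "val b d" "x = a + scaleC \<i> b" by (rule val_decomp[OF xy(1)])
    obtain a' c' b' d' where y: "val a' c'" "val b' d'" "y = a' + scaleC \<i> b'" by (rule val_decomp[OF xy(2)])
    have "x + y = (a + a') + scaleC \<i> (b + b')"
      unfolding x(3) y(3) by (simp add: algebra_simps scaleC_add_right)
    then have "qchar (x + y) = of_real (c + c') + \<i> * of_real (d + d')"
      by (rule qchar_eqI[OF val_add[OF x(1) y(1)] val_add[OF x(2) y(2)]])
    then show ?thesis
      using qchar_eqI[OF x] qchar_eqI[OF y] by (simp add: algebra_simps)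
  qed
  show "qchar (scaleC c x) = c * qchar x" if "x \<in> B" for c x
  proof -
    \<comment> \<open>Homogeneity reduces to multiplicativity, once the value at c 1 is
      known.\<close>
    have "scaleC c 1 = Re c *\<^sub>R 1 + scaleC \<i> (Im c *\<^sub>R 1 :: 'a)"
      unfolding scaleC_of_real[symmetric] scaleC_scaleC scaleC_add_left[symmetric]
      by (simp add: complex_eq[symmetric])
    then have "qchar (scaleC c 1) = c"
      using qchar_eqI[OF val_const val_const] by (simp add: complex_eq[symmetric])
    moreover have "scaleC c x = scaleC c 1 * x" by (simp add: mult_scaleC_left)
    ultimately show ?thesis using m[of "scaleC c 1" x] that by (simp add: mem)
  qed
qed

end

section \<open>Gelfand duality: norm, adjoint and positive parts through characters\<close>

context abelian
begin

text \<open>The element 1 - a a is a square, so any quadratic module that also contains a a - 1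
  forces the value of a a to be 1. The work is to see that the module generated by a a - 1 is
  proper.\<close>

lemma character_norm_one:
  assumes a: "a \<in> sa" "norm a = 1"
  obtains \<tau> where "\<tau> \<in> characters B" "cmod (\<tau> a) = 1"
proof -
  have w: "1 - a * a \<in> sq"
    using sq_norm_diff(1)[OF sa_mult[OF a(1) a(1)]] norm_self_adjoint_square[of a] a by (simp add: saD)
  define Q0 where "Q0 = {p + q * (a * a - 1) |p q. p \<in> sq \<and> q \<in> sq}"
  have I: "p + q * (a * a - 1) \<in> Q0" if "p \<in> sq" "q \<in> sq" for p q
    using that unfolding Q0_def by blast
  have "qmod Q0"
    unfolding qmod_def
  proof (intro conjI ballI)
    show "Q0 \<subseteq> sa"
      unfolding Q0_def using a by (auto intro!: sa_intros simp: sq_sa)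
    show "sq \<subseteq> Q0"
      using I[OF _ sq_0] by auto
    show "x + y \<in> Q0" if xy: "x \<in> Q0" "y \<in> Q0" for x y
    proof -
      from xy obtain p1 q1 p2 q2 where *: "p1 \<in> sq" "q1 \<in> sq" "x = p1 + q1 * (a * a - 1)"
        "p2 \<in> sq" "q2 \<in> sq" "y = p2 + q2 * (a * a - 1)"
        unfolding Q0_def by blast
      have "x + y = (p1 + p2) + (q1 + q2) * (a * a - 1)" unfolding *(3,6) by (simp add: algebra_simps)
      with * show ?thesis by (simp only:) (intro I sq_add)
    qed
    show "x * y \<in> Q0" if xy: "x \<in> sq" "y \<in> Q0" for x y
    proof -
      from xy obtain p1 q1 where *: "p1 \<in> sq" "q1 \<in> sq" "y = p1 + q1 * (a * a - 1)"
        unfolding Q0_def by blast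
      have "x * y = (x * p1) + (x * q1) * (a * a - 1)" unfolding *(3) by (simp add: algebra_simps)
      with * xy show ?thesis by (simp only:) (intro I sq_mult)
    qed
    show "- 1 \<notin> Q0"
    proof
      assume "- 1 \<in> Q0"
      then obtain p q where pq: "p \<in> sq" "q \<in> sq" "- 1 = p + q * (a * a - 1)"
        unfolding Q0_def by blast
      \<comment> \<open>K is large enough for K - q to be a square. Multiplying it by the square 1 -
        a a and adding p shows that K - 1 is K a a plus a square, so the norm of K a a would be at
        most K - 1, while it is K.\<close>
      define K where "K = norm q + 1"
      have "(norm q *\<^sub>R 1 - q) + 1 \<in> sq"
        using pq by (intro sq_add sq_1 sq_norm_diff sq_sa)
      then have "(K *\<^sub>R 1 - q) \<in> sq" by (simp add: K_def algebra_simps)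
      then have "(K *\<^sub>R 1 - q) * (1 - a * a) + p \<in> sq"
        using w pq by (intro sq_add sq_mult)
      moreover have "(K *\<^sub>R 1 - q) * (1 - a * a) + p = (K - 1) *\<^sub>R 1 - K *\<^sub>R (a * a)"
      proof -
        have "(K *\<^sub>R 1 - q) * (1 - a * a) + p = K *\<^sub>R 1 - K *\<^sub>R (a * a) + (p + q * (a * a - 1))"
          by (simp add: algebra_simps)
        also have "\<dots> = K *\<^sub>R 1 - K *\<^sub>R (a * a) + - 1" by (simp only: pq(3)[symmetric])
        finally show ?thesis by (simp add: algebra_simps)
      qed
      ultimately have "norm (K *\<^sub>R (a * a)) \<le> norm (K *\<^sub>R (a * a) + ((K - 1) *\<^sub>R 1 - K *\<^sub>R (a * a)))"
        using a by (intro norm_sq_le sq_scaleR sqI) (auto simp: K_def)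
      also have "\<dots> = K - 1" by (simp add: K_def)
      also have "norm (K *\<^sub>R (a * a)) = K"
        using norm_self_adjoint_square[of a] a by (simp add: saD K_def)
      finally show False by simp
    qed
  qed
  then obtain Q where ext: "Q0 \<subseteq> Q" "qmod Q" "\<forall>Q'. qmod Q' \<longrightarrow> Q \<subseteq> Q' \<longrightarrow> Q' = Q"
    by (rule qmod_extend_max)
  interpret maximal_qmod B Q
    by unfold_locales (use ext in auto)
  have "a * a - 1 \<in> Q0"
    using I[OF sq_0 sq_1] by simp
  then have 1: "a * a - 1 \<in> Q" using ext by blast
  have 2: "- (a * a - 1) \<in> Q" using Q_sq[OF w] by simp
  have v: "val a (phi a)" using a by (intro val_phi)
  have "val (a * a - 1) (phi a * phi a - 1)"
    using val_diff[OF val_square[OF v] val_const[of 1]] by simp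
  from val_nonneg[OF this 1] val_nonneg[OF val_minus[OF this] 2]
  have "phi a * phi a = 1" by simp
  then have "(phi a)\<^sup>2 = 1" by (simp add: power2_eq_square)
  then have "\<bar>phi a\<bar> = 1" unfolding power2_eq_1_iff by auto
  moreover have "qchar a = of_real (phi a)"
    using qchar_eqI[OF v val_const[of 0]] by simp
  ultimately show thesis
    using that[OF qchar_character] by simp
qed

lemma characterD:
  assumes "\<tau> \<in> characters B"
  shows "x \<in> B \<Longrightarrow> y \<in> B \<Longrightarrow> \<tau> (x + y) = \<tau> x + \<tau> y" "x \<in> B \<Longrightarrow> \<tau> (scaleC c x) = c * \<tau> x"
    "x \<in> B \<Longrightarrow> y \<in> B \<Longrightarrow> \<tau> (x * y) = \<tau> x * \<tau> y" "\<tau> 1 = 1" "\<tau> 0 = 0"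
    "x \<in> B \<Longrightarrow> \<tau> (- x) = - \<tau> x" "x \<in> B \<Longrightarrow> y \<in> B \<Longrightarrow> \<tau> (x - y) = \<tau> x - \<tau> y"
    "x \<in> B \<Longrightarrow> \<tau> (r *\<^sub>R x) = of_real r * \<tau> x" "\<tau> \<in> extensional B"
proof -
  have add: "\<And>x y. x \<in> B \<Longrightarrow> y \<in> B \<Longrightarrow> \<tau> (x + y) = \<tau> x + \<tau> y"
    and sc: "\<And>c x. x \<in> B \<Longrightarrow> \<tau> (scaleC c x) = c * \<tau> x"
    using assms by (auto simp: characters_def)
  show "x \<in> B \<Longrightarrow> y \<in> B \<Longrightarrow> \<tau> (x + y) = \<tau> x + \<tau> y" "x \<in> B \<Longrightarrow> \<tau> (scaleC c x) = c * \<tau> x"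
    "x \<in> B \<Longrightarrow> y \<in> B \<Longrightarrow> \<tau> (x * y) = \<tau> x * \<tau> y" "\<tau> 1 = 1" "\<tau> \<in> extensional B"
    using assms by (auto simp: characters_def)
  show "\<tau> 0 = 0" using sc[of 1 0] mem(8) by simp
  show m: "x \<in> B \<Longrightarrow> \<tau> (- x) = - \<tau> x" for x
    using sc[of x "-1"] by (simp add: scaleC_one)
  show "x \<in> B \<Longrightarrow> y \<in> B \<Longrightarrow> \<tau> (x - y) = \<tau> x - \<tau> y"
    using add[of x "- y"] m[of y] by (simp add: mem)
  show "x \<in> B \<Longrightarrow> \<tau> (r *\<^sub>R x) = of_real r * \<tau> x"
    by (simp flip: scaleC_of_real add: sc)
qed

lemma character_sum:
  assumes "\<tau> \<in> characters B" "\<And>i. i \<in> I \<Longrightarrow> f i \<in> B"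
  shows "\<tau> (sum f I) = (\<Sum>i\<in>I. \<tau> (f i))"
  using assms(2)
  by (induction I rule: infinite_finite_induct)
    (simp_all add: characterD[OF assms(1)] mem)

text \<open>The geometric series g of h satisfies g = 1 + h g, so the value 1 at h would give 0 = 1.
  This is automatic continuity of characters: g lies in B because B is closed.\<close>

lemma character_ne_one:
  assumes \<tau>: "\<tau> \<in> characters B" and h: "h \<in> B" "norm h < 1"
  shows "\<tau> h \<noteq> 1"
proof
  assume "\<tau> h = 1"
  have hp: "h ^ k \<in> B" for k by (induction k) (auto simp: mem h)
  have sm: "summable (\<lambda>k. h ^ k)" by (rule complete_algebra_summable_geometric[OF h(2)])
  define g where "g = (\<Sum>k. h ^ k)"
  have lim: "(\<lambda>m. \<Sum>k<m. h ^ k) \<longlonglongrightarrow> g"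
    using summable_LIMSEQ[OF sm] by (simp add: g_def)
  have "g \<in> B"
    by (rule closed_sequentially[OF mem(10) _ lim]) (intro mem(11) hp)
  have "g = 1 + (\<Sum>k. h ^ Suc k)"
    unfolding g_def using suminf_split_head[OF sm] by simp
  also have "(\<Sum>k. h ^ Suc k) = h * g"
    unfolding g_def using suminf_mult[OF sm, of h] by simp
  finally have "\<tau> g = \<tau> 1 + \<tau> h * \<tau> g"
    using h \<open>g \<in> B\<close> by (metis characterD(1,3)[OF \<tau>] mem(3,8))
  with \<open>\<tau> h = 1\<close> show False using characterD(4)[OF \<tau>] by simp
qed

lemma character_le_norm:
  assumes \<tau>: "\<tau> \<in> characters B" and x: "x \<in> B"
  shows "cmod (\<tau> x) \<le> norm x"
proof (rule ccontr)
  assume c: "\<not> ?thesis"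
  then have nz: "\<tau> x \<noteq> 0" using norm_ge_zero[of x] by (metis norm_zero)
  define h where "h = scaleC (1 / \<tau> x) x"
  have "h \<in> B" by (simp add: h_def mem x)
  moreover have "norm h < 1" using c nz by (simp add: h_def norm_scaleC norm_divide divide_simps)
  moreover have "\<tau> h = 1" using nz by (simp add: h_def characterD[OF \<tau>] x)
  ultimately show False using character_ne_one[OF \<tau>] by blast
qed

text \<open>A non-real value can be normalized by a real affine change of a to a self-adjoint b of
  value i. Then the square b b has value -1, which pushes a suitable element of norm below 1 to the
  value 1.\<close>

lemma character_sa_real:
  assumes \<tau>: "\<tau> \<in> characters B" and a: "a \<in> sa"
  shows "\<tau> a \<in> \<real>"
proof (rule ccontr)
  assume "\<tau> a \<notin> \<real>"
  then have im: "Im (\<tau> a) \<noteq> 0" by (simp add: complex_is_Real_iff)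
  define b where "b = (1 / Im (\<tau> a)) *\<^sub>R (a - Re (\<tau> a) *\<^sub>R 1)"
  have b: "b \<in> sa" unfolding b_def by (intro sa_intros a)
  have aB: "a \<in> B" using a by (rule saD)
  have "\<tau> (a - Re (\<tau> a) *\<^sub>R 1) = \<i> * of_real (Im (\<tau> a))"
    using complex_eq[of "\<tau> a"] by (simp add: characterD[OF \<tau>] aB mem) (simp add: algebra_simps)
  then have tb: "\<tau> b = \<i>"
    using im by (simp add: b_def characterD[OF \<tau>] aB mem)
  \<comment> \<open>Since b b is a square, r - b b has norm at most r, while its value is r + 1.
    Dividing by 1 + r gives h of norm below 1 and value 1.\<close>
  define r where "r = norm (b * b)"
  define h where "h = (1 / (1 + r)) *\<^sub>R (r *\<^sub>R 1 - b * b)"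
  have r: "r \<ge> 0" by (simp add: r_def)
  have "norm h \<le> (1 / (1 + r)) * r"
    using norm_sub_sq_le[OF sqI[OF b]] r unfolding h_def r_def by (simp add: divide_right_mono)
  also have "\<dots> < 1" using r by simp
  finally have "norm h < 1" .
  moreover have hB: "h \<in> B" using b by (simp add: h_def mem saD)
  moreover have "\<tau> h = 1"
  proof -
    have "\<tau> h = of_real (1 / (1 + r)) * (of_real r + 1)"
      using b tb by (simp add: h_def characterD[OF \<tau>] mem saD)
    also have "\<dots> = of_real ((1 / (1 + r)) * (r + 1))" by (simp only: of_real_add of_real_mult of_real_1)
    also have "(1 / (1 + r)) * (r + 1) = 1" using r by (simp add: add.commute add_nonneg_eq_0_iff)
    finally show ?thesis by simp
  qed
  ultimately show False using character_ne_one[OF \<tau>] by blast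
qed

lemma character_star:
  assumes \<tau>: "\<tau> \<in> characters B" and x: "x \<in> B"
  shows "\<tau> (star x) = cnj (\<tau> x)"
proof -
  let ?a = "re_part x" and ?b = "im_part x"
  have ab: "?a \<in> sa" "?b \<in> sa" using x by (simp_all add: sa_re_part sa_im_part)
  note abB = saD(1)[OF ab(1)] saD(1)[OF ab(2)]
  have sx: "star x = ?a + scaleC (- \<i>) ?b"
    by (subst re_im_decomp[of x]) (simp add: star_add star_scaleC saD(2)[OF ab(1)] saD(2)[OF ab(2)])
  have "cnj (\<tau> ?a) = \<tau> ?a" "cnj (\<tau> ?b) = \<tau> ?b"
    using character_sa_real[OF \<tau>] ab Reals_cnj_iff by blast+
  moreover have "\<tau> x = \<tau> ?a + \<i> * \<tau> ?b"
    by (subst re_im_decomp[of x]) (simp add: characterD[OF \<tau>] abB mem)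
  moreover have "\<tau> (star x) = \<tau> ?a + - \<i> * \<tau> ?b"
    unfolding sx by (subst characterD(1)[OF \<tau>]) (simp_all only: characterD(2)[OF \<tau>] abB mem(5))
  ultimately show ?thesis by simp
qed

lemma character_star_mult:
  assumes \<tau>: "\<tau> \<in> characters B" and x: "x \<in> B"
  shows "\<tau> (star x * x) = of_real ((cmod (\<tau> x))\<^sup>2)"
  using complex_norm_square[of "\<tau> x"]
  by (simp add: characterD[OF \<tau>] mem x character_star[OF \<tau>] mult.commute)

text \<open>By the C*-identity it suffices to attain the norm of the self-adjoint element
  \<open>star x * x\<close>.\<close>

lemma character_attains_norm:
  assumes x: "x \<in> B"
  obtains \<tau> where "\<tau> \<in> characters B" "cmod (\<tau> x) = norm x"
proof (cases "x = 0")
  case True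
  obtain \<tau> where \<tau>: "\<tau> \<in> characters B" "cmod (\<tau> 1) = 1"
    using character_norm_one[OF sa_1] by auto
  show ?thesis by (rule that[OF \<tau>(1)]) (simp add: True characterD[OF \<tau>(1)])
next
  case False
  define a where "a = (1 / (norm x)\<^sup>2) *\<^sub>R (star x * x)"
  have "a \<in> sa" using x by (simp add: a_def sa_def mem self_adjoint_scaleR)
  moreover have "norm a = 1" using False by (simp add: a_def cstar_identity)
  ultimately obtain \<tau> where \<tau>: "\<tau> \<in> characters B" "cmod (\<tau> a) = 1" by (rule character_norm_one)
  have "\<tau> a = of_real ((1 / (norm x)\<^sup>2) * (cmod (\<tau> x))\<^sup>2)"
    unfolding a_def using x by (simp add: characterD(8)[OF \<tau>(1)] mem character_star_mult[OF \<tau>(1)])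
  then have "cmod (\<tau> a) = (cmod (\<tau> x))\<^sup>2 / (norm x)\<^sup>2" by (simp only: norm_of_real) simp
  with \<tau>(2) False have "(cmod (\<tau> x))\<^sup>2 = (norm x)\<^sup>2" by simp
  then have "cmod (\<tau> x) = norm x" by simp
  with \<tau>(1) show ?thesis by (rule that)
qed

lemma norm_le_character:
  assumes "x \<in> B" "\<And>\<tau>. \<tau> \<in> characters B \<Longrightarrow> cmod (\<tau> x) \<le> r"
  shows "norm x \<le> r"
proof -
  obtain \<tau> where "\<tau> \<in> characters B" "cmod (\<tau> x) = norm x" by (rule character_attains_norm[OF assms(1)])
  with assms(2)[of \<tau>] show ?thesis by simp
qed

lemma character_separates:
  assumes "x \<in> B" "y \<in> B" "\<And>\<tau>. \<tau> \<in> characters B \<Longrightarrow> \<tau> x = \<tau> y"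
  shows "x = y"
  using norm_le_character[of "x - y" 0] assms by (simp add: mem characterD)

lemma sa_iff_character:
  assumes "x \<in> B" "\<And>\<tau>. \<tau> \<in> characters B \<Longrightarrow> \<tau> x \<in> \<real>"
  shows "x \<in> sa"
proof -
  have "star x = x"
    using assms by (intro character_separates) (auto simp: mem character_star Reals_cnj_iff)
  then show ?thesis using assms by (simp add: sa_def self_adjoint_def)
qed

text \<open>The element is half the sum of a and its absolute value, the latter being the root of a
  a. No continuous functional calculus beyond this root is used later.\<close>

lemma positive_part:
  assumes a: "a \<in> sa"
  obtains p where "p \<in> sa" "\<And>\<tau>. \<tau> \<in> characters B \<Longrightarrow> \<tau> p = of_real (max 0 (Re (\<tau> a)))"
proof -
  \<comment> \<open>With r at least the norm of a a, the element t lies in the unit ball and a a = r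
    (1 - t); the summand 1 allows division by r when a = 0.\<close>
  define r where "r = (norm a)\<^sup>2 + 1"
  have r: "r > 0" by (simp add: r_def add_nonneg_pos)
  define t where "t = 1 - (1/r) *\<^sub>R (a * a)"
  have na: "norm (a * a) = (norm a)\<^sup>2" using a by (simp add: norm_self_adjoint_square saD)
  have t: "t \<in> sa" unfolding t_def by (intro sa_intros a)
  have "(r *\<^sub>R 1 - a * a) = (norm (a * a) *\<^sub>R 1 - a * a) + 1 *\<^sub>R 1"
    by (simp add: r_def na algebra_simps)
  then have "norm (r *\<^sub>R 1 - a * a) \<le> norm (norm (a * a) *\<^sub>R 1 - a * a) + norm (1 *\<^sub>R (1 :: 'a))"
    by (simp only: norm_triangle_ineq)
  also have "\<dots> \<le> norm (a * a) + 1"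
    using norm_sub_sq_le[OF sqI[OF a]] by simp
  finally have "norm (r *\<^sub>R 1 - a * a) \<le> norm (a * a) + 1" .
  then have "norm (r *\<^sub>R 1 - a * a) \<le> r" by (simp add: r_def na)
  moreover have "t = (1/r) *\<^sub>R (r *\<^sub>R 1 - a * a)"
    using r by (simp add: t_def scaleR_diff_right)
  ultimately have "norm t \<le> 1" using r by simp
  then obtain s where s: "s \<in> B" "self_adjoint s" "s * s = 1 - t" "norm (1 - s) \<le> 1"
    using sqrt_one_minus[OF sub] t saD by metis
  then have ssa: "s \<in> sa" by (simp add: sa_def)
  define p where "p = (1/2) *\<^sub>R (sqrt r *\<^sub>R s + a)"
  have "p \<in> sa" unfolding p_def by (intro sa_intros a ssa)
  moreover have "\<tau> p = of_real (max 0 (Re (\<tau> a)))" if \<tau>: "\<tau> \<in> characters B" for \<tau>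
  proof -
    obtain \<alpha> where \<alpha>: "\<tau> a = of_real \<alpha>" using character_sa_real[OF \<tau> a] by (auto elim: Reals_cases)
    obtain \<sigma> where \<sigma>: "\<tau> s = of_real \<sigma>" using character_sa_real[OF \<tau> ssa] by (auto elim: Reals_cases)
    have "cmod (\<tau> (1 - s)) \<le> 1"
      using character_le_norm[OF \<tau>, of "1 - s"] s by (simp add: mem)
    moreover have "\<tau> (1 - s) = of_real (1 - \<sigma>)"
      using s(1) by (simp add: characterD[OF \<tau>] mem \<sigma>)
    ultimately have "\<bar>1 - \<sigma>\<bar> \<le> 1"
      by (simp only: norm_of_real)
    then have pos: "\<sigma> \<ge> 0" by simp
    have "s * s = (1/r) *\<^sub>R (a * a)" using s by (simp add: t_def)
    then have "\<tau> s * \<tau> s = of_real (1/r) * (\<tau> a * \<tau> a)"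
      using characterD(3)[OF \<tau> s(1) s(1)] characterD(3)[OF \<tau> saD(1)[OF a] saD(1)[OF a]]
        characterD(8)[OF \<tau>, of "a * a" "1/r"] saD(1)[OF sa_mult[OF a a]] by simp
    then have "\<sigma> * \<sigma> = (1/r) * (\<alpha> * \<alpha>)"
      unfolding \<alpha> \<sigma> by (simp only: of_real_mult[symmetric] of_real_eq_iff)
    moreover have "(sqrt r * \<sigma>)\<^sup>2 = r * (\<sigma> * \<sigma>)"
      using r by (simp add: power_mult_distrib power2_eq_square[of \<sigma>])
    ultimately have "(sqrt r * \<sigma>)\<^sup>2 = \<alpha>\<^sup>2" using r by (simp add: power2_eq_square[of \<alpha>])
    then have "\<bar>sqrt r * \<sigma>\<bar> = \<bar>\<alpha>\<bar>" by (simp only: power2_eq_iff abs_eq_iff)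
    then have "sqrt r * \<sigma> = \<bar>\<alpha>\<bar>" using pos r by simp
    then have "(1/2) * (sqrt r * \<sigma> + \<alpha>) = max 0 \<alpha>" by (simp add: max_def)
    moreover have "\<tau> p = of_real ((1/2) * (sqrt r * \<sigma> + \<alpha>))"
      using s a by (simp add: p_def characterD[OF \<tau>] mem saD \<alpha> \<sigma>)
    ultimately show ?thesis by (simp only: \<alpha> Re_complex_of_real)
  qed
  ultimately show thesis by (rule that)
qed

end

section \<open>States\<close>

lemma stateD:
  assumes "state \<rho>"
  shows "\<rho> (x + y) = \<rho> x + \<rho> y" "\<rho> (scaleC c x) = c * \<rho> x" "\<rho> 0 = 0" "\<rho> (- x) = - \<rho> x"
    "\<rho> (x - y) = \<rho> x - \<rho> y" "\<rho> (r *\<^sub>R x) = of_real r * \<rho> x" "\<rho> 1 = 1"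
    "\<rho> (star x * x) \<in> \<real>\<^sub>\<ge>\<^sub>0"
proof -
  interpret Vector_Spaces.linear scaleC "(*)" \<rho>
    using assms by (simp add: state_def)
  show "\<rho> (x + y) = \<rho> x + \<rho> y" "\<rho> (scaleC c x) = c * \<rho> x" "\<rho> 0 = 0" "\<rho> (- x) = - \<rho> x"
    "\<rho> (x - y) = \<rho> x - \<rho> y" "\<rho> 1 = 1" "\<rho> (star x * x) \<in> \<real>\<^sub>\<ge>\<^sub>0"
    using assms by (simp_all add: add scale zero neg diff state_def)
  show "\<rho> (r *\<^sub>R x) = of_real r * \<rho> x"
    by (simp only: scaleC_of_real[symmetric] scale)
qed

lemma state_form:
  assumes "state \<rho>"
  shows "\<rho> (star (x + scaleC c y) * (x + scaleC c y))
    = \<rho> (star x * x) + c * \<rho> (star x * y) + cnj c * \<rho> (star y * x) + cnj c * c * \<rho> (star y * y)"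
proof -
  have "star (x + scaleC c y) * (x + scaleC c y)
      = star x * x + scaleC c (star x * y) + scaleC (cnj c) (star y * x) + scaleC (cnj c * c) (star y * y)"
    by (simp add: star_add star_scaleC distrib_left distrib_right mult_scaleC_left mult_scaleC_right
        scaleC_scaleC scaleC_add_right ac_simps)
  then show ?thesis by (simp only: stateD[OF assms])
qed

text \<open>Positivity at x + 1 and at x + i 1 gives two real equations for the values at x and at
  its adjoint.\<close>

lemma state_hermitian:
  assumes \<rho>: "state \<rho>"
  shows "\<rho> (star x) = cnj (\<rho> x)"
proof -
  have im0: "Im z = 0" if "z \<in> \<real>\<^sub>\<ge>\<^sub>0" for z using that by (auto simp: complex_nonneg_Reals_iff)
  note pos = stateD(8)[OF \<rho>, THEN im0]
  have "Im (\<rho> (star x * 1) + \<rho> (star 1 * x)) = 0"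
    using pos[of "x + scaleC 1 1"] pos[of x] pos[of 1] unfolding state_form[OF \<rho>]
    by (simp add: stateD[OF \<rho>])
  moreover have "Im (\<i> * \<rho> (star x * 1) - \<i> * \<rho> (star 1 * x)) = 0"
    using pos[of "x + scaleC \<i> 1"] pos[of x] pos[of 1] unfolding state_form[OF \<rho>]
    by (simp add: stateD[OF \<rho>])
  ultimately show ?thesis by (simp add: complex_eq_iff)
qed

lemma state_cauchy_schwarz_0:
  assumes \<rho>: "state \<rho>" and 0: "\<rho> (star y * y) = 0"
  shows "\<rho> (star y * x) = 0"
proof (rule ccontr)
  define w where "w = \<rho> (star y * x)"
  assume "\<rho> (star y * x) \<noteq> 0"
  then have w: "cmod w > 0" by (simp add: w_def)
  have xy: "\<rho> (star x * y) = cnj w"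
    using state_hermitian[OF \<rho>, of "star y * x"] by (simp add: star_mult star_star w_def)
  \<comment> \<open>Chosen so that the real part of the value at the perturbed positive element is
    exactly -1.\<close>
  define t where "t = (Re (\<rho> (star x * x)) + 1) / (2 * (cmod w)\<^sup>2)"
  have "\<rho> (star (x + scaleC (- of_real t * w) y) * (x + scaleC (- of_real t * w) y))
      = \<rho> (star x * x) - of_real t * (w * cnj w) - of_real t * (cnj w * w)"
    unfolding state_form[OF \<rho>] 0 xy by (simp add: w_def[symmetric] algebra_simps)
  also have "w * cnj w = of_real ((cmod w)\<^sup>2)" using complex_norm_square[of w] by simp
  also have "cnj w * w = of_real ((cmod w)\<^sup>2)" using complex_norm_square[of w] by (simp add: mult.commute)
  finally have "Re (\<rho> (star x * x)) - t * (cmod w)\<^sup>2 - t * (cmod w)\<^sup>2 \<ge> 0"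
    using stateD(8)[OF \<rho>, of "x + scaleC (- of_real t * w) y"] by (simp add: complex_nonneg_Reals_iff)
  moreover have "t * (cmod w)\<^sup>2 = (Re (\<rho> (star x * x)) + 1) / 2"
    using w by (simp add: t_def)
  ultimately show False by simp
qed

lemma UNIV_subalgebra: "unital_cstar_subalgebra UNIV"
  by (simp add: unital_cstar_subalgebra_def complex_vector.subspace_UNIV)

text \<open>The element 1 - h has a self-adjoint square root. The root series works in the whole,
  possibly noncommutative, algebra because it involves powers of h only.\<close>

lemma state_self_adjoint_le:
  assumes \<rho>: "state \<rho>" and h: "self_adjoint h" "norm h \<le> 1"
  shows "Re (\<rho> h) \<le> 1"
proof -
  obtain s where s: "self_adjoint s" "s * s = 1 - h"
    using sqrt_one_minus[OF UNIV_subalgebra _ h] by auto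
  have "\<rho> (1 - h) \<in> \<real>\<^sub>\<ge>\<^sub>0"
    using stateD(8)[OF \<rho>, of s] s by (simp add: self_adjoint_def)
  then show ?thesis by (simp add: stateD[OF \<rho>] complex_nonneg_Reals_iff)
qed

lemma state_le_norm:
  assumes \<rho>: "state \<rho>"
  shows "cmod (\<rho> x) \<le> norm x"
proof (cases "\<rho> x = 0 \<or> x = 0")
  case False
  \<comment> \<open>This phase makes the value at u x nonnegative, so that it equals the value at
    the self-adjoint real part of u x.\<close>
  define u where "u = cnj (sgn (\<rho> x))"
  have u: "u * \<rho> x = of_real (cmod (\<rho> x))" "cmod u = 1"
    using False by (auto simp: u_def sgn_eq complex_norm_square[symmetric] norm_divide field_simps power2_eq_square)
  define h where "h = (1 / norm x) *\<^sub>R re_part (scaleC u x)"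
  have "norm (re_part (scaleC u x)) \<le> norm x"
    using norm_triangle_ineq[of "scaleC u x" "star (scaleC u x)"]
    by (simp add: re_part_def norm_scaleC u)
  then have "norm h \<le> 1" using False by (simp add: h_def)
  moreover have "self_adjoint h" by (simp add: h_def self_adjoint_scaleR self_adjoint_re_part)
  ultimately have le: "Re (\<rho> h) \<le> 1" by (intro state_self_adjoint_le \<rho>)
  have "\<rho> (re_part (scaleC u x)) = of_real (cmod (\<rho> x))"
    by (simp add: re_part_def stateD[OF \<rho>] state_hermitian[OF \<rho>] u)
  then have "\<rho> h = of_real (cmod (\<rho> x) / norm x)"
    by (simp add: h_def stateD[OF \<rho>])
  then have "cmod (\<rho> x) / norm x \<le> 1" using le by simp
  then show ?thesis using False by (simp add: divide_simps)
qed (auto simp: stateD[OF \<rho>])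

lemma state_continuous:
  assumes \<rho>: "state \<rho>"
  shows "continuous_on UNIV \<rho>"
proof (rule continuous_on_iff[THEN iffD2], intro ballI allI impI)
  fix x and e :: real assume "e > 0"
  have "dist (\<rho> y) (\<rho> x) \<le> dist y x" for y
    using state_le_norm[OF \<rho>, of "y - x"] by (simp add: dist_norm stateD[OF \<rho>])
  with \<open>e > 0\<close> show "\<exists>d>0. \<forall>x'\<in>UNIV. dist x' x < d \<longrightarrow> dist (\<rho> x') (\<rho> x) < e"
    by (meson order_le_less_trans)
qed

section \<open>Extensions of characters to normalizers\<close>

context abelian
begin

lemma Mod_state: "\<rho> \<in> Mod B \<Longrightarrow> state \<rho>"
  and Mod_character: "\<rho> \<in> Mod B \<Longrightarrow> restrict \<rho> B \<in> characters B"
  by (simp_all add: Mod_def)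

text \<open>By Cauchy-Schwarz, \<open>B\<close> lies in the multiplicative domain of \<open>\<rho>\<close>.\<close>

lemma Mod_mult_right:
  assumes \<rho>: "\<rho> \<in> Mod B" and d: "d \<in> B"
  shows "\<rho> (d * x) = \<rho> d * \<rho> x"
proof -
  note st = Mod_state[OF \<rho>] and ch = Mod_character[OF \<rho>]
  define y where "y = star d - scaleC (cnj (\<rho> d)) 1"
  have sy: "star y = d - scaleC (\<rho> d) 1"
    by (simp add: y_def star_diff star_star star_scaleC)
  have yB: "y \<in> B" "star y \<in> B" using d by (simp_all add: y_def mem sy)
  have "\<rho> (star y * y) = \<rho> (star y) * \<rho> y"
    using characterD(3)[OF ch yB(2,1)] yB mem(3)[OF yB(2,1)] by simp
  moreover have "\<rho> (star y) = 0" by (simp add: sy stateD[OF st])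
  ultimately have "\<rho> (star y * y) = 0" by simp
  then have "\<rho> (star y * x) = 0" by (rule state_cauchy_schwarz_0[OF st])
  then show ?thesis
    by (simp add: sy left_diff_distrib mult_scaleC_left stateD[OF st])
qed

lemma Mod_mult_left:
  assumes \<rho>: "\<rho> \<in> Mod B" and d: "d \<in> B"
  shows "\<rho> (x * d) = \<rho> x * \<rho> d"
proof -
  have "\<rho> (star (x * d)) = \<rho> (star d) * \<rho> (star x)"
    unfolding star_mult using d by (intro Mod_mult_right \<rho> mem)
  then have "cnj (\<rho> (x * d)) = cnj (\<rho> x * \<rho> d)"
    by (simp add: state_hermitian[OF Mod_state[OF \<rho>]] mult.commute)
  then show ?thesis by (simp only: complex_cnj_cancel_iff)
qed

text \<open>
  Where \<open>\<tau> (v* v) \<noteq> 0\<close>, the normalizer \<open>v\<close> induces a partial homeomorphism of the character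
  space; \<open>moved\<close> says that it does not fix \<open>\<tau>\<close>.
\<close>

definition moved :: "'a \<Rightarrow> ('a \<Rightarrow> complex) \<Rightarrow> bool" where
  "moved v \<tau> \<longleftrightarrow> (\<exists>e\<in>B. \<tau> (star v * e * v) \<noteq> \<tau> (star v * v) * \<tau> e)"

definition locally_in :: "'a \<Rightarrow> ('a \<Rightarrow> complex) \<Rightarrow> bool" where
  "locally_in v \<tau> \<longleftrightarrow> (\<exists>d\<in>B. \<tau> d \<noteq> 0 \<and> v * d \<in> B)"

lemma normalizerD:
  assumes "v \<in> normalizers B"
  shows "d \<in> B \<Longrightarrow> star v * d * v \<in> B" "d \<in> B \<Longrightarrow> v * d * star v \<in> B" "star v * v \<in> B" "v * star v \<in> B"
proof -
  have "star v * 1 * v \<in> B" "v * 1 * star v \<in> B"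
    using assms mem(8) unfolding normalizers_def by blast+
  then show "star v * v \<in> B" "v * star v \<in> B" by simp_all
qed (use assms in \<open>auto simp: normalizers_def\<close>)

text \<open>Since \<open>v * star v\<close> commutes with e, the product
  \<open>v * (star v * e * v)\<close> equals \<open>e * v * (star v * v)\<close>. As B is in the
  multiplicative domain, \<rho> turns this into \<rho> v times a factor that moving makes
  nonzero.\<close>

lemma Mod_moved:
  assumes \<rho>: "\<rho> \<in> Mod B" and v: "v \<in> normalizers B" and m: "moved v (restrict \<rho> B)"
  shows "\<rho> v = 0"
proof -
  from m obtain e where e: "e \<in> B" "\<rho> (star v * e * v) \<noteq> \<rho> (star v * v) * \<rho> e"
    unfolding moved_def using normalizerD[OF v] by auto
  have "v * (star v * e * v) = (v * star v) * e * v" by (simp add: mult.assoc)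
  also have "\<dots> = e * (v * star v) * v"
    using comm[OF normalizerD(4)[OF v] e(1)] by simp
  also have "\<dots> = e * (v * (star v * v))" by (simp add: mult.assoc)
  finally have "\<rho> (v * (star v * e * v)) = \<rho> (e * (v * (star v * v)))" by simp
  then have "\<rho> v * \<rho> (star v * e * v) = \<rho> e * (\<rho> v * \<rho> (star v * v))"
    using e(1) normalizerD[OF v] by (simp only: Mod_mult_left[OF \<rho>] Mod_mult_right[OF \<rho>])
  then have "\<rho> v * (\<rho> (star v * e * v) - \<rho> (star v * v) * \<rho> e) = 0"
    by (simp add: algebra_simps)
  with e(2) show ?thesis by simp
qed

lemma Mod_agree:
  assumes \<rho>: "\<rho> \<in> Mod B" "\<sigma> \<in> Mod B" "restrict \<rho> B = restrict \<sigma> B" and v: "v \<in> normalizers B"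
    and good: "moved v (restrict \<rho> B) \<or> locally_in v (restrict \<rho> B)"
  shows "\<rho> v = \<sigma> v"
  using good
proof
  assume "moved v (restrict \<rho> B)"
  then show ?thesis using Mod_moved[OF \<rho>(1) v] Mod_moved[OF \<rho>(2) v] \<rho>(3) by simp
next
  assume "locally_in v (restrict \<rho> B)"
  then obtain d where d: "d \<in> B" "\<rho> d \<noteq> 0" "v * d \<in> B" by (auto simp: locally_in_def)
  have eq: "\<rho> x = \<sigma> x" if "x \<in> B" for x
    using fun_cong[OF \<rho>(3), of x] that by simp
  have "\<rho> v * \<rho> d = \<sigma> v * \<sigma> d"
    using eq[OF d(3)] by (simp only: Mod_mult_left[OF \<rho>(1) d(1)] Mod_mult_left[OF \<rho>(2) d(1)])
  with eq[OF d(1)] d(2) show ?thesis by simp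
qed

text \<open>The commutator z is not known to lie in B, but \<open>star z * z\<close> does, so
  characters can test whether it vanishes. Each of them kills it, either through the factor d or
  because v does not move it.\<close>

lemma commutes_if_not_moved:
  assumes v: "v \<in> normalizers B" and d: "d \<in> B"
    and nm: "\<And>\<tau>. \<tau> \<in> characters B \<Longrightarrow> \<tau> d \<noteq> 0 \<Longrightarrow> \<not> moved v \<tau>" and e: "e \<in> B"
  shows "v * d * e = e * (v * d)"
proof -
  define z where "z = v * d * e - e * (v * d)"
  have sz: "star z = star e * (star d * star v) - star d * star v * star e"
    by (simp add: z_def star_diff star_mult)
  \<comment> \<open>The expansion is grouped so that v occurs only in blocks from
    \<open>star v\<close> to v around an element of B; these lie in B because v normalizes
    it.\<close>
  define w where "w = star e * star d * (star v * v) * d * e - star e * star d * (star v * e * v) * d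
      - star d * (star v * star e * v) * d * e + star d * (star v * (star e * e) * v) * d"
  have "star z * z = (star e * (star d * star v) - star d * star v * star e) * z"
    by (simp only: sz)
  also have "\<dots> = w"
    unfolding w_def z_def by (simp add: algebra_simps)
  finally have zz: "star z * z = w" .
  have B: "star e \<in> B" "star d \<in> B" "star e * e \<in> B" using d e by (simp_all add: mem)
  note N = normalizerD(3)[OF v] normalizerD(1)[OF v e] normalizerD(1)[OF v B(1)] normalizerD(1)[OF v B(3)]
  have wB: "w \<in> B" unfolding w_def by (intro mem B N d e)
  have "w = 0"
  proof (rule character_separates[OF wB mem(9)])
    fix \<tau> assume \<tau>: "\<tau> \<in> characters B"
    note T = characterD[OF \<tau>]
    have "\<tau> w = \<tau> (star e) * \<tau> (star d) * \<tau> (star v * v) * \<tau> d * \<tau> e - \<tau> (star e) * \<tau> (star d) * \<tau> (star v * e * v) * \<tau> d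
        - \<tau> (star d) * \<tau> (star v * star e * v) * \<tau> d * \<tau> e + \<tau> (star d) * \<tau> (star v * (star e * e) * v) * \<tau> d"
      unfolding w_def by (simp only: T B N d e mem(1,2,3))
    also have "\<dots> = 0"
    proof (cases "\<tau> d = 0")
      case False
      then have "\<tau> (star v * e' * v) = \<tau> (star v * v) * \<tau> e'" if "e' \<in> B" for e'
        using nm[OF \<tau>] that unfolding moved_def by blast
      from this[OF e] this[OF B(1)] this[OF B(3)] show ?thesis
        using T(3)[OF B(1) e] by (simp add: algebra_simps)
    qed simp
    finally show "\<tau> w = \<tau> 0" by (simp add: T)
  qed
  then have "norm z = 0" using cstar_identity[of z] zz by simp
  then show ?thesis by (simp add: z_def)
qed

end

section \<open>Maximal abelian subalgebras\<close>

definition commutant :: "'a::times set \<Rightarrow> 'a set" where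
  "commutant S = {x. \<forall>y\<in>S. x * y = y * x}"

lemma commutant_subalgebra:
  assumes "\<And>x. x \<in> S \<Longrightarrow> star x \<in> S"
  shows "unital_cstar_subalgebra (commutant S)"
  unfolding unital_cstar_subalgebra_def
proof (intro conjI ballI)
  show "complex_vector.subspace (commutant S)"
    by (rule complex_vector.subspaceI)
      (auto simp: commutant_def distrib_left distrib_right mult_scaleC_left mult_scaleC_right)
  show "1 \<in> commutant S" by (simp add: commutant_def)
  fix x assume x: "x \<in> commutant S"
  show "x * y \<in> commutant S" if "y \<in> commutant S" for y
    unfolding commutant_def
  proof (intro CollectI ballI)
    fix z assume "z \<in> S"
    then have "x * z = z * x" "y * z = z * y" using x that by (auto simp: commutant_def)
    then show "x * y * z = z * (x * y)" by (metis mult.assoc)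
  qed
  show "star x \<in> commutant S"
    unfolding commutant_def
  proof (intro CollectI ballI)
    fix z assume "z \<in> S"
    then have "x * star z = star z * x" using x assms by (simp add: commutant_def)
    then have "star (x * star z) = star (star z * x)" by simp
    then show "star x * z = z * star x" by (simp add: star_mult star_star)
  qed
next
  have "commutant S = (\<Inter>y\<in>S. {x. x * y = y * x})" by (auto simp: commutant_def)
  moreover have "closed {x. x * y = y * x}" for y :: 'a
    by (intro closed_Collect_eq continuous_intros)
  ultimately show "closed (commutant S)" by auto
qed

lemma commutant_antimono: "S \<subseteq> T \<Longrightarrow> commutant T \<subseteq> commutant S"
  by (auto simp: commutant_def)

text \<open>The double commutant serves as an abelian C*-algebra containing S, in place of the one
  generated by S.\<close>

lemma double_commutant_inclusion:
  assumes "commuting S" "\<And>x. x \<in> S \<Longrightarrow> star x \<in> S"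
  shows "inclusion (commutant (commutant S))" "S \<subseteq> commutant (commutant S)"
proof -
  have "S \<subseteq> commutant S" using assms(1) by (auto simp: commuting_def commutant_def)
  then have "commutant (commutant S) \<subseteq> commutant S" by (rule commutant_antimono)
  then have "commuting (commutant (commutant S))"
    unfolding commuting_def commutant_def[of "commutant S"] by blast
  moreover have "unital_cstar_subalgebra (commutant (commutant S))"
    using unital_cstar_subalgebraD(7)[OF commutant_subalgebra[OF assms(2)]] by (intro commutant_subalgebra)
  ultimately show "inclusion (commutant (commutant S))" by (simp add: inclusion_def)
  show "S \<subseteq> commutant (commutant S)"
    unfolding commutant_def by auto
qed

lemma masa_commutant:
  assumes masa: "masa_inclusion D" and x: "x \<in> commutant D"
  shows "x \<in> D"
proof -
  have D: "unital_cstar_subalgebra D" "commuting D"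
    and max: "\<And>B. inclusion B \<Longrightarrow> D \<subseteq> B \<Longrightarrow> B = D"
    using masa by (auto simp: masa_inclusion_def inclusion_def)
  note D' = unital_cstar_subalgebraD[OF D(1)]
  \<comment> \<open>Adjoining a single self-adjoint h keeps D commuting and closed under
    \<open>star\<close>; a general x would bring in its adjoint, which might not commute with
    it.\<close>
  have sa: "h \<in> D" if h: "h \<in> commutant D" "self_adjoint h" for h
  proof -
    have c: "commuting (insert h D)"
      using h D(2) by (auto simp: commuting_def commutant_def)
    have s: "star y \<in> insert h D" if "y \<in> insert h D" for y
      using that h D'(7) by (auto simp: self_adjoint_def)
    note double_commutant_inclusion[OF c s]
    with max[of "commutant (commutant (insert h D))"] show ?thesis by (metis insert_subset)
  qed
  note C = unital_cstar_subalgebraD[OF commutant_subalgebra[OF D'(7)]]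
  have "re_part x \<in> commutant D"
    unfolding re_part_def by (intro C x)
  moreover have "im_part x \<in> commutant D"
    unfolding im_part_def by (intro C x)
  ultimately have "re_part x \<in> D" "im_part x \<in> D"
    by (auto intro: sa self_adjoint_re_part self_adjoint_im_part)
  then have "re_part x + scaleC \<i> (im_part x) \<in> D" by (intro D')
  then show ?thesis by (simp flip: re_im_decomp)
qed

lemma masa_moved_or_locally_in:
  assumes masa: "masa_inclusion D" and v: "v \<in> normalizers D" and d: "d \<in> D"
    and nm: "\<And>\<tau>. \<tau> \<in> characters D \<Longrightarrow> \<tau> d \<noteq> 0 \<Longrightarrow> \<not> abelian.moved D v \<tau>"
  shows "v * d \<in> D"
proof -
  interpret abelian D using masa by unfold_locales (simp add: masa_inclusion_def)
  show ?thesis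
    using commutes_if_not_moved[OF v d nm] by (intro masa_commutant[OF masa]) (simp add: commutant_def)
qed

section \<open>Positive matrices over abelian algebras\<close>

text \<open>For a Hermitian form the bound on the diagonal controls the operator norm. With w = H v,
  polarizing b at w and v gives 4 N w, bounded by N (w + v) + N (w - v), which the parallelogram law
  evaluates as 2 N w + 2 N v.\<close>

lemma hermitian_contraction:
  fixes H :: "nat \<Rightarrow> nat \<Rightarrow> complex" and v :: "nat \<Rightarrow> complex"
  assumes herm: "\<And>i j. i < n \<Longrightarrow> j < n \<Longrightarrow> cnj (H i j) = H j i"
    and bnd: "\<And>z. \<bar>Re (\<Sum>i<n. \<Sum>j<n. cnj (z i) * H i j * z j)\<bar> \<le> (\<Sum>i<n. (cmod (z i))\<^sup>2)"
  shows "(\<Sum>i<n. (cmod (\<Sum>j<n. H i j * v j))\<^sup>2) \<le> (\<Sum>i<n. (cmod (v i))\<^sup>2)"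
proof -
  define b where "b u v = (\<Sum>i<n. \<Sum>j<n. cnj (u i) * H i j * v j)" for u v :: "nat \<Rightarrow> complex"
  define N where "N v = (\<Sum>i<n. (cmod (v i))\<^sup>2)" for v :: "nat \<Rightarrow> complex"
  define w where "w i = (\<Sum>j<n. H i j * v j)" for i
  have plus: "b (\<lambda>i. w i + v i) (\<lambda>i. w i + v i) = b w w + b w v + b v w + b v v"
    unfolding b_def by (simp add: algebra_simps sum.distrib)
  have minus: "b (\<lambda>i. w i - v i) (\<lambda>i. w i - v i) = b w w - b w v - b v w + b v v"
    unfolding b_def by (simp add: algebra_simps sum.distrib sum_subtractf)
  have "b w v = (\<Sum>i<n. cnj (w i) * w i)"
    unfolding b_def w_def by (simp add: sum_distrib_left mult.assoc)
  also have "\<dots> = of_real (N w)"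
    unfolding N_def of_real_sum by (intro sum.cong refl) (simp add: complex_norm_square mult.commute del: of_real_power)
  finally have wv: "b w v = of_real (N w)" .
  have "cnj (b w v) = (\<Sum>i<n. \<Sum>j<n. cnj (v j) * H j i * w i)"
    unfolding b_def by (simp add: herm mult_ac)
  also have "\<dots> = b v w"
    unfolding b_def by (rule sum.swap)
  finally have vw: "b v w = of_real (N w)" by (simp add: wv)
  have B: "\<bar>Re (b z z)\<bar> \<le> N z" for z
    using bnd[of z] unfolding b_def N_def .
  have "4 * N w = Re (b (\<lambda>i. w i + v i) (\<lambda>i. w i + v i)) - Re (b (\<lambda>i. w i - v i) (\<lambda>i. w i - v i))"
    unfolding plus minus by (simp add: wv vw)
  also have "\<dots> \<le> N (\<lambda>i. w i + v i) + N (\<lambda>i. w i - v i)"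
    using B[of "\<lambda>i. w i + v i"] B[of "\<lambda>i. w i - v i"] by linarith
  also have "\<dots> = (\<Sum>i<n. (cmod (w i + v i))\<^sup>2 + (cmod (w i - v i))\<^sup>2)"
    unfolding N_def by (simp add: sum.distrib)
  also have "\<dots> = (\<Sum>i<n. 2 * (cmod (w i))\<^sup>2 + 2 * (cmod (v i))\<^sup>2)"
  proof (intro sum.cong refl)
    fix i
    show "(cmod (w i + v i))\<^sup>2 + (cmod (w i - v i))\<^sup>2 = 2 * (cmod (w i))\<^sup>2 + 2 * (cmod (v i))\<^sup>2"
      by (simp only: cmod_power2 plus_complex.sel minus_complex.sel) (simp add: power2_eq_square algebra_simps)
  qed
  also have "\<dots> = 2 * N w + 2 * N v"
    unfolding N_def by (simp add: sum.distrib sum_distrib_left)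
  finally have "N w \<le> N v" by simp
  then show ?thesis by (simp add: N_def w_def)
qed

text \<open>Column j of a power is obtained by applying H repeatedly to the unit vector j, so its
  norm never exceeds 1.\<close>

lemma hermitian_contraction_mpow:
  fixes H :: "nat \<Rightarrow> nat \<Rightarrow> complex"
  assumes herm: "\<And>i j. i < n \<Longrightarrow> j < n \<Longrightarrow> cnj (H i j) = H j i"
    and bnd: "\<And>z. \<bar>Re (\<Sum>i<n. \<Sum>j<n. cnj (z i) * H i j * z j)\<bar> \<le> (\<Sum>i<n. (cmod (z i))\<^sup>2)"
    and ij: "i < n" "j < n"
  shows "cmod (mpow n H k i j) \<le> 1"
proof -
  have col: "(\<Sum>i<n. (cmod (mpow n H k i j))\<^sup>2) \<le> 1" for k
  proof (induction k)
    case 0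
    have "(\<Sum>i<n. (cmod (mpow n H 0 i j))\<^sup>2) = (\<Sum>i<n. if i = j then 1 else 0)"
      by (intro sum.cong) auto
    then show ?case using ij by simp
  next
    case (Suc k)
    have "(\<Sum>i<n. (cmod (mpow n H (Suc k) i j))\<^sup>2) \<le> (\<Sum>i<n. (cmod (mpow n H k i j))\<^sup>2)"
      unfolding mpow.simps by (rule hermitian_contraction[OF herm bnd])
    with Suc show ?case by linarith
  qed
  have "(cmod (mpow n H k i j))\<^sup>2 \<le> (\<Sum>i<n. (cmod (mpow n H k i j))\<^sup>2)"
    using ij by (intro member_le_sum) auto
  then have "(cmod (mpow n H k i j))\<^sup>2 \<le> 1\<^sup>2" using col[of k] by simp
  then show ?thesis by (rule power2_le_imp_le) simp
qed

text \<open>A crude bound, sufficient to choose a scaling constant uniform over all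
  characters.\<close>

lemma quadratic_form_bound:
  fixes c :: "nat \<Rightarrow> nat \<Rightarrow> complex" and z :: "nat \<Rightarrow> complex"
  shows "cmod (\<Sum>i<n. \<Sum>j<n. cnj (z i) * c i j * z j) \<le> (\<Sum>i<n. \<Sum>j<n. cmod (c i j)) * (\<Sum>i<n. (cmod (z i))\<^sup>2)"
proof -
  let ?N = "\<Sum>i<n. (cmod (z i))\<^sup>2"
  have zz: "cmod (z i) * cmod (z j) \<le> ?N" if "i < n" "j < n" for i j
  proof -
    have "(cmod (z i))\<^sup>2 \<le> ?N" "(cmod (z j))\<^sup>2 \<le> ?N"
      using that by (auto intro!: member_le_sum)
    moreover have "2 * (cmod (z i) * cmod (z j)) \<le> (cmod (z i))\<^sup>2 + (cmod (z j))\<^sup>2"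
      using sum_squares_bound[of "cmod (z i)" "cmod (z j)"] by simp
    ultimately show ?thesis by linarith
  qed
  have "cmod (\<Sum>i<n. \<Sum>j<n. cnj (z i) * c i j * z j) \<le> (\<Sum>i<n. \<Sum>j<n. cmod (cnj (z i) * c i j * z j))"
    by (intro order_trans[OF norm_sum] sum_mono norm_sum)
  also have "\<dots> \<le> (\<Sum>i<n. \<Sum>j<n. cmod (c i j) * ?N)"
  proof (intro sum_mono)
    fix i j assume "i \<in> {..<n}" "j \<in> {..<n}"
    then have "cmod (c i j) * (cmod (z i) * cmod (z j)) \<le> cmod (c i j) * ?N"
      by (intro mult_left_mono zz) auto
    then show "cmod (cnj (z i) * c i j * z j) \<le> cmod (c i j) * ?N"
      by (simp add: norm_mult mult_ac)
  qed
  also have "\<dots> = (\<Sum>i<n. \<Sum>j<n. cmod (c i j)) * ?N"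
    by (simp only: sum_distrib_right)
  finally show ?thesis .
qed

context abelian
begin

lemma character_mpow:
  assumes \<tau>: "\<tau> \<in> characters B" and T: "\<And>i j. i < n \<Longrightarrow> j < n \<Longrightarrow> T i j \<in> B" and "i < n" "j < n"
  shows "\<tau> (mpow n T k i j) = mpow n (\<lambda>i j. \<tau> (T i j)) k i j"
  using assms(3,4)
proof (induction k arbitrary: i j)
  case (Suc k)
  have mp: "mpow n T k i j \<in> B" if "i < n" "j < n" for i j
    by (rule mpow_mem[OF sub _ that]) (rule T)
  have "\<tau> (mpow n T (Suc k) i j) = (\<Sum>l<n. \<tau> (T i l * mpow n T k l j))"
    unfolding mpow.simps by (rule character_sum[OF \<tau>]) (use Suc.prems in \<open>auto intro!: mem T mp\<close>)
  also have "\<dots> = (\<Sum>l<n. \<tau> (T i l) * mpow n (\<lambda>i j. \<tau> (T i j)) k l j)"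
    by (intro sum.cong refl) (use Suc in \<open>simp add: characterD(3)[OF \<tau>] T mp\<close>)
  finally show ?case by simp
qed (simp add: characterD[OF \<tau>])

text \<open>After scaling, M = K (1 - T) with T a Hermitian contraction at every character, so the
  entries of all powers of T are bounded in norm and the series gives a Hermitian root with entries
  in B.\<close>

lemma positive_matrix_factorization:
  fixes n :: nat and M :: "nat \<Rightarrow> nat \<Rightarrow> 'a"
  assumes M: "\<And>i j. i < n \<Longrightarrow> j < n \<Longrightarrow> M i j \<in> B"
    and herm: "\<And>i j. i < n \<Longrightarrow> j < n \<Longrightarrow> star (M i j) = M j i"
    and pos: "\<And>\<tau> z. \<tau> \<in> characters B \<Longrightarrow> 0 \<le> Re (\<Sum>i<n. \<Sum>j<n. cnj (z i) * \<tau> (M i j) * z j)"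
  obtains S where "\<And>i j. i < n \<Longrightarrow> j < n \<Longrightarrow> S i j \<in> B"
    "\<And>i j. i < n \<Longrightarrow> j < n \<Longrightarrow> M i j = (\<Sum>k<n. star (S k i) * S k j)"
proof -
  \<comment> \<open>The sum of norms dominates the quadratic form of M at every character; the
    summand 1 keeps K positive when M vanishes.\<close>
  define K where "K = 1 + (\<Sum>i<n. \<Sum>j<n. norm (M i j))"
  have K: "K > 0" unfolding K_def by (intro add_pos_nonneg sum_nonneg) auto
  define T where "T i j = (if i = j then 1 else 0) - (1/K) *\<^sub>R M i j" for i j
  have TB: "T i j \<in> B" if "i < n" "j < n" for i j
    using M[OF that] by (simp add: T_def mem)
  have Ts: "star (T i j) = T j i" if "i < n" "j < n" for i j
    using herm[OF that] by (auto simp: T_def star_diff star_scaleR)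
  have tb: "cmod (mpow n (\<lambda>i j. \<tau> (T i j)) k i j) \<le> 1"
    if \<tau>: "\<tau> \<in> characters B" and ij: "i < n" "j < n" for \<tau> k i j
  proof (rule hermitian_contraction_mpow[OF _ _ ij])
    show "cnj (\<tau> (T i j)) = \<tau> (T j i)" if "i < n" "j < n" for i j
      using character_star[OF \<tau> TB[OF that]] Ts[OF that] by simp
    fix z :: "nat \<Rightarrow> complex"
    let ?N = "\<Sum>i<n. (cmod (z i))\<^sup>2"
    let ?q = "\<Sum>i<n. \<Sum>j<n. cnj (z i) * \<tau> (M i j) * z j"
    have "(\<Sum>i<n. \<Sum>j<n. cnj (z i) * \<tau> (T i j) * z j)
      = (\<Sum>i<n. \<Sum>j<n. (if i = j then cnj (z i) * z i else 0) - of_real (1/K) * (cnj (z i) * \<tau> (M i j) * z j))"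
    proof (intro sum.cong refl)
      fix i j assume "i \<in> {..<n}" "j \<in> {..<n}"
      then have te: "\<tau> (T i j) = (if i = j then 1 else 0) - of_real (1/K) * \<tau> (M i j)"
        using M unfolding T_def by (simp add: characterD[OF \<tau>] mem)
      show "cnj (z i) * \<tau> (T i j) * z j = (if i = j then cnj (z i) * z i else 0) - of_real (1/K) * (cnj (z i) * \<tau> (M i j) * z j)"
        unfolding te by (simp add: algebra_simps)
    qed
    also have "\<dots> = (\<Sum>i<n. cnj (z i) * z i) - of_real (1/K) * ?q"
      by (simp add: sum_subtractf sum_distrib_left)
    also have "(\<Sum>i<n. cnj (z i) * z i) = of_real ?N"
      unfolding of_real_sum by (intro sum.cong refl) (simp add: complex_norm_square mult.commute del: of_real_power)
    finally have "Re (\<Sum>i<n. \<Sum>j<n. cnj (z i) * \<tau> (T i j) * z j) = ?N - (1/K) * Re ?q"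
      by (simp del: of_real_sum)
    moreover have "(1/K) * Re ?q \<ge> 0" using pos[OF \<tau>, of z] K by simp
    moreover have "(1/K) * Re ?q \<le> ?N"
    proof -
      have "Re ?q \<le> cmod ?q" by (rule complex_Re_le_cmod)
      also have "\<dots> \<le> (\<Sum>i<n. \<Sum>j<n. cmod (\<tau> (M i j))) * ?N"
        by (rule quadratic_form_bound)
      also have "\<dots> \<le> K * ?N"
      proof (intro mult_right_mono sum_nonneg)
        have "(\<Sum>i<n. \<Sum>j<n. cmod (\<tau> (M i j))) \<le> (\<Sum>i<n. \<Sum>j<n. norm (M i j))"
          by (intro sum_mono character_le_norm \<tau> M) auto
        then show "(\<Sum>i<n. \<Sum>j<n. cmod (\<tau> (M i j))) \<le> K" by (simp add: K_def)
      qed auto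
      finally show ?thesis using K by (simp add: divide_simps mult.commute)
    qed
    moreover have "?N \<ge> 0" by (intro sum_nonneg) auto
    ultimately show "\<bar>Re (\<Sum>i<n. \<Sum>j<n. cnj (z i) * \<tau> (T i j) * z j)\<bar> \<le> ?N" by linarith
  qed
  have pb: "power_bounded_matrix n T"
  proof
    fix k i j assume ij: "i < n" "j < n"
    show "norm (mpow n T k i j) \<le> 1"
    proof (rule norm_le_character)
      show "mpow n T k i j \<in> B" by (rule mpow_mem[OF sub _ ij]) (rule TB)
      fix \<tau> assume \<tau>: "\<tau> \<in> characters B"
      have "\<tau> (mpow n T k i j) = mpow n (\<lambda>i j. \<tau> (T i j)) k i j"
        by (rule character_mpow[OF \<tau> _ ij]) (rule TB)
      then show "cmod (\<tau> (mpow n T k i j)) \<le> 1" using tb[OF \<tau> ij] by simp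
    qed
  qed
  interpret power_bounded_matrix n T by (rule pb)
  define S where "S i j = sqrt K *\<^sub>R msqrt n T i j" for i j
  have "msqrt n T i j \<in> B" if "i < n" "j < n" for i j
    by (rule msqrt_mem[OF sub pb _ that]) (rule TB)
  then have "S i j \<in> B" if "i < n" "j < n" for i j
    unfolding S_def using that by (intro mem) auto
  moreover have "M i j = (\<Sum>k<n. star (S k i) * S k j)" if ij: "i < n" "j < n" for i j
  proof -
    have "star (msqrt n T k i) = msqrt n T i k" if "k < n" for k
      by (rule msqrt_star[OF pb _ that ij(1)]) (rule Ts)
    then have "(\<Sum>k<n. star (S k i) * S k j) = (\<Sum>k<n. K *\<^sub>R (msqrt n T i k * msqrt n T k j))"
      using K by (intro sum.cong refl) (simp add: S_def star_scaleR)
    also have "\<dots> = K *\<^sub>R ((if i = j then 1 else 0) - T i j)"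
      using msqrt_square[OF ij] by (simp flip: scaleR_sum_right)
    also have "\<dots> = M i j" using K by (simp add: T_def)
    finally show ?thesis by simp
  qed
  ultimately show thesis by (rule that)
qed

end

section \<open>Bounded functions as a C*-algebra\<close>

text \<open>Functions on Y are extended by zero to the whole type: when Y consists of characters of
  \<open>'i\<close>, they become elements of \<open>'i universe\<close>, as the test algebras of
  \<open>essential_extension\<close> require.\<close>

definition bounded_on_zero_off :: "'x set \<Rightarrow> ('x \<Rightarrow> complex) set" where
  "bounded_on_zero_off Y = {f. (\<forall>y. y \<notin> Y \<longrightarrow> f y = 0) \<and> (\<exists>r. \<forall>y. cmod (f y) \<le> r)}"

definition bf_proj :: "'x set \<Rightarrow> ('x \<Rightarrow> complex) \<Rightarrow> 'x \<Rightarrow> complex" where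
  "bf_proj Y f = (if f \<in> bounded_on_zero_off Y then f else (\<lambda>_. 0))"

definition sup_norm :: "('x \<Rightarrow> complex) \<Rightarrow> real" where
  "sup_norm f = (SUP y. cmod (f y))"

text \<open>
  The completeness axiom of \<^locale>\<open>cstar\<close> refers to a distance function that has to be symmetric
  and nonnegative outside the carrier as well; hence \<open>bf_proj\<close> in the addition and the norm.
\<close>

definition bfun_algebra :: "'x set \<Rightarrow> ('x \<Rightarrow> complex) cstar_struct" where
  "bfun_algebra Y = \<lparr>carrier = bounded_on_zero_off Y, mult = (\<lambda>f g y. f y * g y),
     one = (\<lambda>y. if y \<in> Y then 1 else 0), zero = (\<lambda>_. 0),
     add = (\<lambda>f g y. bf_proj Y f y + bf_proj Y g y), smult = (\<lambda>c f y. c * f y),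
     adjoint_op = (\<lambda>f y. cnj (f y)), norm_op = (\<lambda>f. sup_norm (bf_proj Y f))\<rparr>"

lemma bfun_algebra_sel [simp]:
  "carrier (bfun_algebra Y) = bounded_on_zero_off Y"
  "f \<otimes>\<^bsub>bfun_algebra Y\<^esub> g = (\<lambda>y. f y * g y)"
  "\<one>\<^bsub>bfun_algebra Y\<^esub> = (\<lambda>y. if y \<in> Y then 1 else 0)"
  "\<zero>\<^bsub>bfun_algebra Y\<^esub> = (\<lambda>_. 0)"
  "f \<oplus>\<^bsub>bfun_algebra Y\<^esub> g = (\<lambda>y. bf_proj Y f y + bf_proj Y g y)"
  "c \<odot>\<^bsub>bfun_algebra Y\<^esub> f = (\<lambda>y. c * f y)"
  "adjoint_op (bfun_algebra Y) f = (\<lambda>y. cnj (f y))"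
  "norm_op (bfun_algebra Y) f = sup_norm (bf_proj Y f)"
  by (simp_all add: bfun_algebra_def)

lemma bounded_on_zero_offI: "(\<And>y. y \<notin> Y \<Longrightarrow> f y = 0) \<Longrightarrow> (\<And>y. cmod (f y) \<le> r) \<Longrightarrow> f \<in> bounded_on_zero_off Y"
  by (auto simp: bounded_on_zero_off_def)

lemma bounded_on_zero_offE:
  assumes "f \<in> bounded_on_zero_off Y"
  obtains r where "\<And>y. cmod (f y) \<le> r" "0 \<le> r" "\<And>y. y \<notin> Y \<Longrightarrow> f y = 0"
proof -
  from assms obtain r where r: "\<And>y. cmod (f y) \<le> r" and z: "\<And>y. y \<notin> Y \<Longrightarrow> f y = 0"
    by (auto simp: bounded_on_zero_off_def)
  have "0 \<le> r" using norm_ge_zero r by (rule order_trans)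
  with r z show thesis by (intro that)
qed

lemma bf_proj_id [simp]: "f \<in> bounded_on_zero_off Y \<Longrightarrow> bf_proj Y f = f"
  by (simp add: bf_proj_def)

lemma bf_zero [simp]: "(\<lambda>_. 0) \<in> bounded_on_zero_off Y"
  by (rule bounded_on_zero_offI[of _ _ 0]) auto

lemma bf_proj_mem [simp]: "bf_proj Y f \<in> bounded_on_zero_off Y"
  by (simp add: bf_proj_def)

lemma bf_one [simp]: "(\<lambda>y. if y \<in> Y then 1 else 0) \<in> bounded_on_zero_off Y"
  by (rule bounded_on_zero_offI[of _ _ 1]) auto

lemma bf_add [simp]:
  assumes "f \<in> bounded_on_zero_off Y" "g \<in> bounded_on_zero_off Y"
  shows "(\<lambda>y. f y + g y) \<in> bounded_on_zero_off Y"
proof -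
  obtain r where r: "\<And>y. cmod (f y) \<le> r" "0 \<le> r" "\<And>y. y \<notin> Y \<Longrightarrow> f y = 0"
    using bounded_on_zero_offE[OF assms(1)] by metis
  obtain s where s: "\<And>y. cmod (g y) \<le> s" "0 \<le> s" "\<And>y. y \<notin> Y \<Longrightarrow> g y = 0"
    using bounded_on_zero_offE[OF assms(2)] by metis
  show ?thesis
    by (rule bounded_on_zero_offI[of _ _ "r + s"]) (simp_all add: r s norm_triangle_mono)
qed

lemma bf_mult [simp]:
  assumes "f \<in> bounded_on_zero_off Y" "g \<in> bounded_on_zero_off Y"
  shows "(\<lambda>y. f y * g y) \<in> bounded_on_zero_off Y"
proof -
  obtain r where r: "\<And>y. cmod (f y) \<le> r" "0 \<le> r" "\<And>y. y \<notin> Y \<Longrightarrow> f y = 0"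
    using bounded_on_zero_offE[OF assms(1)] by metis
  obtain s where s: "\<And>y. cmod (g y) \<le> s" "0 \<le> s" "\<And>y. y \<notin> Y \<Longrightarrow> g y = 0"
    using bounded_on_zero_offE[OF assms(2)] by metis
  show ?thesis
    by (rule bounded_on_zero_offI[of _ _ "r * s"]) (simp_all add: r s norm_mult mult_mono)
qed

lemma bf_scale [simp]:
  assumes "f \<in> bounded_on_zero_off Y"
  shows "(\<lambda>y. c * f y) \<in> bounded_on_zero_off Y"
proof -
  obtain r where r: "\<And>y. cmod (f y) \<le> r" "0 \<le> r" "\<And>y. y \<notin> Y \<Longrightarrow> f y = 0"
    using bounded_on_zero_offE[OF assms(1)] by metis
  show ?thesis
    by (rule bounded_on_zero_offI[of _ _ "cmod c * r"]) (simp_all add: r norm_mult mult_left_mono)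
qed

lemma bf_uminus [simp]: "f \<in> bounded_on_zero_off Y \<Longrightarrow> (\<lambda>y. - f y) \<in> bounded_on_zero_off Y"
  using bf_scale[of f Y "-1"] by simp

lemma bf_diff [simp]:
  "f \<in> bounded_on_zero_off Y \<Longrightarrow> g \<in> bounded_on_zero_off Y \<Longrightarrow> (\<lambda>y. f y - g y) \<in> bounded_on_zero_off Y"
  using bf_add[of f Y "\<lambda>y. - g y"] by simp

lemma bf_cnj [simp]: "f \<in> bounded_on_zero_off Y \<Longrightarrow> (\<lambda>y. cnj (f y)) \<in> bounded_on_zero_off Y"
  by (auto simp: bounded_on_zero_off_def)

lemma sup_norm_least: "(\<And>y. cmod (f y) \<le> r) \<Longrightarrow> sup_norm f \<le> r"
  unfolding sup_norm_def by (rule cSUP_least) auto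

lemma le_sup_norm: "f \<in> bounded_on_zero_off Y \<Longrightarrow> cmod (f y) \<le> sup_norm f"
  unfolding sup_norm_def
  by (rule cSUP_upper) (auto simp: bounded_on_zero_off_def bdd_above_def)

lemma sup_norm_nonneg: "f \<in> bounded_on_zero_off Y \<Longrightarrow> 0 \<le> sup_norm f"
  using norm_ge_zero le_sup_norm by (rule order_trans)

lemma abelian_group_bfun: "abelian_group (bfun_algebra Y)"
proof (rule abelian_groupI)
  fix f assume f: "f \<in> carrier (bfun_algebra Y)"
  show "\<exists>g\<in>carrier (bfun_algebra Y). g \<oplus>\<^bsub>bfun_algebra Y\<^esub> f = \<zero>\<^bsub>bfun_algebra Y\<^esub>"
    by (rule bexI[of _ "\<lambda>y. - f y"]) (use f in auto)
qed (auto simp: algebra_simps)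

lemma ring_bfun: "Ring.ring (bfun_algebra Y)"
proof (rule ringI)
  show "monoid (bfun_algebra Y)"
    by (rule monoidI) (simp_all add: mult.assoc, auto simp: bounded_on_zero_off_def fun_eq_iff)
qed (auto intro: abelian_group_bfun simp: algebra_simps)

text \<open>Arguments outside the carrier are included, where the group laws say nothing, so the
  inverse is computed from its definition.\<close>

lemma bfun_minus: "f \<ominus>\<^bsub>bfun_algebra Y\<^esub> g = (\<lambda>y. bf_proj Y f y - bf_proj Y g y)"
proof -
  have "\<ominus>\<^bsub>bfun_algebra Y\<^esub> g = (\<lambda>y. - bf_proj Y g y)"
    unfolding a_inv_def m_inv_def
  proof (rule the_equality)
    show "(\<lambda>y. - bf_proj Y g y) \<in> carrier (add_monoid (bfun_algebra Y)) \<and>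
      g \<otimes>\<^bsub>add_monoid (bfun_algebra Y)\<^esub> (\<lambda>y. - bf_proj Y g y) = \<one>\<^bsub>add_monoid (bfun_algebra Y)\<^esub> \<and>
      (\<lambda>y. - bf_proj Y g y) \<otimes>\<^bsub>add_monoid (bfun_algebra Y)\<^esub> g = \<one>\<^bsub>add_monoid (bfun_algebra Y)\<^esub>"
      by simp
    show "h = (\<lambda>y. - bf_proj Y g y)"
      if "h \<in> carrier (add_monoid (bfun_algebra Y)) \<and>
        g \<otimes>\<^bsub>add_monoid (bfun_algebra Y)\<^esub> h = \<one>\<^bsub>add_monoid (bfun_algebra Y)\<^esub> \<and>
        h \<otimes>\<^bsub>add_monoid (bfun_algebra Y)\<^esub> g = \<one>\<^bsub>add_monoid (bfun_algebra Y)\<^esub>" for h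
      using that by (auto simp: fun_eq_iff eq_neg_iff_add_eq_0)
  qed
  then show ?thesis by (simp add: a_minus_def)
qed

lemma Metric_space_bfun:
  "Metric_space (carrier (bfun_algebra Y)) (\<lambda>f g. norm_op (bfun_algebra Y) (f \<ominus>\<^bsub>bfun_algebra Y\<^esub> g))"
proof -
  have *: "norm_op (bfun_algebra Y) (f \<ominus>\<^bsub>bfun_algebra Y\<^esub> g) = sup_norm (\<lambda>y. bf_proj Y f y - bf_proj Y g y)" for f g
    by (simp add: bfun_minus)
  show ?thesis
    unfolding *
  proof
    fix f g h :: "'a \<Rightarrow> complex"
    show "0 \<le> sup_norm (\<lambda>y. bf_proj Y f y - bf_proj Y g y)"
      by (rule sup_norm_nonneg[of _ Y]) simp
    show "sup_norm (\<lambda>y. bf_proj Y f y - bf_proj Y g y) = sup_norm (\<lambda>y. bf_proj Y g y - bf_proj Y f y)"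
      by (simp add: sup_norm_def norm_minus_commute)
    show "sup_norm (\<lambda>y. bf_proj Y f y - bf_proj Y g y) = 0 \<longleftrightarrow> f = g"
      if fg: "f \<in> carrier (bfun_algebra Y)" "g \<in> carrier (bfun_algebra Y)"
    proof
      assume 0: "sup_norm (\<lambda>y. bf_proj Y f y - bf_proj Y g y) = 0"
      show "f = g"
      proof
        fix y
        show "f y = g y" using le_sup_norm[of "\<lambda>y. f y - g y" Y y] 0 fg by simp
      qed
    qed (simp add: sup_norm_def)
    show "sup_norm (\<lambda>y. bf_proj Y f y - bf_proj Y h y)
      \<le> sup_norm (\<lambda>y. bf_proj Y f y - bf_proj Y g y) + sup_norm (\<lambda>y. bf_proj Y g y - bf_proj Y h y)"
    proof (rule sup_norm_least)
      fix y
      have "cmod (bf_proj Y f y - bf_proj Y h y) \<le> cmod (bf_proj Y f y - bf_proj Y g y) + cmod (bf_proj Y g y - bf_proj Y h y)"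
        using norm_triangle_ineq[of "bf_proj Y f y - bf_proj Y g y" "bf_proj Y g y - bf_proj Y h y"] by simp
      also have "\<dots> \<le> sup_norm (\<lambda>y. bf_proj Y f y - bf_proj Y g y) + sup_norm (\<lambda>y. bf_proj Y g y - bf_proj Y h y)"
        using le_sup_norm[of "\<lambda>y. bf_proj Y f y - bf_proj Y g y" Y y] le_sup_norm[of "\<lambda>y. bf_proj Y g y - bf_proj Y h y" Y y]
        by (intro add_mono) simp_all
      finally show "cmod (bf_proj Y f y - bf_proj Y h y)
        \<le> sup_norm (\<lambda>y. bf_proj Y f y - bf_proj Y g y) + sup_norm (\<lambda>y. bf_proj Y g y - bf_proj Y h y)" .
    qed
  qed
qed

lemma mcomplete_bfun:
  "Metric_space.mcomplete (carrier (bfun_algebra Y)) (\<lambda>f g. norm_op (bfun_algebra Y) (f \<ominus>\<^bsub>bfun_algebra Y\<^esub> g))"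
proof -
  let ?d = "\<lambda>f g. norm_op (bfun_algebra Y) (f \<ominus>\<^bsub>bfun_algebra Y\<^esub> g)"
  interpret Metric_space "carrier (bfun_algebra Y)" ?d
    by (rule Metric_space_bfun)
  have d: "?d f g = sup_norm (\<lambda>y. f y - g y)"
    if "f \<in> bounded_on_zero_off Y" "g \<in> bounded_on_zero_off Y" for f g
    using that by (simp add: bfun_minus)
  show ?thesis
    unfolding mcomplete_def
  proof (intro allI impI)
    fix s assume "MCauchy s"
    then have s: "\<And>k. s k \<in> bounded_on_zero_off Y"
      and c: "\<And>e. e > 0 \<Longrightarrow> \<exists>N. \<forall>m m'. N \<le> m \<longrightarrow> N \<le> m' \<longrightarrow> ?d (s m) (s m') < e"
      unfolding MCauchy_def by auto
    \<comment> \<open>The conjunct \<open>True\<close> is the index predicate of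
      \<open>uniformly_convergent_eq_cauchy\<close>, here imposing no restriction.\<close>
    have "\<forall>e>0. \<exists>N. \<forall>m m' y. N \<le> m \<and> N \<le> m' \<and> True \<longrightarrow> dist (s m y) (s m' y) < e"
    proof (intro allI impI)
      fix e :: real assume "e > 0"
      then obtain N where N: "\<And>m m'. N \<le> m \<Longrightarrow> N \<le> m' \<Longrightarrow> ?d (s m) (s m') < e"
        using c by blast
      have "dist (s m y) (s m' y) < e" if "N \<le> m" "N \<le> m'" for m m' y
      proof -
        have "cmod (s m y - s m' y) \<le> sup_norm (\<lambda>y. s m y - s m' y)"
          using le_sup_norm[of "\<lambda>y. s m y - s m' y" Y y] s by simp
        then show ?thesis using N[OF that] d[OF s s, of m m'] by (simp add: dist_norm)
      qed
      then show "\<exists>N. \<forall>m m' y. N \<le> m \<and> N \<le> m' \<and> True \<longrightarrow> dist (s m y) (s m' y) < e" by blast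
    qed
    then obtain l where l: "\<And>e. e > 0 \<Longrightarrow> \<exists>N. \<forall>m y. N \<le> m \<and> True \<longrightarrow> dist (s m y) (l y) < e"
      unfolding uniformly_convergent_eq_cauchy[symmetric] by blast
    have lB: "l \<in> bounded_on_zero_off Y"
    proof -
      obtain N where N: "\<And>y. dist (s N y) (l y) < 1"
        using l[of 1] by auto
      obtain r where r: "\<And>y. cmod (s N y) \<le> r" using s[of N] by (auto simp: bounded_on_zero_off_def)
      show ?thesis
      proof (rule bounded_on_zero_offI)
        show "cmod (l y) \<le> r + 1" for y
        proof -
          have "cmod (l y) \<le> cmod (s N y) + dist (s N y) (l y)"
            using norm_triangle_sub[of "l y" "s N y"] by (simp add: dist_norm norm_minus_commute)
          with N[of y] r[of y] show ?thesis by linarith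
        qed
        fix y assume "y \<notin> Y"
        then have sy: "s m y = 0" for m using s[of m] by (simp add: bounded_on_zero_off_def)
        have "dist 0 (l y) < e" if e: "e > 0" for e
          using l[OF e] sy by (metis order_refl)
        then show "l y = 0" by (metis dist_self less_irrefl zero_less_dist_iff)
      qed
    qed
    have "limitin mtopology s l sequentially"
      unfolding limit_metric_sequentially
    proof (intro conjI allI impI)
      show "l \<in> carrier (bfun_algebra Y)" using lB by simp
      fix e :: real assume "e > 0"
      then obtain N where N: "\<And>m y. N \<le> m \<Longrightarrow> dist (s m y) (l y) < e/2" using l[of "e/2"] by auto
      have "?d (s m) l < e" if "N \<le> m" for m
      proof -
        have "?d (s m) l \<le> e/2"
          unfolding d[OF s lB] using N[OF that] by (intro sup_norm_least) (simp add: dist_norm less_imp_le)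
        with \<open>e > 0\<close> show ?thesis by linarith
      qed
      then show "\<exists>N. \<forall>m\<ge>N. s m \<in> carrier (bfun_algebra Y) \<and> ?d (s m) l < e"
        using s by auto
    qed
    then show "\<exists>x. limitin mtopology s x sequentially" by (rule exI[of _ l])
  qed
qed

lemma cstar_bfun: "cstar (bfun_algebra Y)"
proof (intro cstar.intro ring_bfun cstar_axioms.intro mcomplete_bfun)
  show "Module.module complex_ring (bfun_algebra Y)"
    by (intro moduleI cring_complex_ring abelian_group_bfun) (auto simp: complex_ring_def algebra_simps)
  fix f g :: "'a \<Rightarrow> complex" and c
  assume f: "f \<in> carrier (bfun_algebra Y)"
  have fB: "f \<in> bounded_on_zero_off Y" using f by simp
  show "adjoint_op (bfun_algebra Y) f \<in> carrier (bfun_algebra Y)" using f by simp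
  show "adjoint_op (bfun_algebra Y) (adjoint_op (bfun_algebra Y) f) = f" by simp
  show "adjoint_op (bfun_algebra Y) (c \<odot>\<^bsub>bfun_algebra Y\<^esub> f) = cnj c \<odot>\<^bsub>bfun_algebra Y\<^esub> adjoint_op (bfun_algebra Y) f"
    by simp
  show "0 \<le> norm_op (bfun_algebra Y) f" using f by (simp add: sup_norm_nonneg[of _ Y])
  show "norm_op (bfun_algebra Y) f = 0 \<longleftrightarrow> f = \<zero>\<^bsub>bfun_algebra Y\<^esub>"
  proof
    assume "norm_op (bfun_algebra Y) f = 0"
    then have "cmod (f y) \<le> 0" for y using le_sup_norm[OF fB, of y] fB by simp
    then show "f = \<zero>\<^bsub>bfun_algebra Y\<^esub>" by auto
  qed (simp add: sup_norm_def)
  show "norm_op (bfun_algebra Y) (c \<odot>\<^bsub>bfun_algebra Y\<^esub> f) = cmod c * norm_op (bfun_algebra Y) f"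
  proof -
    have "sup_norm (\<lambda>y. c * f y) = cmod c * sup_norm f"
    proof (rule antisym)
      show "sup_norm (\<lambda>y. c * f y) \<le> cmod c * sup_norm f"
        by (rule sup_norm_least) (simp add: norm_mult mult_left_mono le_sup_norm[OF fB])
      show "cmod c * sup_norm f \<le> sup_norm (\<lambda>y. c * f y)"
      proof (cases "c = 0")
        case False
        have "sup_norm f \<le> sup_norm (\<lambda>y. c * f y) / cmod c"
        proof (rule sup_norm_least)
          fix y
          show "cmod (f y) \<le> sup_norm (\<lambda>y. c * f y) / cmod c"
            using le_sup_norm[OF bf_scale[OF fB, of c], of y] False by (simp add: norm_mult field_simps)
        qed
        with False show ?thesis by (simp add: field_simps)
      qed (simp add: sup_norm_def)
    qed
    then show ?thesis using fB by simp
  qed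
  show "norm_op (bfun_algebra Y) (adjoint_op (bfun_algebra Y) f \<otimes>\<^bsub>bfun_algebra Y\<^esub> f) = (norm_op (bfun_algebra Y) f)\<^sup>2"
  proof -
    let ?g = "\<lambda>y. cnj (f y) * f y"
    have gB: "?g \<in> bounded_on_zero_off Y" using fB by simp
    have sq: "cmod (?g y) = (cmod (f y))\<^sup>2" for y by (simp add: norm_mult power2_eq_square)
    have "sup_norm ?g = (sup_norm f)\<^sup>2"
    proof (rule antisym)
      show "sup_norm ?g \<le> (sup_norm f)\<^sup>2"
        by (rule sup_norm_least) (simp only: sq power_mono le_sup_norm[OF fB] norm_ge_zero)
      have "sup_norm f \<le> sqrt (sup_norm ?g)"
      proof (rule sup_norm_least)
        fix y
        show "cmod (f y) \<le> sqrt (sup_norm ?g)"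
          using le_sup_norm[OF gB, of y] unfolding sq by (rule real_le_rsqrt)
      qed
      then have "(sup_norm f)\<^sup>2 \<le> (sqrt (sup_norm ?g))\<^sup>2"
        by (intro power_mono sup_norm_nonneg[OF fB])
      then show "(sup_norm f)\<^sup>2 \<le> sup_norm ?g"
        using sup_norm_nonneg[OF gB] by simp
    qed
    then show ?thesis using fB gB by simp
  qed
  assume g: "g \<in> carrier (bfun_algebra Y)"
  have gB: "g \<in> bounded_on_zero_off Y" using g by simp
  show "(c \<odot>\<^bsub>bfun_algebra Y\<^esub> f) \<otimes>\<^bsub>bfun_algebra Y\<^esub> g = c \<odot>\<^bsub>bfun_algebra Y\<^esub> (f \<otimes>\<^bsub>bfun_algebra Y\<^esub> g)"
    "f \<otimes>\<^bsub>bfun_algebra Y\<^esub> (c \<odot>\<^bsub>bfun_algebra Y\<^esub> g) = c \<odot>\<^bsub>bfun_algebra Y\<^esub> (f \<otimes>\<^bsub>bfun_algebra Y\<^esub> g)"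
    "adjoint_op (bfun_algebra Y) (f \<otimes>\<^bsub>bfun_algebra Y\<^esub> g) =
      adjoint_op (bfun_algebra Y) g \<otimes>\<^bsub>bfun_algebra Y\<^esub> adjoint_op (bfun_algebra Y) f"
    by (simp_all add: mult_ac)
  show "adjoint_op (bfun_algebra Y) (f \<oplus>\<^bsub>bfun_algebra Y\<^esub> g) =
      adjoint_op (bfun_algebra Y) f \<oplus>\<^bsub>bfun_algebra Y\<^esub> adjoint_op (bfun_algebra Y) g"
    using fB gB by simp
  show "norm_op (bfun_algebra Y) (f \<oplus>\<^bsub>bfun_algebra Y\<^esub> g) \<le> norm_op (bfun_algebra Y) f + norm_op (bfun_algebra Y) g"
  proof -
    have "sup_norm (\<lambda>y. f y + g y) \<le> sup_norm f + sup_norm g"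
      by (rule sup_norm_least) (intro norm_triangle_mono le_sup_norm[OF fB] le_sup_norm[OF gB])
    then show ?thesis using fB gB by simp
  qed
  show "norm_op (bfun_algebra Y) (f \<otimes>\<^bsub>bfun_algebra Y\<^esub> g) \<le> norm_op (bfun_algebra Y) f * norm_op (bfun_algebra Y) g"
  proof -
    have "sup_norm (\<lambda>y. f y * g y) \<le> sup_norm f * sup_norm g"
      by (rule sup_norm_least)
        (simp add: norm_mult mult_mono le_sup_norm[OF fB] le_sup_norm[OF gB] sup_norm_nonneg[OF fB])
    then show ?thesis using fB gB by simp
  qed
qed

text \<open>Membership is carried along in the induction because \<open>bf_proj\<close> in the
  addition disappears only on members.\<close>

lemma finsum_bfun:
  fixes Y :: "'x set"
  assumes "\<And>i. i \<in> I \<Longrightarrow> f i \<in> bounded_on_zero_off Y" "finite I"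
  shows "finsum (bfun_algebra Y) f I = (\<lambda>y. \<Sum>i\<in>I. f i y) \<and> (\<lambda>y. \<Sum>i\<in>I. f i y) \<in> bounded_on_zero_off Y"
  using assms(2,1)
proof (induction I)
  interpret abelian_group "bfun_algebra Y" by (rule abelian_group_bfun)
  case empty
  then show ?case by simp
next
  interpret abelian_group "bfun_algebra Y" by (rule abelian_group_bfun)
  case (insert i I)
  have "finsum (bfun_algebra Y) f (insert i I) = f i \<oplus>\<^bsub>bfun_algebra Y\<^esub> finsum (bfun_algebra Y) f I"
    using insert by (intro finsum_insert) auto
  with insert show ?case by simp
qed

lemma finsum_cstar_of: "finite I \<Longrightarrow> finsum (cstar_of :: 'a::cstar_algebra cstar_struct) f I = sum f I"
proof (induction I rule: finite_induct)
  interpret Ring.ring "cstar_of :: 'a cstar_struct" by (rule ring_cstar_of)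
  case empty
  have "finsum cstar_of f {} = \<zero>\<^bsub>(cstar_of :: 'a cstar_struct)\<^esub>" by (rule finsum_empty)
  also have "\<dots> = 0" by (simp add: cstar_of_def)
  finally show ?case by simp
next
  interpret Ring.ring "cstar_of :: 'a cstar_struct" by (rule ring_cstar_of)
  case (insert i I)
  have "finsum cstar_of f (insert i I) = f i \<oplus>\<^bsub>cstar_of\<^esub> finsum (cstar_of :: 'a cstar_struct) f I"
    using insert.hyps by (intro finsum_insert) (auto simp: cstar_of_def)
  also have "\<dots> = f i + finsum (cstar_of :: 'a cstar_struct) f I" by (simp add: cstar_of_def)
  finally show ?case using insert by simp
qed

lemma positive_matrix_cstar_of:
  "positive_matrix (cstar_of :: 'a::cstar_algebra cstar_struct) n M \<longleftrightarrow>
    (\<exists>S. \<forall>i<n. \<forall>j<n. M i j = (\<Sum>k<n. star (S k i) * S k j))"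
  unfolding positive_matrix_def by (simp add: finsum_cstar_of) (simp add: cstar_of_def)

lemma positive_matrix_bfun:
  "positive_matrix (bfun_algebra Y) n M \<longleftrightarrow>
    (\<exists>S. (\<forall>i<n. \<forall>j<n. S i j \<in> bounded_on_zero_off Y) \<and>
      (\<forall>i<n. \<forall>j<n. M i j = (\<lambda>y. \<Sum>k<n. cnj (S k i y) * S k j y)))"
proof -
  have "finsum (bfun_algebra Y) (\<lambda>k. adjoint_op (bfun_algebra Y) (S k i) \<otimes>\<^bsub>bfun_algebra Y\<^esub> S k j) {..<n}
    = (\<lambda>y. \<Sum>k<n. cnj (S k i y) * S k j y)"
    if "\<forall>i<n. \<forall>j<n. S i j \<in> bounded_on_zero_off Y" "i < n" "j < n" for S i j
    using finsum_bfun[of "{..<n}" "\<lambda>k y. cnj (S k i y) * S k j y" Y] that by simp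
  then show ?thesis
    unfolding positive_matrix_def by (simp cong: conj_cong)
qed

section \<open>The character space of the injective envelope\<close>

lemma cstar_of_sel [simp]:
  "carrier cstar_of = UNIV" "x \<otimes>\<^bsub>cstar_of\<^esub> y = x * y" "\<one>\<^bsub>cstar_of\<^esub> = 1" "\<zero>\<^bsub>cstar_of\<^esub> = 0"
  "x \<oplus>\<^bsub>cstar_of\<^esub> y = x + y" "c \<odot>\<^bsub>cstar_of\<^esub> x = scaleC c x" "adjoint_op cstar_of x = star x"
  by (simp_all add: cstar_of_def)

lemma euclidean_fun_topology: "product_topology (\<lambda>_. euclidean) UNIV = (euclidean :: ('x \<Rightarrow> complex) topology)"
  by (simp add: euclidean_product_topology)

lemma open_fun_basic:
  fixes U :: "('x \<Rightarrow> complex) set"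
  assumes "open U" "f \<in> U"
  obtains W where "finite {i. W i \<noteq> UNIV}" "\<forall>i. open (W i)" "\<forall>i. f i \<in> W i" "\<forall>g. (\<forall>i. g i \<in> W i) \<longrightarrow> g \<in> U"
proof -
  have "openin (product_topology (\<lambda>_. euclidean) UNIV) U"
    using assms(1) by (simp add: euclidean_fun_topology)
  then obtain W where W: "finite {i \<in> UNIV. W i \<noteq> topspace euclidean}" "\<forall>i\<in>UNIV. openin euclidean (W i)"
    "f \<in> Pi\<^sub>E UNIV W" "Pi\<^sub>E UNIV W \<subseteq> U"
    using assms(2) unfolding openin_product_topology_alt by blast
  show thesis
    by (rule that[of W]) (use W in \<open>auto simp: PiE_iff subset_iff\<close>)
qed

lemma open_coordinate_vimage:
  assumes "open S"
  shows "open {f :: 'x \<Rightarrow> complex. f i \<in> S}"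
proof -
  have "open ((\<lambda>f :: 'x \<Rightarrow> complex. f i) -` S)"
    by (rule open_vimage[OF assms]) (rule continuous_on_product_coordinates)
  then show ?thesis by (simp add: vimage_def)
qed

locale envelope =
  fixes D :: "'a::cstar_algebra set" and \<iota> :: "'a \<Rightarrow> 'i::cstar_algebra" and E :: "'a \<Rightarrow> 'i"
  assumes masa: "masa_inclusion D" and env: "injective_envelope D \<iota>" and pe: "pseudo_expectation D \<iota> E"

sublocale envelope \<subseteq> abelian D
  using masa by unfold_locales (simp add: masa_inclusion_def)

sublocale envelope \<subseteq> I: abelian "UNIV :: 'i set"
  using env by unfold_locales (simp add: inclusion_def injective_envelope_def UNIV_subalgebra)

context envelope
begin

abbreviation X :: "('i \<Rightarrow> complex) set" where
  "X \<equiv> characters UNIV"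

text \<open>The map \<pi> of the overview.\<close>

abbreviation pull :: "('i \<Rightarrow> complex) \<Rightarrow> 'a \<Rightarrow> complex" where
  "pull x \<equiv> restrict (x \<circ> \<iota>) D"

lemma iota:
  "d \<in> D \<Longrightarrow> e \<in> D \<Longrightarrow> \<iota> (d + e) = \<iota> d + \<iota> e" "d \<in> D \<Longrightarrow> \<iota> (scaleC c d) = scaleC c (\<iota> d)"
  "d \<in> D \<Longrightarrow> e \<in> D \<Longrightarrow> \<iota> (d * e) = \<iota> d * \<iota> e" "d \<in> D \<Longrightarrow> \<iota> (star d) = star (\<iota> d)"
  "\<iota> 1 = 1" "inj_on \<iota> D"
  using env by (simp_all add: injective_envelope_def unital_injective_star_hom_def)

lemma E_ucp: "ucp cstar_of UNIV cstar_of E"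
  using pe by (simp add: pseudo_expectation_def)

lemma E_linear: "E (x + y) = E x + E y" "E (scaleC c x) = scaleC c (E x)" "E 1 = 1"
  and E_iota: "d \<in> D \<Longrightarrow> E d = \<iota> d"
  using E_ucp pe by (simp_all add: ucp_def pseudo_expectation_def)

lemma E_positive_matrix: "positive_matrix cstar_of n M \<Longrightarrow> positive_matrix cstar_of n (\<lambda>i j. E (M i j))"
  using E_ucp by (simp add: ucp_def)

lemma E_star_mult:
  obtains b where "E (star a * a) = star b * b"
proof -
  have "positive_matrix cstar_of 1 (\<lambda>_ _. star a * a)"
    unfolding positive_matrix_cstar_of by (intro exI[of _ "\<lambda>_ _. a"]) simp
  then have "positive_matrix cstar_of 1 (\<lambda>_ _. E (star a * a))"
    by (rule E_positive_matrix)
  then obtain S :: "nat \<Rightarrow> nat \<Rightarrow> 'i" where "\<forall>i<1::nat. \<forall>j<1::nat. E (star a * a) = (\<Sum>k<1::nat. star (S k i) * S k j)"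
    unfolding positive_matrix_cstar_of by blast
  then have "E (star a * a) = star (S 0 0) * S 0 0" by simp
  then show thesis by (rule that)
qed

lemma pull_character:
  assumes x: "x \<in> X"
  shows "pull x \<in> characters D"
  unfolding characters_def
  by (auto simp: mem iota I.characterD[OF x])

lemma comp_E_Mod:
  assumes x: "x \<in> X"
  shows "x \<circ> E \<in> Mod D" "restrict (x \<circ> E) D = pull x"
proof -
  show r: "restrict (x \<circ> E) D = pull x"
    by (auto simp: restrict_def E_iota)
  have "state (x \<circ> E)"
    unfolding state_def
  proof (intro conjI allI)
    show "Vector_Spaces.linear scaleC (*) (x \<circ> E)"
      by unfold_locales (simp_all add: E_linear I.characterD[OF x] algebra_simps)
    show "(x \<circ> E) 1 = 1" by (simp add: E_linear I.characterD[OF x])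
    fix a
    obtain b where "E (star a * a) = star b * b" by (rule E_star_mult)
    then show "(x \<circ> E) (star a * a) \<in> \<real>\<^sub>\<ge>\<^sub>0"
      using I.character_star_mult[OF x, of b] by (simp add: complex_nonneg_Reals_iff)
  qed
  with r pull_character[OF x] show "x \<circ> E \<in> Mod D" by (simp add: Mod_def)
qed

text \<open>The hypothesis on Y says in algebraic form that its image in the character space of D is
  dense. The element m is self-adjoint since \<open>star m - m\<close> vanishes on Y, and its
  negative part p is zero for the same reason.\<close>

lemma nonneg_transfer:
  assumes Y: "Y \<subseteq> X" and inj: "\<And>d. d \<in> D \<Longrightarrow> (\<And>y. y \<in> Y \<Longrightarrow> y (\<iota> d) = 0) \<Longrightarrow> d = 0"
    and m: "m \<in> D" "\<And>y. y \<in> Y \<Longrightarrow> y (\<iota> m) \<in> \<real>\<^sub>\<ge>\<^sub>0" and \<tau>: "\<tau> \<in> characters D"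
  shows "0 \<le> Re (\<tau> m)"
proof -
  have ch: "pull y \<in> characters D" if "y \<in> Y" for y
    using that Y by (intro pull_character) auto
  have re: "cnj (y (\<iota> m)) = y (\<iota> m)" if "y \<in> Y" for y
    using m(2)[OF that] by (auto simp: complex_nonneg_Reals_iff complex_eq_iff)
  have "star m - m = 0"
  proof (rule inj)
    show "star m - m \<in> D" using m by (simp add: mem)
    fix y assume y: "y \<in> Y"
    have "pull y (star m - m) = 0"
      using re[OF y] m(1) by (simp only: characterD(7)[OF ch[OF y]] mem(7) character_star[OF ch[OF y]]) simp
    then show "y (\<iota> (star m - m)) = 0" using m(1) by (simp add: mem)
  qed
  then have "- m \<in> sa" using m(1) by (auto simp: sa_def self_adjoint_def star_minus mem)
  then obtain p where p: "p \<in> sa" "\<And>\<tau>. \<tau> \<in> characters D \<Longrightarrow> \<tau> p = of_real (max 0 (Re (\<tau> (- m))))"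
    using positive_part by blast
  have pD: "p \<in> D" using p(1) by (rule saD)
  have "p = 0"
  proof (rule inj[OF pD])
    fix y assume y: "y \<in> Y"
    have "pull y (- m) = - y (\<iota> m)" using m(1) characterD(6)[OF ch[OF y] m(1)] by simp
    then show "y (\<iota> p) = 0"
      using p(2)[OF ch[OF y]] m(2)[OF y] pD by (simp add: complex_nonneg_Reals_iff)
  qed
  then have "max 0 (Re (\<tau> (- m))) = 0"
    using p(2)[OF \<tau>] characterD(5)[OF \<tau>] by simp
  then show ?thesis using characterD(6)[OF \<tau> m(1)] by (simp add: max_def split: if_splits)
qed

text \<open>
  Essentiality, tested against the restriction to \<open>Y\<close> of the Gelfand transform of \<open>'i\<close>: an
  ideal of \<open>'i\<close> meeting \<open>\<iota> D\<close> only in zero vanishes.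
\<close>

lemma essential_vanishing:
  assumes Y: "Y \<subseteq> X" and inj: "\<And>d. d \<in> D \<Longrightarrow> (\<And>y. y \<in> Y \<Longrightarrow> y (\<iota> d) = 0) \<Longrightarrow> d = 0"
    and f: "\<And>y. y \<in> Y \<Longrightarrow> y f = 0"
  shows "f = 0"
proof -
  define \<phi> where "\<phi> g = (\<lambda>y. if y \<in> Y then y g else 0)" for g
  let ?T = "bfun_algebra Y"
  have YX: "y \<in> X" if "y \<in> Y" for y using that Y by auto
  have \<phi>B [simp]: "\<phi> g \<in> bounded_on_zero_off Y" for g
    by (rule bounded_on_zero_offI[of _ _ "norm g"]) (auto simp: \<phi>_def I.character_le_norm[OF YX])
  have \<phi>_add: "\<phi> (g + h) = (\<lambda>y. \<phi> g y + \<phi> h y)" for g h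
    by (auto simp: \<phi>_def I.characterD[OF YX])
  have \<phi>_scale: "\<phi> (scaleC c g) = (\<lambda>y. c * \<phi> g y)" for c g
    by (auto simp: \<phi>_def I.characterD[OF YX])
  have \<phi>_1: "\<phi> 1 = (\<lambda>y. if y \<in> Y then 1 else 0)"
    by (auto simp: \<phi>_def I.characterD[OF YX])
  have \<phi>_pos: "positive_matrix ?T n (\<lambda>i j. \<phi> (M i j))" if pos: "positive_matrix cstar_of n M" for n M
  proof -
    from pos obtain S where S: "\<And>i j. i < n \<Longrightarrow> j < n \<Longrightarrow> M i j = (\<Sum>k<n. star (S k i) * S k j)"
      unfolding positive_matrix_cstar_of by blast
    show ?thesis
      unfolding positive_matrix_bfun
    proof (intro exI[of _ "\<lambda>i j. \<phi> (S i j)"] conjI allI impI ext)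
      fix i j y assume ij: "i < n" "j < n"
      show "\<phi> (M i j) y = (\<Sum>k<n. cnj (\<phi> (S k i) y) * \<phi> (S k j) y)"
      proof (cases "y \<in> Y")
        case True
        have "y (M i j) = (\<Sum>k<n. y (star (S k i) * S k j))"
          unfolding S[OF ij] by (rule I.character_sum[OF YX[OF True]]) simp
        also have "\<dots> = (\<Sum>k<n. cnj (y (S k i)) * y (S k j))"
          by (intro sum.cong refl) (simp add: I.characterD[OF YX[OF True]] I.character_star[OF YX[OF True]])
        finally show ?thesis using True by (simp add: \<phi>_def)
      qed (simp add: \<phi>_def)
    qed simp
  qed
  have ucp_\<phi>: "ucp cstar_of UNIV ?T \<phi>"
    unfolding ucp_def using \<phi>_pos by (auto simp: \<phi>_add \<phi>_scale \<phi>_1)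
  have ucp_\<phi>\<iota>: "ucp cstar_of D ?T (\<phi> \<circ> \<iota>)"
    unfolding ucp_def
  proof (intro conjI ballI allI impI)
    fix n M assume MD: "\<forall>i<n. \<forall>j<n. M i j \<in> D" and "positive_matrix cstar_of n M"
    \<comment> \<open>On D the embedding agrees with E, from which it inherits complete
      positivity.\<close>
    then have "positive_matrix cstar_of n (\<lambda>i j. E (M i j))" by (intro E_positive_matrix)
    with MD have "positive_matrix cstar_of n (\<lambda>i j. \<iota> (M i j))"
      unfolding positive_matrix_cstar_of by (simp add: E_iota)
    then show "positive_matrix ?T n (\<lambda>i j. (\<phi> \<circ> \<iota>) (M i j))"
      using \<phi>_pos by simp
  qed (auto simp: iota \<phi>_add \<phi>_scale \<phi>_1)
  have "positive_matrix cstar_of n M"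
    if MD: "\<forall>i<n. \<forall>j<n. M i j \<in> D" and pos: "positive_matrix ?T n (\<lambda>i j. (\<phi> \<circ> \<iota>) (M i j))" for n M
  proof -
    have MD': "M i j \<in> D" if "i < n" "j < n" for i j using MD that by blast
    from pos obtain S where S: "\<And>i j. i < n \<Longrightarrow> j < n \<Longrightarrow> \<phi> (\<iota> (M i j)) = (\<lambda>y. \<Sum>k<n. cnj (S k i y) * S k j y)"
      unfolding positive_matrix_bfun by auto
    have yM: "y (\<iota> (M i j)) = (\<Sum>k<n. cnj (S k i y) * S k j y)" if "i < n" "j < n" "y \<in> Y" for i j y
      using fun_cong[OF S[OF that(1,2)], of y] that(3) by (simp add: \<phi>_def)
    have herm: "star (M i j) = M j i" if ij: "i < n" "j < n" for i j
    proof -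
      have "star (M i j) - M j i = 0"
      proof (rule inj)
        show "star (M i j) - M j i \<in> D" using MD' ij by (simp add: mem)
        fix y assume y: "y \<in> Y"
        note ch = pull_character[OF YX[OF y]]
        have "pull y (star (M i j) - M j i) = cnj (pull y (M i j)) - pull y (M j i)"
          using MD' ij by (simp only: characterD(7)[OF ch] mem(7) character_star[OF ch])
        also have "\<dots> = cnj (y (\<iota> (M i j))) - y (\<iota> (M j i))"
          using MD' ij by simp
        also have "\<dots> = 0"
          unfolding yM[OF ij y] yM[OF ij(2,1) y] by (simp add: mult.commute)
        finally show "y (\<iota> (star (M i j) - M j i)) = 0" using MD' ij by (simp add: mem)
      qed
      then show ?thesis by simp
    qed
    have psd: "0 \<le> Re (\<Sum>i<n. \<Sum>j<n. cnj (z i) * \<tau> (M i j) * z j)" if \<tau>: "\<tau> \<in> characters D" for \<tau> z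
    proof -
      \<comment> \<open>For fixed z the quadratic form is the value of one element of D, so
        positivity passes from Y to all characters of D by \<open>nonneg_transfer\<close>.\<close>
      define m where "m = (\<Sum>i<n. \<Sum>j<n. scaleC (cnj (z i) * z j) (M i j))"
      have mD: "m \<in> D" unfolding m_def by (intro mem(11) mem(5) MD') auto
      have form: "\<sigma> m = (\<Sum>i<n. \<Sum>j<n. cnj (z i) * \<sigma> (M i j) * z j)" if \<sigma>: "\<sigma> \<in> characters D" for \<sigma>
      proof -
        have "\<sigma> m = (\<Sum>i<n. \<sigma> (\<Sum>j<n. scaleC (cnj (z i) * z j) (M i j)))"
          unfolding m_def by (rule character_sum[OF \<sigma>]) (intro mem(11) mem(5) MD', auto)
        also have "\<dots> = (\<Sum>i<n. \<Sum>j<n. \<sigma> (scaleC (cnj (z i) * z j) (M i j)))"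
          by (intro sum.cong refl character_sum[OF \<sigma>] mem(5) MD') auto
        also have "\<dots> = (\<Sum>i<n. \<Sum>j<n. cnj (z i) * \<sigma> (M i j) * z j)"
          by (intro sum.cong refl) (simp add: characterD(2)[OF \<sigma>] MD' mult_ac)
        finally show ?thesis .
      qed
      have "0 \<le> Re (\<tau> m)"
      proof (rule nonneg_transfer[OF Y inj mD _ \<tau>])
        fix y assume y: "y \<in> Y"
        have "y (\<iota> m) = (\<Sum>i<n. \<Sum>j<n. cnj (z i) * pull y (M i j) * z j)"
          using form[OF pull_character[OF YX[OF y]]] mD by simp
        also have "\<dots> = (\<Sum>i<n. \<Sum>j<n. cnj (z i) * (\<Sum>k<n. cnj (S k i y) * S k j y) * z j)"
          using MD' by (intro sum.cong refl) (simp add: yM[OF _ _ y])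
        also have "\<dots> = (\<Sum>i<n. \<Sum>j<n. \<Sum>k<n. cnj (S k i y * z i) * (S k j y * z j))"
          by (simp add: sum_distrib_left sum_distrib_right mult_ac)
        also have "\<dots> = (\<Sum>i<n. \<Sum>k<n. \<Sum>j<n. cnj (S k i y * z i) * (S k j y * z j))"
          by (intro sum.cong refl sum.swap)
        also have "\<dots> = (\<Sum>k<n. \<Sum>i<n. \<Sum>j<n. cnj (S k i y * z i) * (S k j y * z j))"
          by (rule sum.swap)
        also have "\<dots> = (\<Sum>k<n. cnj (\<Sum>i<n. S k i y * z i) * (\<Sum>j<n. S k j y * z j))"
          unfolding cnj_sum sum_product by simp
        also have "\<dots> = of_real (\<Sum>k<n. (cmod (\<Sum>i<n. S k i y * z i))\<^sup>2)"
          unfolding of_real_sum by (intro sum.cong refl) (simp add: complex_norm_square mult.commute del: of_real_power)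
        finally show "y (\<iota> m) \<in> \<real>\<^sub>\<ge>\<^sub>0"
          by (simp only: nonneg_Reals_of_real_iff sum_nonneg zero_le_power2)
      qed
      then show ?thesis by (simp only: form[OF \<tau>])
    qed
    obtain S' where "\<And>i j. i < n \<Longrightarrow> j < n \<Longrightarrow> M i j = (\<Sum>k<n. star (S' k i) * S' k j)"
      by (rule positive_matrix_factorization[of n M]) (use MD' herm psd in auto)
    then show ?thesis unfolding positive_matrix_cstar_of by blast
  qed
  with ucp_\<phi>\<iota> have "complete_order_embedding cstar_of D ?T (\<phi> \<circ> \<iota>)"
    unfolding complete_order_embedding_def by blast
  moreover have "essential_extension D \<iota>" using env by (simp add: injective_envelope_def)
  ultimately have "complete_order_embedding cstar_of UNIV ?T \<phi>"
    using ucp_\<phi> cstar_bfun[of Y] unfolding essential_extension_def by blast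
  then have reflect: "positive_matrix ?T n (\<lambda>i j. \<phi> (M i j)) \<Longrightarrow> positive_matrix cstar_of n M" for n M
    unfolding complete_order_embedding_def by simp
  \<comment> \<open>The map \<phi> sends g to 0, which is positive; order reflection makes g
    positive although it is minus a square, and this forces f = 0.\<close>
  define g where "g = - (star f * f)"
  have "\<phi> g = (\<lambda>_. 0)"
    using f by (auto simp: \<phi>_def g_def I.characterD[OF YX])
  then have "positive_matrix ?T 1 (\<lambda>_ _. \<phi> g)"
    unfolding positive_matrix_bfun by (intro exI[of _ "\<lambda>_ _ _. 0"]) simp
  then have "positive_matrix cstar_of 1 (\<lambda>_ _. g)" by (rule reflect)
  then obtain S :: "nat \<Rightarrow> nat \<Rightarrow> 'i" where "\<forall>i<1::nat. \<forall>j<1::nat. g = (\<Sum>k<1::nat. star (S k i) * S k j)"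
    unfolding positive_matrix_cstar_of by blast
  then have gb: "g = star (S 0 0) * S 0 0" by simp
  show "f = 0"
  proof (rule I.character_separates)
    fix x assume x: "x \<in> X"
    have "x g = - of_real ((cmod (x f))\<^sup>2)"
      unfolding g_def using I.character_star_mult[OF x, of f] by (simp only: I.characterD(6)[OF x UNIV_I] UNIV_I)
    moreover have "x g = of_real ((cmod (x (S 0 0)))\<^sup>2)"
      unfolding gb by (rule I.character_star_mult[OF x UNIV_I])
    ultimately have "of_real ((cmod (x (S 0 0)))\<^sup>2 + (cmod (x f))\<^sup>2) = (0 :: complex)" by simp
    then have "(cmod (x (S 0 0)))\<^sup>2 + (cmod (x f))\<^sup>2 = 0" by (simp only: of_real_eq_0_iff)
    then have "x f = 0" by (simp add: add_nonneg_eq_0_iff)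
    then show "x f = x 0" by (simp add: I.characterD[OF x])
  qed auto
qed

section \<open>Topology of the character space of the envelope\<close>

text \<open>A basic neighbourhood constrains finitely many coordinates. Each b a vanishes at x0 and
  has modulus at least 1 where coordinate a leaves its ball, so the positive part of 1 minus the sum
  of squared moduli is 1 at x0 and 0 off U.\<close>

lemma bump_function:
  assumes U: "open U" and x0: "x0 \<in> X" "x0 \<in> U"
  obtains f where "x0 f \<noteq> 0" "\<forall>x\<in>X. x \<notin> U \<longrightarrow> x f = 0"
proof -
  obtain W where W: "finite {a. W a \<noteq> UNIV}" "\<forall>a. open (W a)" "\<forall>a. x0 a \<in> W a"
    "\<forall>g. (\<forall>a. g a \<in> W a) \<longrightarrow> g \<in> U"
    by (rule open_fun_basic[OF U x0(2)])
  define A where "A = {a. W a \<noteq> UNIV}"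
  have "\<exists>e>0. ball (x0 a) e \<subseteq> W a" for a
    using W(2,3) open_contains_ball by blast
  then obtain e where e: "\<And>a. e a > 0" "\<And>a. ball (x0 a) (e a) \<subseteq> W a" by metis
  define b where "b a = (1 / e a) *\<^sub>R (a - scaleC (x0 a) 1)" for a
  define h where "h = 1 - (\<Sum>a\<in>A. star (b a) * b a)"
  have "h \<in> I.sa"
    unfolding h_def I.sa_def by (simp add: self_adjoint_def star_diff star_sum star_mult star_star)
  then obtain f where f: "f \<in> I.sa" "\<And>x. x \<in> X \<Longrightarrow> x f = of_real (max 0 (Re (x h)))"
    using I.positive_part by blast
  have xb: "x (b a) = of_real (1 / e a) * (x a - x0 a)" if "x \<in> X" for x a
    unfolding b_def by (simp only: I.characterD[OF that] UNIV_I) simp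
  have xh: "x h = of_real (1 - (\<Sum>a\<in>A. (cmod (x (b a)))\<^sup>2))" if x: "x \<in> X" for x
  proof -
    have "x h = 1 - (\<Sum>a\<in>A. x (star (b a) * b a))"
      unfolding h_def by (simp only: I.characterD[OF x] UNIV_I I.character_sum[OF x])
    also have "\<dots> = 1 - (\<Sum>a\<in>A. of_real ((cmod (x (b a)))\<^sup>2))"
      by (simp only: I.character_star_mult[OF x UNIV_I])
    finally show ?thesis by simp
  qed
  show thesis
  proof (rule that[of f])
    show "x0 f \<noteq> 0" using f(2)[OF x0(1)] xh[OF x0(1)] xb[OF x0(1)] by simp
    show "\<forall>x\<in>X. x \<notin> U \<longrightarrow> x f = 0"
    proof (intro ballI impI)
      fix x assume x: "x \<in> X" "x \<notin> U"
      with W(4) obtain a where a: "x a \<notin> W a" by blast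
      then have "a \<in> A" by (auto simp: A_def)
      have "\<not> cmod (x a - x0 a) < e a"
        using a e(2)[of a] by (auto simp: subset_iff dist_norm norm_minus_commute)
      then have "1 \<le> cmod (x (b a))"
        using e(1)[of a] by (simp add: xb[OF x(1)] norm_mult norm_divide field_simps)
      then have "1 \<le> (cmod (x (b a)))\<^sup>2" by (simp add: one_le_power)
      also have "\<dots> \<le> (\<Sum>a\<in>A. (cmod (x (b a)))\<^sup>2)"
        using \<open>a \<in> A\<close> W(1) by (intro member_le_sum) (auto simp: A_def)
      finally show "x f = 0" using f(2)[OF x(1)] xh[OF x(1)] by simp
    qed
  qed
qed

text \<open>Otherwise X - U would detect every element of D, and \<open>essential_vanishing\<close>
  would annihilate the bump function of U.\<close>

lemma nonzero_supported:
  assumes U: "open U" and x0: "x0 \<in> X" "x0 \<in> U"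
  obtains d where "d \<in> D" "d \<noteq> 0" "\<forall>x\<in>X. x (\<iota> d) \<noteq> 0 \<longrightarrow> x \<in> U"
proof -
  obtain f where f: "x0 f \<noteq> 0" "\<forall>x\<in>X. x \<notin> U \<longrightarrow> x f = 0"
    by (rule bump_function[OF U x0])
  have "f \<noteq> 0" using f(1) I.characterD(5)[OF x0(1)] by auto
  have "\<exists>d\<in>D. d \<noteq> 0 \<and> (\<forall>y\<in>X - U. y (\<iota> d) = 0)"
  proof (rule ccontr)
    assume n: "\<not> ?thesis"
    have "f = 0"
    proof (rule essential_vanishing[of "X - U"])
      show "d = 0" if "d \<in> D" "\<And>y. y \<in> X - U \<Longrightarrow> y (\<iota> d) = 0" for d
        using n that by auto
    qed (use f in auto)
    with \<open>f \<noteq> 0\<close> show False ..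
  qed
  then obtain d where d: "d \<in> D" "d \<noteq> 0" "\<forall>y\<in>X - U. y (\<iota> d) = 0" by (elim bexE conjE)
  show thesis by (rule that[OF d(1,2)]) (use d(3) in auto)
qed

lemma compact_X: "compact X"
proof -
  define K :: "('i \<Rightarrow> complex) set" where "K = Pi\<^sub>E UNIV (\<lambda>a. cball 0 (norm a))"
  have "compactin (product_topology (\<lambda>_. euclidean) UNIV) K"
    unfolding K_def by (subst compactin_PiE) (auto simp: compactin_euclidean_iff)
  then have "compact K" by (simp add: euclidean_fun_topology)
  have "X = K \<inter> ((\<Inter>a. \<Inter>b. {x. x (a + b) = x a + x b}) \<inter> (\<Inter>c. \<Inter>a. {x. x (scaleC c a) = c * x a})
      \<inter> (\<Inter>a. \<Inter>b. {x. x (a * b) = x a * x b}) \<inter> {x. x 1 = 1})" (is "_ = K \<inter> ?C")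
  proof
    show "X \<subseteq> K \<inter> ?C"
      using I.character_le_norm by (auto simp: K_def I.characterD)
    show "K \<inter> ?C \<subseteq> X"
      by (auto simp: characters_def)
  qed
  moreover have "closed ?C"
    by (intro closed_Int closed_INT ballI closed_Collect_eq continuous_intros continuous_on_product_coordinates)
  ultimately show ?thesis using \<open>compact K\<close> by (simp add: compact_Int_closed)
qed

text \<open>If \<tau> were missed, compactness would give finitely many elements of the kernel of
  \<tau> whose sum m of squared moduli is at least some r > 0 on X. The positive part of r - m then
  vanishes on X, hence is zero as the embedding is injective, yet its value at \<tau> is r.\<close>

lemma pull_surj:
  assumes \<tau>: "\<tau> \<in> characters D"
  obtains x where "x \<in> X" "pull x = \<tau>"
proof (rule ccontr)
  assume "\<not> thesis"
  with that have ne: "pull x \<noteq> \<tau>" if "x \<in> X" for x using that by blast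
  define Z where "Z = {d \<in> D. \<tau> d = 0}"
  have cover: "\<exists>d\<in>Z. x (\<iota> d) \<noteq> 0" if x: "x \<in> X" for x
  proof -
    have "\<exists>e\<in>D. pull x e \<noteq> \<tau> e"
    proof (rule ccontr)
      assume "\<not> ?thesis"
      then have "pull x = \<tau>"
        by (intro extensionalityI[OF characterD(9)[OF pull_character[OF x]] characterD(9)[OF \<tau>]]) auto
      with ne[OF x] show False ..
    qed
    then obtain e where e: "e \<in> D" "x (\<iota> e) \<noteq> \<tau> e" by auto
    define d where "d = e - scaleC (\<tau> e) 1"
    have d: "d \<in> D" using e by (simp add: d_def mem)
    have "\<tau> d = 0" using e by (simp add: d_def characterD[OF \<tau>] mem)
    moreover have "pull x d = pull x e - \<tau> e"
      unfolding d_def by (simp only: characterD[OF pull_character[OF x]] e(1) mem(5,8)) simp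
    then have "x (\<iota> d) \<noteq> 0" using e d by simp
    ultimately show ?thesis using d by (auto simp: Z_def)
  qed
  have op: "open {x :: 'i \<Rightarrow> complex. x (\<iota> d) \<noteq> 0}" for d
    using open_coordinate_vimage[OF open_Compl[OF closed_singleton[of 0]], of "\<iota> d"] by simp
  obtain F where F: "F \<subseteq> Z" "finite F" "X \<subseteq> (\<Union>d\<in>F. {x. x (\<iota> d) \<noteq> 0})"
    by (rule compactE_image[OF compact_X, of Z "\<lambda>d. {x. x (\<iota> d) \<noteq> 0}"]) (use cover op in auto)
  have FD: "d \<in> D" if "d \<in> F" for d using that F(1) by (auto simp: Z_def)
  define m where "m = (\<Sum>d\<in>F. star d * d)"
  have mD: "m \<in> D" unfolding m_def by (intro mem FD)
  have val: "\<sigma> m = of_real (\<Sum>d\<in>F. (cmod (\<sigma> d))\<^sup>2)" if \<sigma>: "\<sigma> \<in> characters D" for \<sigma>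
  proof -
    have "\<sigma> m = (\<Sum>d\<in>F. \<sigma> (star d * d))"
      unfolding m_def by (rule character_sum[OF \<sigma>]) (intro mem FD)
    then show ?thesis unfolding of_real_sum by (simp only: character_star_mult[OF \<sigma> FD] cong: sum.cong)
  qed
  have pos: "Re (x (\<iota> m)) > 0" if x: "x \<in> X" for x
  proof -
    obtain d where d: "d \<in> F" "x (\<iota> d) \<noteq> 0" using F(3) x by auto
    have "x (\<iota> m) = of_real (\<Sum>d\<in>F. (cmod (pull x d))\<^sup>2)"
      using val[OF pull_character[OF x]] mD by simp
    moreover have "(\<Sum>d\<in>F. (cmod (pull x d))\<^sup>2) > 0"
      using d FD F(2) by (intro sum_pos2[of _ d]) auto
    ultimately show ?thesis by simp
  qed
  obtain x' where "x' \<in> X" using I.character_attains_norm[of 1] by blast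
  then have "X \<noteq> {}" by blast
  have "continuous_on X (\<lambda>x. Re (x (\<iota> m)))"
    by (intro continuous_intros continuous_on_product_coordinates[THEN continuous_on_subset]) simp
  then obtain x1 where x1: "x1 \<in> X" "\<And>x. x \<in> X \<Longrightarrow> Re (x1 (\<iota> m)) \<le> Re (x (\<iota> m))"
    using continuous_attains_inf[OF compact_X \<open>X \<noteq> {}\<close>] by blast
  define r where "r = Re (x1 (\<iota> m))"
  have "r > 0" using pos[OF x1(1)] by (simp add: r_def)
  have "m \<in> sa"
    using mD by (rule sa_iff_character) (simp only: val Reals_of_real)
  then have rm: "r *\<^sub>R 1 - m \<in> sa" by (intro sa_intros)
  have rmv: "\<sigma> (r *\<^sub>R 1 - m) = of_real r - \<sigma> m" if "\<sigma> \<in> characters D" for \<sigma>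
    using mD by (simp add: characterD[OF that] mem)
  obtain p where p: "p \<in> sa" "\<And>\<sigma>. \<sigma> \<in> characters D \<Longrightarrow> \<sigma> p = of_real (max 0 (Re (\<sigma> (r *\<^sub>R 1 - m))))"
    using positive_part[OF rm] by blast
  have pD: "p \<in> D" using p(1) by (rule saD)
  have "\<iota> p = 0"
  proof (rule I.character_separates)
    fix x assume x: "x \<in> X"
    note ch = pull_character[OF x]
    have "pull x p = 0"
      using p(2)[OF ch] rmv[OF ch] x1(2)[OF x] mD by (simp add: r_def)
    then show "x (\<iota> p) = x 0" using pD by (simp add: I.characterD[OF x])
  qed auto
  moreover have "\<iota> 0 = 0" using iota(2)[OF mem(9), of 0] by simp
  ultimately have "p = 0" using inj_onD[OF iota(6), of p 0] pD mem(9) by simp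
  moreover have "\<tau> m = 0"
    using val[OF \<tau>] F(1) by (simp add: Z_def subset_iff)
  ultimately show False
    using p(2)[OF \<tau>] rmv[OF \<tau>] \<open>r > 0\<close> characterD(5)[OF \<tau>] by simp
qed

section \<open>Generic points\<close>

definition regular_points :: "'a \<Rightarrow> ('i \<Rightarrow> complex) set" where
  "regular_points v = {x \<in> X. moved v (pull x) \<or> locally_in v (pull x)}"

lemma regular_points_open:
  assumes v: "v \<in> normalizers D"
  shows "openin (top_of_set X) (regular_points v)"
proof -
  let ?O = "(\<Union>e\<in>D. {x :: 'i \<Rightarrow> complex. x (\<iota> (star v * e * v)) \<noteq> x (\<iota> (star v * v)) * x (\<iota> e)})
    \<union> (\<Union>d\<in>{d \<in> D. v * d \<in> D}. {x. x (\<iota> d) \<noteq> 0})"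
  have "regular_points v = X \<inter> ?O"
    unfolding regular_points_def moved_def locally_in_def
    using normalizerD[OF v] by auto
  moreover have "open ?O"
    by (intro open_Un open_UN ballI open_Collect_neq continuous_on_mult continuous_on_const continuous_on_product_coordinates)
  ultimately show ?thesis by (auto simp: openin_open)
qed

text \<open>Take d supported in U. If v moves no character in the support of d, then v d is in D and
  d itself witnesses \<open>locally_in\<close> at any such character. Surjectivity of
  \<open>pull\<close> lifts the character found to X, and the support condition places the lift in
  U.\<close>

lemma regular_points_dense:
  assumes v: "v \<in> normalizers D" and U: "open U" "x0 \<in> X" "x0 \<in> U"
  obtains x where "x \<in> U" "x \<in> regular_points v"
proof -
  obtain d where d: "d \<in> D" "d \<noteq> 0" "\<forall>x\<in>X. x (\<iota> d) \<noteq> 0 \<longrightarrow> x \<in> U"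
    by (rule nonzero_supported[OF U])
  have "\<exists>\<tau>\<in>characters D. \<tau> d \<noteq> 0 \<and> (moved v \<tau> \<or> locally_in v \<tau>)"
  proof (cases "\<exists>\<tau>\<in>characters D. \<tau> d \<noteq> 0 \<and> moved v \<tau>")
    case False
    then have "v * d \<in> D"
      using masa_moved_or_locally_in[OF masa v d(1)] by blast
    obtain \<tau> where \<tau>: "\<tau> \<in> characters D" "cmod (\<tau> d) = norm d"
      by (rule character_attains_norm[OF d(1)])
    then have "\<tau> d \<noteq> 0" using d(2) by auto
    with \<tau>(1) d(1) \<open>v * d \<in> D\<close> show ?thesis unfolding locally_in_def by blast
  qed auto
  then obtain \<tau> where \<tau>: "\<tau> \<in> characters D" "\<tau> d \<noteq> 0" "moved v \<tau> \<or> locally_in v \<tau>" by blast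
  obtain x where x: "x \<in> X" "pull x = \<tau>" by (rule pull_surj[OF \<tau>(1)])
  have "x (\<iota> d) \<noteq> 0" using \<tau>(2) x(2) d(1) by auto
  then have "x \<in> U" using d(3) x(1) by blast
  moreover have "x \<in> regular_points v" using x \<tau>(3) by (simp add: regular_points_def)
  ultimately show thesis by (rule that)
qed

lemma generic_point:
  assumes V: "countable V" "V \<subseteq> normalizers D" and U: "open U" "x0 \<in> X" "x0 \<in> U"
  obtains x where "x \<in> X" "x \<in> U" "\<forall>v\<in>V. x \<in> regular_points v"
proof -
  let ?X = "top_of_set X"
  have H: "Hausdorff_space ?X"
    by (intro Hausdorff_space_subtopology)
      (simp add: Hausdorff_space_product_topology flip: euclidean_fun_topology)
  have C: "compact_space ?X"
    using compact_X by (simp add: compact_space_subtopology)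
  \<comment> \<open>Inserting X keeps the intersection inside X even when V is empty.\<close>
  let ?G = "insert X (regular_points ` V)"
  have "?X closure_of (\<Inter>?G) = topspace ?X"
  proof (rule Baire_category)
    show "completely_metrizable_space ?X \<or> locally_compact_space ?X \<and> regular_space ?X"
      using H C by (simp add: compact_imp_locally_compact_space compact_Hausdorff_imp_regular_space)
    show "countable ?G" using V by simp
    fix T assume "T \<in> ?G"
    then consider "T = X" | v where "v \<in> V" "T = regular_points v" by auto
    then show "openin ?X T \<and> ?X closure_of T = topspace ?X"
    proof cases
      case 1
      then show ?thesis using closure_of_topspace[of ?X] openin_topspace[of ?X] by simp
    next
      case 2
      then have v: "v \<in> normalizers D" using V by auto
      have "X \<subseteq> ?X closure_of T"
      proof
        fix y assume y: "y \<in> X"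
        show "y \<in> ?X closure_of T"
          unfolding in_closure_of
        proof (intro conjI allI impI)
          show "y \<in> topspace ?X" using y by simp
          fix T' assume "y \<in> T' \<and> openin ?X T'"
          then obtain W where W: "open W" "T' = X \<inter> W" "y \<in> W" by (auto simp: openin_open)
          obtain x where "x \<in> W" "x \<in> regular_points v"
            by (rule regular_points_dense[OF v W(1) y W(3)])
          then show "\<exists>x. x \<in> T \<and> x \<in> T'"
            using W 2 by (auto simp: regular_points_def)
        qed
      qed
      then show ?thesis
        using regular_points_open[OF v] 2 closure_of_subset_topspace[of ?X T] by auto
    qed
  qed
  then have "x0 \<in> ?X closure_of (\<Inter>?G)" using U by simp
  moreover have "openin ?X (X \<inter> U)" using U by (auto simp: openin_open)
  ultimately obtain x where "x \<in> \<Inter>?G" "x \<in> X \<inter> U"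
    unfolding in_closure_of using U by blast
  then show thesis by (intro that[of x]) auto
qed

lemma regular_points_agree:
  assumes "x \<in> regular_points v" "v \<in> normalizers D" "\<rho> \<in> Mod D" "\<sigma> \<in> Mod D"
    "restrict \<rho> D = pull x" "restrict \<sigma> D = pull x"
  shows "\<rho> v = \<sigma> v"
  using assms by (intro Mod_agree) (auto simp: regular_points_def)

text \<open>D is in the multiplicative domain of both states, so multiplying by d on either side
  scales their values by the same number.\<close>

lemma agree_set:
  assumes "\<rho> \<in> Mod D" "\<sigma> \<in> Mod D" "restrict \<rho> D = restrict \<sigma> D"
  shows "closed_bimodule D {a. \<rho> a = \<sigma> a}"
proof -
  note st = Mod_state[OF assms(1)] Mod_state[OF assms(2)]
  have eq: "\<rho> d = \<sigma> d" if "d \<in> D" for d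
    using fun_cong[OF assms(3), of d] that by simp
  have "closed {a. \<rho> a = \<sigma> a}"
    by (intro closed_Collect_eq state_continuous st)
  moreover have "complex_vector.subspace {a. \<rho> a = \<sigma> a}"
    by (rule complex_vector.subspaceI) (auto simp: stateD[OF st(1)] stateD[OF st(2)])
  ultimately show ?thesis
    unfolding closed_bimodule_def
    by (auto simp: Mod_mult_left[OF assms(1)] Mod_mult_left[OF assms(2)]
        Mod_mult_right[OF assms(1)] Mod_mult_right[OF assms(2)] eq)
qed

text \<open>A sequence in the span converges to a, and each of its members involves finitely many
  generators. This cuts the normalizers relevant to a down to countably many.\<close>

lemma countable_spanning:
  assumes "a \<in> closure (complex_vector.span N)"
  obtains V where "countable V" "V \<subseteq> N" "a \<in> closure (complex_vector.span (V :: 'a set))"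
proof -
  obtain s where s: "\<And>n. s n \<in> complex_vector.span N" "s \<longlonglongrightarrow> a"
    using assms unfolding closure_sequential by blast
  have "\<exists>t. finite t \<and> t \<subseteq> N \<and> s n \<in> complex_vector.span t" for n
  proof -
    obtain t r where t: "finite t" "t \<subseteq> N" "s n = (\<Sum>a\<in>t. scaleC (r a) a)"
      using s(1)[of n] unfolding complex_vector.span_explicit by auto
    have "s n \<in> complex_vector.span t"
      unfolding t(3) by (intro complex_vector.span_sum complex_vector.span_scale complex_vector.span_base)
    with t show ?thesis by blast
  qed
  then obtain t where t: "\<And>n. finite (t n)" "\<And>n. t n \<subseteq> N" "\<And>n. s n \<in> complex_vector.span (t n)"
    by metis
  define V where "V = (\<Union>n. t n)"
  show thesis
  proof (rule that[of V])
    show "countable V" unfolding V_def using t(1) by (intro countable_UN) (auto intro: countable_finite)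
    show "V \<subseteq> N" unfolding V_def using t(2) by auto
    have "s n \<in> complex_vector.span V" for n
      using t(3)[of n] complex_vector.span_mono[of "t n" V] by (auto simp: V_def)
    then show "a \<in> closure (complex_vector.span V)"
      unfolding closure_sequential using s(2) by blast
  qed
qed

lemma agree_closure_span:
  assumes "\<rho> \<in> Mod D" "\<sigma> \<in> Mod D" "restrict \<rho> D = restrict \<sigma> D" and V: "\<And>v. v \<in> V \<Longrightarrow> \<rho> v = \<sigma> v"
    and a: "a \<in> closure (complex_vector.span V)"
  shows "\<rho> a = \<sigma> a"
proof -
  have M: "closed {a. \<rho> a = \<sigma> a}" "complex_vector.subspace {a. \<rho> a = \<sigma> a}"
    using agree_set[OF assms(1-3)] by (simp_all add: closed_bimodule_def)
  have "complex_vector.span V \<subseteq> {a. \<rho> a = \<sigma> a}"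
    using V M(2) by (intro complex_vector.span_minimal) auto
  then have "closure (complex_vector.span V) \<subseteq> {a. \<rho> a = \<sigma> a}"
    using M(1) by (rule closure_minimal)
  with a show ?thesis by blast
qed

section \<open>Strongly compatible states as limits of generic ones\<close>

lemma Mod_topology_eq: "Mod_topology D = top_of_set (Mod D)"
  by (simp add: Mod_topology_def euclidean_fun_topology)

text \<open>A neighbourhood separating \<rho> from F tests finitely many elements. At a point y
  generic for the countably many normalizers approximating these, the member of F over
  \<open>pull y\<close> agrees with y \<circ> E on the tested elements, so it enters the
  neighbourhood, a contradiction.\<close>

lemma strongly_compatible_subset:
  assumes dense: "closure (complex_vector.span (normalizers D)) = UNIV"
    and F: "closedin (Mod_topology D) F" "(\<lambda>\<rho>. restrict \<rho> D) ` F = characters D"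
  shows "strongly_compatible_states E \<subseteq> F"
proof
  fix \<rho> assume "\<rho> \<in> strongly_compatible_states E"
  then obtain x where x: "x \<in> X" "\<rho> = x \<circ> E" by (auto simp: strongly_compatible_states_def)
  show "\<rho> \<in> F"
  proof (rule ccontr)
    assume "\<rho> \<notin> F"
    obtain G where G: "closed G" "F = Mod D \<inter> G"
      using F(1) unfolding Mod_topology_eq closedin_closed by blast
    have "\<rho> \<in> - G" using \<open>\<rho> \<notin> F\<close> G(2) comp_E_Mod(1)[OF x(1)] x(2) by auto
    obtain W where W: "finite {a. W a \<noteq> UNIV}" "\<forall>a. open (W a)" "\<forall>a. \<rho> a \<in> W a"
      "\<forall>g. (\<forall>a. g a \<in> W a) \<longrightarrow> g \<in> - G"
      by (rule open_fun_basic[OF open_Compl[OF G(1)] \<open>\<rho> \<in> - G\<close>])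
    define A where "A = {a. W a \<noteq> UNIV}"
    have "\<exists>V. countable V \<and> V \<subseteq> normalizers D \<and> a \<in> closure (complex_vector.span V)" for a
    proof -
      have "a \<in> closure (complex_vector.span (normalizers D))" using dense by simp
      then obtain V where "countable V" "V \<subseteq> normalizers D" "a \<in> closure (complex_vector.span V)"
        by (rule countable_spanning)
      then show ?thesis by blast
    qed
    then obtain V where V: "\<And>a. countable (V a)" "\<And>a. V a \<subseteq> normalizers D"
      "\<And>a. a \<in> closure (complex_vector.span (V a))" by metis
    define V' where "V' = (\<Union>a\<in>A. V a)"
    \<comment> \<open>The neighbourhood pulled back along E; only the coordinates in the finite set
      A are restrictive, so U is open.\<close>
    define U where "U = (\<Inter>a\<in>A. {y. y (E a) \<in> W a})"
    have "open U"
      unfolding U_def using W by (intro open_INT ballI open_coordinate_vimage) (auto simp: A_def)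
    have "x \<in> U" using W(3) x(2) by (auto simp: U_def)
    have "countable V'"
      unfolding V'_def A_def by (rule countable_UN[OF countable_finite[OF W(1)] V(1)])
    have "V' \<subseteq> normalizers D"
      using V(2) by (auto simp: V'_def)
    obtain y where y: "y \<in> X" "y \<in> U" "\<forall>v\<in>V'. y \<in> regular_points v"
      by (rule generic_point[OF \<open>countable V'\<close> \<open>V' \<subseteq> normalizers D\<close> \<open>open U\<close> x(1) \<open>x \<in> U\<close>])
    have "pull y \<in> (\<lambda>\<rho>. restrict \<rho> D) ` F" using pull_character[OF y(1)] F(2) by simp
    then obtain \<tau> where \<tau>: "\<tau> \<in> F" "restrict \<tau> D = pull y" by auto
    have \<tau>M: "\<tau> \<in> Mod D" using \<tau>(1) G(2) by auto
    note yM = comp_E_Mod[OF y(1)]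
    have "\<tau> a \<in> W a" for a
    proof (cases "a \<in> A")
      case True
      have "\<tau> a = (y \<circ> E) a"
      proof (rule agree_closure_span[OF \<tau>M yM(1) _ _ V(3)])
        show "restrict \<tau> D = restrict (y \<circ> E) D" using \<tau>(2) yM(2) by simp
        fix v assume "v \<in> V a"
        then have "v \<in> V'" using True by (auto simp: V'_def)
        then show "\<tau> v = (y \<circ> E) v"
          using y(3) \<open>V' \<subseteq> normalizers D\<close> by (intro regular_points_agree[OF _ _ \<tau>M yM(1) \<tau>(2) yM(2)]) auto
      qed
      then show ?thesis using y(2) True by (auto simp: U_def)
    qed (auto simp: A_def)
    then have "\<tau> \<in> - G" using W(4) by blast
    with \<tau>(1) G(2) show False by auto
  qed
qed

text \<open>Any competing state agrees with x \<circ> E on N, hence on the closed bimodule generated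
  by N, which is everything.\<close>

lemma generic_unique_extension:
  assumes hull: "closed_bimodule D hull N = UNIV" and N: "N \<subseteq> normalizers D"
    and x: "x \<in> X" "\<forall>v\<in>N. x \<in> regular_points v"
  shows "x \<circ> E \<in> unique_extension_states D"
proof -
  note xM = comp_E_Mod[OF x(1)]
  have "\<sigma> = x \<circ> E" if \<sigma>: "state \<sigma>" "restrict \<sigma> D = restrict (x \<circ> E) D" for \<sigma>
  proof -
    have \<sigma>M: "\<sigma> \<in> Mod D" using \<sigma> xM(1) by (simp add: Mod_def)
    have "\<sigma> v = (x \<circ> E) v" if "v \<in> N" for v
      using x(2) N that \<sigma>(2) xM(2) by (intro regular_points_agree[OF _ _ \<sigma>M xM(1)]) auto
    then have "N \<subseteq> {a. \<sigma> a = (x \<circ> E) a}" by auto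
    then have "closed_bimodule D hull N \<subseteq> {a. \<sigma> a = (x \<circ> E) a}"
      using agree_set[OF \<sigma>M xM(1) \<sigma>(2)] by (rule hull_minimal)
    then show ?thesis using hull by (auto simp: fun_eq_iff subset_iff)
  qed
  then show ?thesis
    using xM(1) Mod_state[OF xM(1)] unfolding unique_extension_states_def by blast
qed

lemma compact_strongly_compatible: "compact (strongly_compatible_states E)"
proof -
  have "strongly_compatible_states E = (\<lambda>x. x \<circ> E) ` X"
    by (auto simp: strongly_compatible_states_def)
  moreover have "continuous_on X (\<lambda>x. x \<circ> E)"
    by (rule continuous_on_coordinatewise_then_product)
      (auto intro: continuous_on_subset[OF continuous_on_product_coordinates])
  ultimately show ?thesis using compact_X by (simp add: compact_continuous_image)
qed

text \<open>Over every character of D lies some state x \<circ> E; uniqueness identifies it with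
  \<rho>.\<close>

lemma unique_extension_subset: "unique_extension_states D \<subseteq> strongly_compatible_states E"
proof
  fix \<rho> assume \<rho>: "\<rho> \<in> unique_extension_states D"
  then have \<rho>M: "\<rho> \<in> Mod D" and u: "\<exists>!\<sigma>. state \<sigma> \<and> restrict \<sigma> D = restrict \<rho> D"
    by (auto simp: unique_extension_states_def)
  obtain x where x: "x \<in> X" "pull x = restrict \<rho> D"
    by (rule pull_surj[OF Mod_character[OF \<rho>M]])
  have "x \<circ> E = \<rho>"
    using u Mod_state[OF \<rho>M] Mod_state[OF comp_E_Mod(1)[OF x(1)]] comp_E_Mod(2)[OF x(1)] x(2) by auto
  with x(1) show "\<rho> \<in> strongly_compatible_states E" by (auto simp: strongly_compatible_states_def)
qed

text \<open>One inclusion holds because the strongly compatible states form a compact set. For the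
  other, a single residual set of generic points serves all neighbourhoods, and its members give
  states in \<open>unique_extension_states D\<close>.\<close>

lemma strongly_compatible_eq_closure:
  assumes N: "countable N" "N \<subseteq> normalizers D" "closed_bimodule D hull N = UNIV"
  shows "strongly_compatible_states E = Mod_topology D closure_of unique_extension_states D"
proof
  have sub: "strongly_compatible_states E \<subseteq> Mod D"
    using comp_E_Mod(1) by (auto simp: strongly_compatible_states_def)
  have "closed (strongly_compatible_states E)"
  proof -
    have "closedin euclidean (strongly_compatible_states E)"
      using compact_strongly_compatible
      by (intro compactin_imp_closedin)
        (simp_all add: Hausdorff_space_product_topology flip: euclidean_fun_topology, simp add: euclidean_fun_topology)
    then show ?thesis by simp
  qed
  then have "closedin (Mod_topology D) (strongly_compatible_states E)"
    unfolding Mod_topology_eq closedin_closed using sub by blast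
  then show "Mod_topology D closure_of unique_extension_states D \<subseteq> strongly_compatible_states E"
    by (intro closure_of_minimal unique_extension_subset)
  show "strongly_compatible_states E \<subseteq> Mod_topology D closure_of unique_extension_states D"
  proof
    fix \<rho> assume \<rho>: "\<rho> \<in> strongly_compatible_states E"
    then obtain x where x: "x \<in> X" "\<rho> = x \<circ> E" by (auto simp: strongly_compatible_states_def)
    show "\<rho> \<in> Mod_topology D closure_of unique_extension_states D"
      unfolding in_closure_of
    proof (intro conjI allI impI)
      show "\<rho> \<in> topspace (Mod_topology D)" using \<rho> sub by (auto simp: Mod_topology_eq)
      fix T assume T: "\<rho> \<in> T \<and> openin (Mod_topology D) T"
      then obtain W where W: "open W" "T = Mod D \<inter> W"
        unfolding Mod_topology_eq openin_open by blast
      define U where "U = (\<lambda>y. y \<circ> E) -` W"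
      have "open U"
        unfolding U_def by (rule open_vimage[OF W(1)], rule continuous_on_coordinatewise_then_product)
          (auto intro: continuous_on_product_coordinates)
      moreover have "x \<in> U" using T W x by (simp add: U_def)
      ultimately obtain y where y: "y \<in> X" "y \<in> U" "\<forall>v\<in>N. y \<in> regular_points v"
        by (rule generic_point[OF N(1,2) _ x(1)])
      have "y \<circ> E \<in> unique_extension_states D"
        by (rule generic_unique_extension[OF N(3,2) y(1,3)])
      moreover have "y \<circ> E \<in> T"
        using y(2) W(2) comp_E_Mod(1)[OF y(1)] by (simp add: U_def)
      ultimately show "\<exists>\<sigma>. \<sigma> \<in> unique_extension_states D \<and> \<sigma> \<in> T" by blast
    qed
  qed
qed

end

theorem theorem3p13:
  fixes D :: "'a::cstar_algebra set"
    and \<iota> :: "'a \<Rightarrow> 'i::cstar_algebra"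
    and E :: "'a \<Rightarrow> 'i"
  assumes "regular_masa_inclusion D"
    and "injective_envelope D \<iota>"
    and "pseudo_expectation D \<iota> E"
  shows "(\<forall>F. closedin (Mod_topology D) F \<and> (\<lambda>\<rho>. restrict \<rho> D) ` F = characters D \<longrightarrow>
            strongly_compatible_states E \<subseteq> F) \<and>
         ((\<exists>N. countable N \<and> N \<subseteq> normalizers D \<and> closed_bimodule D hull N = UNIV) \<longrightarrow>
            strongly_compatible_states E =
              Mod_topology D closure_of unique_extension_states D)"
proof -
  interpret envelope D \<iota> E
    using assms by unfold_locales (simp_all add: regular_masa_inclusion_def)
  have "closure (complex_vector.span (normalizers D)) = UNIV"
    using assms(1) by (simp add: regular_masa_inclusion_def regular_inclusion_def)
  then show ?thesis
    using strongly_compatible_subset strongly_compatible_eq_closure by blast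
qed

end
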